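(* Let $G$ be a just infinite profinite group that is not virtually pro-$p$ for any prime $p$, and let $\mathcal{C}$ be a class of finite simple groups such that condition $( ** )$ holds. Then there exist critical pairs $(R_n,S_n)$, $n \geq 0$, of $G$ with $R_{n+1} \le S_n$ and $\bigcap_n S_n = 1$, such that, setting $G_n = G/S_{n+1}$, $A_n = R_n/S_{n+1}$, $B_n = S_n/S_{n+1}$, $P_n = R_{n+1}/S_{n+1}$, and letting $\rho_n : G_{n+1}\to G_n$ be the natural quotient maps (so $P_n = \rho_n(A_{n+1})$ and $B_{n+1} = \ker\rho_n$), we have: $G \cong \varprojlim G_n$; for every $n$, $(A_n,B_n)$ is a critical pair in $G_n$, $A_n/B_n$ is a direct power of a group in $\mathcal{C}$, and $P_nC_{G_n}(P_n) \leq B_n$. If $G$ is moreover hereditarily just infinite, the pairs can additionally be chosen so that for every $n$, every subgroup of $G_n$ normalised by $A_n$ either contains $P_nC_{G_n}(P_n)$ or is contained in every maximal normal subgroup of $A_n$ (or both); and then no normal subgroup of $G_n$ containing $A_n$ is centrally decomposable.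
   Context: All groups are profinite, homomorphisms continuous, subgroups closed. A profinite group is \emph{just infinite} if it is infinite and every non-trivial closed normal subgroup has finite index; \emph{hereditarily just infinite} if moreover every open subgroup is just infinite. For normal subgroups $B<A$ of $G$, $(A,B)$ is a \emph{critical pair} in $G$ if $B$ contains every normal subgroup of $G$ properly contained in $A$. Condition $( ** )$ on $G$ and a class $\mathcal{C}$ of finite simple groups (possibly including cyclic groups of prime order): for every integer $n$ there is a finite continuous image $G/N$ of $G$ and a composition series of $G/N$ with at least $n$ factors in $\mathcal{C}$; and for every prime $p$, if $\mathcal{C}$ contains the cyclic group of order $p$ then $\mathcal{C}$ contains every non-abelian finite simple group whose Schur multiplier has order divisible by $p$. A finite group is a \emph{central product} of subgroups $\{H_i\}$ if they generate it and $[H_i,H_j]=1$ for $i\ne j$; it is \emph{centrally decomposable} if it is a central product of proper subgroups. *)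

theory Defs
  imports "HOL-Analysis.Analysis" "HOL-Algebra.Algebra"
begin

definition topological_group :: "'a monoid \<Rightarrow> 'a topology \<Rightarrow> bool" where
  "topological_group G T \<longleftrightarrow> group G \<and> topspace T = carrier G \<and>
     continuous_map (prod_topology T T) T (\<lambda>(x,y). x \<otimes>\<^bsub>G\<^esub> y) \<and>
     continuous_map T T (\<lambda>x. inv\<^bsub>G\<^esub> x)"

definition profinite_group :: "'a monoid \<Rightarrow> 'a topology \<Rightarrow> bool" where
  "profinite_group G T \<longleftrightarrow> topological_group G T \<and> compact_space T \<and> Hausdorff_space T \<and>
     (\<forall>x\<in>topspace T. connected_component_of_set T x = {x})"

text \<open>Subgroups of profinite groups are understood to be closed.\<close>
definition closed_normal :: "'a monoid \<Rightarrow> 'a topology \<Rightarrow> 'a set \<Rightarrow> bool" where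
  "closed_normal G T N \<longleftrightarrow> N \<lhd> G \<and> closedin T N"

definition closed_subgroup :: "'a monoid \<Rightarrow> 'a topology \<Rightarrow> 'a set \<Rightarrow> bool" where
  "closed_subgroup G T H \<longleftrightarrow> subgroup H G \<and> closedin T H"

definition just_infinite :: "'a monoid \<Rightarrow> 'a topology \<Rightarrow> bool" where
  "just_infinite G T \<longleftrightarrow> infinite (carrier G) \<and>
     (\<forall>N. closed_normal G T N \<and> N \<noteq> {\<one>\<^bsub>G\<^esub>} \<longrightarrow> finite (rcosets\<^bsub>G\<^esub> N))"

definition hereditarily_just_infinite :: "'a monoid \<Rightarrow> 'a topology \<Rightarrow> bool" where
  "hereditarily_just_infinite G T \<longleftrightarrow> just_infinite G T \<and>
     (\<forall>H. subgroup H G \<and> openin T H \<longrightarrow> just_infinite (G\<lparr>carrier := H\<rparr>) (subtopology T H))"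

definition pro_p :: "'a monoid \<Rightarrow> 'a topology \<Rightarrow> nat \<Rightarrow> bool" where
  "pro_p G T p \<longleftrightarrow> profinite_group G T \<and>
     (\<forall>N. N \<lhd> G \<and> openin T N \<longrightarrow> (\<exists>k. card (rcosets\<^bsub>G\<^esub> N) = p ^ k))"

definition virtually_pro_p :: "'a monoid \<Rightarrow> 'a topology \<Rightarrow> nat \<Rightarrow> bool" where
  "virtually_pro_p G T p \<longleftrightarrow>
     (\<exists>U. subgroup U G \<and> openin T U \<and> pro_p (G\<lparr>carrier := U\<rparr>) (subtopology T U) p)"

definition quot_top :: "'a monoid \<Rightarrow> 'a topology \<Rightarrow> 'a set \<Rightarrow> 'a set topology" where
  "quot_top G T N = topology (\<lambda>U. U \<subseteq> rcosets\<^bsub>G\<^esub> N \<and> openin T (\<Union>U))"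

definition critical_pair :: "'a monoid \<Rightarrow> 'a topology \<Rightarrow> 'a set \<Rightarrow> 'a set \<Rightarrow> bool" where
  "critical_pair G T A B \<longleftrightarrow> closed_normal G T A \<and> closed_normal G T B \<and> B \<subset> A \<and>
     (\<forall>N. closed_normal G T N \<and> N \<subset> A \<longrightarrow> N \<subseteq> B)"

definition centralizer_of :: "('a, 'b) monoid_scheme \<Rightarrow> 'a set \<Rightarrow> 'a set" where
  "centralizer_of G Y = {a. a \<in> carrier G \<and> (\<forall>b\<in>Y. mult G a b = mult G b a)}"

definition composition_series :: "'a monoid \<Rightarrow> 'a set list \<Rightarrow> bool" where
  "composition_series K Hs \<longleftrightarrow> Hs \<noteq> [] \<and> hd Hs = {\<one>\<^bsub>K\<^esub>} \<and> last Hs = carrier K \<and>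
     (\<forall>i < length Hs. subgroup (Hs ! i) K) \<and>
     (\<forall>i. Suc i < length Hs \<longrightarrow>
        Hs ! i \<lhd> K\<lparr>carrier := Hs ! Suc i\<rparr> \<and>
        simple_group (K\<lparr>carrier := Hs ! Suc i\<rparr> Mod (Hs ! i)))"

definition comp_factor :: "'a monoid \<Rightarrow> 'a set list \<Rightarrow> nat \<Rightarrow> 'a set monoid" where
  "comp_factor K Hs i = K\<lparr>carrier := Hs ! Suc i\<rparr> Mod (Hs ! i)"

text \<open>Schur multiplier \<open>H^2(S, \<complex>^\<times>)\<close>: normalised (trivial off the carrier) 2-cocycles modulo coboundaries.\<close>
definition schur_cocycles :: "('a, 'b) monoid_scheme \<Rightarrow> ('a \<times> 'a \<Rightarrow> complex) set" where
  "schur_cocycles S = {f. (\<forall>x y. x \<notin> carrier S \<or> y \<notin> carrier S \<longrightarrow> f (x, y) = 1) \<and>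
     (\<forall>x\<in>carrier S. \<forall>y\<in>carrier S. f (x, y) \<noteq> 0) \<and>
     (\<forall>x\<in>carrier S. \<forall>y\<in>carrier S. \<forall>z\<in>carrier S.
        f (x, y) * f (x \<otimes>\<^bsub>S\<^esub> y, z) = f (x, y \<otimes>\<^bsub>S\<^esub> z) * f (y, z))}"

definition schur_cohomologous :: "('a, 'b) monoid_scheme \<Rightarrow> (('a \<times> 'a \<Rightarrow> complex) \<times> ('a \<times> 'a \<Rightarrow> complex)) set" where
  "schur_cohomologous S = {(f, g). f \<in> schur_cocycles S \<and> g \<in> schur_cocycles S \<and>
     (\<exists>h :: 'a \<Rightarrow> complex. (\<forall>x\<in>carrier S. h x \<noteq> 0) \<and>
        (\<forall>x\<in>carrier S. \<forall>y\<in>carrier S. f (x, y) = g (x, y) * h x * h y / h (x \<otimes>\<^bsub>S\<^esub> y)))}"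

definition schur_multiplier_order :: "('a, 'b) monoid_scheme \<Rightarrow> nat" where
  "schur_multiplier_order S = card (schur_cocycles S // schur_cohomologous S)"

definition centrally_decomposable :: "'a monoid \<Rightarrow> bool" where
  "centrally_decomposable K \<longleftrightarrow> (\<exists>\<H>. (\<forall>H\<in>\<H>. subgroup H K \<and> H \<noteq> carrier K) \<and>
     generate K (\<Union>\<H>) = carrier K \<and>
     (\<forall>H\<in>\<H>. \<forall>H'\<in>\<H>. H \<noteq> H' \<longrightarrow> (\<forall>x\<in>H. \<forall>y\<in>H'. x \<otimes>\<^bsub>K\<^esub> y = y \<otimes>\<^bsub>K\<^esub> x)))"

text \<open>A class of finite simple groups is represented (up to isomorphism) by a set of groups on \<open>nat\<close>;
  a group \<open>X\<close> (of any type) lies in the class iff it is isomorphic to a member.\<close>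
definition in_class :: "('c, 'd) monoid_scheme \<Rightarrow> nat monoid set \<Rightarrow> bool" where
  "in_class Q \<C> \<longleftrightarrow> (\<exists>K\<in>\<C>. Q \<cong> K)"

definition class_of_finite_simple :: "nat monoid set \<Rightarrow> bool" where
  "class_of_finite_simple \<C> \<longleftrightarrow> (\<forall>K\<in>\<C>. simple_group K \<and> finite (carrier K))"

definition condition_starstar :: "'a monoid \<Rightarrow> 'a topology \<Rightarrow> nat monoid set \<Rightarrow> bool" where
  "condition_starstar G T \<C> \<longleftrightarrow>
     (\<forall>n::nat. \<exists>N Hs. N \<lhd> G \<and> openin T N \<and> composition_series (G Mod N) Hs \<and>
        n \<le> card {i. Suc i < length Hs \<and> in_class (comp_factor (G Mod N) Hs i) \<C>}) \<and>
     (\<forall>p::nat. Factorial_Ring.prime p \<longrightarrow> in_class (integer_mod_group p) \<C> \<longrightarrow>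
        (\<forall>S :: nat monoid. simple_group S \<and> finite (carrier S) \<and> \<not> comm_group S \<and>
            p dvd schur_multiplier_order S \<longrightarrow> in_class S \<C>))"

definition qmap :: "'a monoid \<Rightarrow> (nat \<Rightarrow> 'a set) \<Rightarrow> nat \<Rightarrow> 'a \<Rightarrow> 'a set" where
  "qmap G S n x = S (Suc n) #>\<^bsub>G\<^esub> x"

definition Gq :: "'a monoid \<Rightarrow> (nat \<Rightarrow> 'a set) \<Rightarrow> nat \<Rightarrow> 'a set monoid" where
  "Gq G S n = G Mod S (Suc n)"

definition Tq :: "'a monoid \<Rightarrow> 'a topology \<Rightarrow> (nat \<Rightarrow> 'a set) \<Rightarrow> nat \<Rightarrow> 'a set topology" where
  "Tq G T S n = quot_top G T (S (Suc n))"

definition An :: "'a monoid \<Rightarrow> (nat \<Rightarrow> 'a set) \<Rightarrow> (nat \<Rightarrow> 'a set) \<Rightarrow> nat \<Rightarrow> 'a set set" where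
  "An G R S n = qmap G S n ` R n"
definition Bn :: "'a monoid \<Rightarrow> (nat \<Rightarrow> 'a set) \<Rightarrow> nat \<Rightarrow> 'a set set" where
  "Bn G S n = qmap G S n ` S n"
definition Pn :: "'a monoid \<Rightarrow> (nat \<Rightarrow> 'a set) \<Rightarrow> (nat \<Rightarrow> 'a set) \<Rightarrow> nat \<Rightarrow> 'a set set" where
  "Pn G R S n = qmap G S n ` R (Suc n)"

text \<open>The natural map \<open>\<rho>_n : G_{n+1} \<rightarrow> G_n\<close>, \<open>S_{n+2} x \<mapsto> S_{n+1} x\<close>.\<close>
definition rho :: "'a monoid \<Rightarrow> (nat \<Rightarrow> 'a set) \<Rightarrow> nat \<Rightarrow> 'a set \<Rightarrow> 'a set" where
  "rho G S n Y = S (Suc n) <#>\<^bsub>G\<^esub> Y"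

definition inv_lim_carrier :: "'a monoid \<Rightarrow> (nat \<Rightarrow> 'a set) \<Rightarrow> (nat \<Rightarrow> 'a set) set" where
  "inv_lim_carrier G S = {g. \<forall>n. g n \<in> carrier (Gq G S n) \<and> rho G S n (g (Suc n)) = g n}"

definition inv_lim_group :: "'a monoid \<Rightarrow> (nat \<Rightarrow> 'a set) \<Rightarrow> (nat \<Rightarrow> 'a set) monoid" where
  "inv_lim_group G S = \<lparr>carrier = inv_lim_carrier G S,
     mult = (\<lambda>g h n. g n \<otimes>\<^bsub>Gq G S n\<^esub> h n), one = (\<lambda>n. \<one>\<^bsub>Gq G S n\<^esub>)\<rparr>"

definition inv_lim_top :: "'a monoid \<Rightarrow> 'a topology \<Rightarrow> (nat \<Rightarrow> 'a set) \<Rightarrow> (nat \<Rightarrow> 'a set) topology" where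
  "inv_lim_top G T S = subtopology (product_topology (\<lambda>n. Tq G T S n) UNIV) (inv_lim_carrier G S)"

definition good_pairs :: "'a monoid \<Rightarrow> 'a topology \<Rightarrow> nat monoid set \<Rightarrow> (nat \<Rightarrow> 'a set) \<Rightarrow> (nat \<Rightarrow> 'a set) \<Rightarrow> bool" where
  "good_pairs G T \<C> R S \<longleftrightarrow>
     (\<forall>n. critical_pair G T (R n) (S n)) \<and>
     (\<forall>n. R (Suc n) \<subseteq> S n) \<and>
     (\<Inter>n. S n) = {\<one>\<^bsub>G\<^esub>} \<and>
     (\<lambda>x n. qmap G S n x) \<in> iso G (inv_lim_group G S) \<and>
     homeomorphic_map T (inv_lim_top G T S) (\<lambda>x n. qmap G S n x) \<and>
     (\<forall>n. critical_pair (Gq G S n) (Tq G T S n) (An G R S n) (Bn G S n) \<and>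
          (\<exists>K\<in>\<C>. \<exists>k::nat. ((Gq G S n)\<lparr>carrier := An G R S n\<rparr> Mod Bn G S n)
                            \<cong> product_group {..<k} (\<lambda>_. K)) \<and>
          Pn G R S n <#>\<^bsub>Gq G S n\<^esub> centralizer_of (Gq G S n) (Pn G R S n) \<subseteq> Bn G S n)"

definition hji_pairs :: "'a monoid \<Rightarrow> 'a topology \<Rightarrow> (nat \<Rightarrow> 'a set) \<Rightarrow> (nat \<Rightarrow> 'a set) \<Rightarrow> bool" where
  "hji_pairs G T R S \<longleftrightarrow>
     (\<forall>n H. closed_subgroup (Gq G S n) (Tq G T S n) H \<and>
        (\<forall>a\<in>An G R S n. \<forall>h\<in>H. a \<otimes>\<^bsub>Gq G S n\<^esub> h \<otimes>\<^bsub>Gq G S n\<^esub> inv\<^bsub>Gq G S n\<^esub> a \<in> H) \<longrightarrow>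
        Pn G R S n <#>\<^bsub>Gq G S n\<^esub> centralizer_of (Gq G S n) (Pn G R S n) \<subseteq> H \<or>
        (\<forall>M. M \<lhd> (Gq G S n)\<lparr>carrier := An G R S n\<rparr> \<and> closedin (Tq G T S n) M \<and>
             M \<noteq> An G R S n \<and>
             (\<forall>M'. M' \<lhd> (Gq G S n)\<lparr>carrier := An G R S n\<rparr> \<and> closedin (Tq G T S n) M' \<and>
                   M \<subseteq> M' \<and> M' \<noteq> An G R S n \<longrightarrow> M' = M)
             \<longrightarrow> H \<subseteq> M)) \<and>
     (\<forall>n N. closed_normal (Gq G S n) (Tq G T S n) N \<and> An G R S n \<subseteq> N \<longrightarrow>
        \<not> centrally_decomposable ((Gq G S n)\<lparr>carrier := N\<rparr>))"

end

(* For an open normal subgroup A of G call a closed subgroup A-invariant if A normalises it. If every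
   nontrivial closed A-invariant subgroup is open (A = G for just infinite G, and A = R_n for hereditarily
   just infinite G), then by compactness the A-invariant subgroups not contained in a fixed open set satisfy
   the descending chain condition, maximal A-invariant subgroups of an A-invariant subgroup of A intersect
   nontrivially, and hence all A-invariant subgroups not contained in a given open subgroup contain a common
   open normal subgroup (obliquity).

   It remains to find, below any open normal W, a critical pair (R, S) of type C whose factor has its
   centraliser in W. Otherwise, by obliquity, some open normal D centralises every chief factor of type C below
   it, so these factors are elementary abelian p-groups. Let E be the least open normal subgroup with D / E a
   p-group; it exists because G is not virtually pro-p. A topmost p-factor R / S of G below E would give a
   character of R of order p. Above R there are no composition factors of order p, and no non-abelian ones
   with p dividing the order of the Schur multiplier, so the character extends uniquely with p-power order along a
   subnormal series up to E, contradicting the choice of E. Hence the intersection of the groups E over all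
   primes p in question has no chief factor of type C and is therefore trivial, which forces some E to be
   equal to D by coprimality: a contradiction. *)
theory Submission
  imports Defs
begin

section \<open>Profinite groups\<close>

text \<open>With \<open>W = S n\<close>, the wanted inclusion of \<open>P_n C(P_n)\<close> in
  \<open>B_n\<close> says exactly that \<open>R (Suc n)\<close> and the centraliser of
  \<open>R (Suc n) / S (Suc n)\<close> lie in \<open>W\<close>. In the hereditary case
  \<open>W\<close> is shrunk further, to the bound that obliquity gives for \<open>A = R n\<close>
  and the intersection of the maximal normal subgroups of \<open>R n\<close>. The obstacle is a
  chief factor that is centralised by everything nearby: obliquity says nothing there, and only the
  passage to characters brings the condition on Schur multipliers into play. Characters take values
  in all nonzero complex numbers, not in the \<open>p\<close>-th roots of unity, so that the
  obstruction to extending one across a simple section is a class in the Schur multiplier itself.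
  The price is that an extension may lose its \<open>p\<close>-power order, which a suitable power
  of it restores. Arguments about finite quotients are carried out in the ambient group, by extremal
  choices among the finitely many overgroups of an open subgroup.\<close>

definition normalises :: "('a, 'b) monoid_scheme \<Rightarrow> 'a set \<Rightarrow> 'a set \<Rightarrow> bool" where
  "normalises G A H \<longleftrightarrow> (\<forall>a\<in>A. \<forall>h\<in>H. a \<otimes>\<^bsub>G\<^esub> h \<otimes>\<^bsub>G\<^esub> inv\<^bsub>G\<^esub> a \<in> H)"

lemma normalisesD: "normalises G A H \<Longrightarrow> a \<in> A \<Longrightarrow> h \<in> H \<Longrightarrow> a \<otimes>\<^bsub>G\<^esub> h \<otimes>\<^bsub>G\<^esub> inv\<^bsub>G\<^esub> a \<in> H"
  by (auto simp: normalises_def)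

lemma normalises_Int: "normalises G A H \<Longrightarrow> normalises G A K \<Longrightarrow> normalises G A (H \<inter> K)"
  by (auto simp: normalises_def)

lemma normalises_Inter: "(\<And>H. H \<in> \<H> \<Longrightarrow> normalises G A H) \<Longrightarrow> normalises G A (\<Inter>\<H>)"
  by (auto simp: normalises_def)

lemma normalises_mono: "normalises G A H \<Longrightarrow> B \<subseteq> A \<Longrightarrow> normalises G B H"
  by (auto simp: normalises_def)

context group
begin

lemma mult_inv_cancel: "x \<in> carrier G \<Longrightarrow> y \<in> carrier G \<Longrightarrow> x \<otimes> (inv x \<otimes> y) = y"
  and inv_mult_cancel: "x \<in> carrier G \<Longrightarrow> y \<in> carrier G \<Longrightarrow> inv x \<otimes> (x \<otimes> y) = y"
  by (simp_all add: m_assoc[symmetric])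

lemmas group_simps = m_assoc mult_inv_cancel inv_mult_cancel inv_mult_group

text \<open>Splits normality into two properties of sets in the ambient group. Normality inside a
  subgroup \<open>A\<close> can then be written \<open>normalises G A N\<close>, without passing to
  a restricted carrier; one inclusion is enough because a subgroup \<open>A\<close> contains
  inverses.\<close>

lemma normal_iff_normalises: "N \<lhd> G \<longleftrightarrow> subgroup N G \<and> normalises G (carrier G) N"
  unfolding normal_inv_iff normalises_def by auto

lemma subgroup_normalises_self: "subgroup H G \<Longrightarrow> normalises G H H"
  unfolding normalises_def by (meson subgroup.m_closed subgroup.m_inv_closed)

lemma subgroup_set_mult:
  assumes H: "subgroup H G" and K: "subgroup K G" and n: "normalises G H K"
  shows "subgroup (H <#> K) G"
proof (rule subgroupI)
  note [simp] = subgroup.mem_carrier[OF H] subgroup.mem_carrier[OF K]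
  show "H <#> K \<subseteq> carrier G"
    by (auto simp: set_mult_def)
  show "H <#> K \<noteq> {}"
    using subgroup.one_closed[OF H] subgroup.one_closed[OF K] by (auto simp: set_mult_def)
  fix x assume "x \<in> H <#> K"
  then obtain h k where hk: "h \<in> H" "k \<in> K" "x = h \<otimes> k" by (auto simp: set_mult_def)
  have "inv x = inv h \<otimes> (h \<otimes> inv k \<otimes> inv h)"
    using hk by (simp add: inv_mult_group m_assoc[symmetric])
  moreover have "h \<otimes> inv k \<otimes> inv h \<in> K"
    by (intro normalisesD[OF n] hk subgroup.m_inv_closed[OF K])
  ultimately show "inv x \<in> H <#> K"
    using subgroup.m_inv_closed[OF H hk(1)] by (auto simp: set_mult_def)
  fix y assume "y \<in> H <#> K"
  then obtain h' k' where hk': "h' \<in> H" "k' \<in> K" "y = h' \<otimes> k'" by (auto simp: set_mult_def)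
  have "x \<otimes> y = (h \<otimes> h') \<otimes> ((inv h' \<otimes> k \<otimes> inv (inv h')) \<otimes> k')"
    using hk hk' by (simp add: group_simps)
  moreover have "(inv h' \<otimes> k \<otimes> inv (inv h')) \<otimes> k' \<in> K"
    by (intro subgroup.m_closed[OF K] normalisesD[OF n] hk hk' subgroup.m_inv_closed[OF H])
  ultimately show "x \<otimes> y \<in> H <#> K"
    using subgroup.m_closed[OF H hk(1) hk'(1)] by (auto simp: set_mult_def)
qed

lemma set_mult_upper1:
  assumes "subgroup H G" "subgroup K G"
  shows "H \<subseteq> H <#> K"
proof
  fix h assume h: "h \<in> H"
  then have "h \<otimes> \<one> \<in> H <#> K"
    unfolding set_mult_def using subgroup.one_closed[OF assms(2)] by blast
  then show "h \<in> H <#> K" using subgroup.mem_carrier[OF assms(1) h] by simp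
qed

lemma set_mult_upper2:
  assumes "subgroup H G" "subgroup K G"
  shows "K \<subseteq> H <#> K"
proof
  fix k assume k: "k \<in> K"
  then have "\<one> \<otimes> k \<in> H <#> K"
    unfolding set_mult_def using subgroup.one_closed[OF assms(1)] by blast
  then show "k \<in> H <#> K" using subgroup.mem_carrier[OF assms(2) k] by simp
qed

lemma set_mult_least:
  assumes "H \<subseteq> L" "K \<subseteq> L" "subgroup L G"
  shows "H <#> K \<subseteq> L"
  using assms(1,2) by (auto simp: set_mult_def intro!: subgroup.m_closed[OF assms(3)])

lemma normalises_set_mult:
  assumes H: "subgroup H G" and K: "subgroup K G" and A: "A \<subseteq> carrier G"
    and "normalises G A H" "normalises G A K"
  shows "normalises G A (H <#> K)"
  unfolding normalises_def
proof (intro ballI)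
  fix a x assume a: "a \<in> A" and "x \<in> H <#> K"
  then obtain h k where hk: "h \<in> H" "k \<in> K" "x = h \<otimes> k" by (auto simp: set_mult_def)
  have c: "a \<in> carrier G" "h \<in> carrier G" "k \<in> carrier G"
    using hk a A subgroup.mem_carrier[OF H] subgroup.mem_carrier[OF K] by auto
  have "a \<otimes> x \<otimes> inv a = (a \<otimes> h \<otimes> inv a) \<otimes> (a \<otimes> k \<otimes> inv a)"
    using c hk by (simp add: group_simps)
  moreover have "a \<otimes> h \<otimes> inv a \<in> H" "a \<otimes> k \<otimes> inv a \<in> K"
    using assms a hk by (auto simp: normalises_def)
  ultimately show "a \<otimes> x \<otimes> inv a \<in> H <#> K" by (auto simp: set_mult_def)
qed

text \<open>The modular law: the factor from \<open>K\<close> can be cancelled inside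
  \<open>L\<close>, which leaves the other factor in \<open>L\<close>.\<close>

lemma dedekind:
  assumes H: "subgroup H G" and K: "subgroup K G" and L: "subgroup L G" and "K \<subseteq> L"
  shows "(H <#> K) \<inter> L = (H \<inter> L) <#> K"
proof (intro equalityI subsetI)
  fix x assume "x \<in> (H <#> K) \<inter> L"
  then obtain h k where hk: "h \<in> H" "k \<in> K" "x = h \<otimes> k" and x: "x \<in> L" by (auto simp: set_mult_def)
  have "x \<otimes> inv k \<in> L" using x hk assms by (meson subgroup.m_closed[OF L] subgroup.m_inv_closed[OF L] subsetD)
  moreover have "x \<otimes> inv k = h"
    using hk subgroup.mem_carrier[OF H] subgroup.mem_carrier[OF K] by (simp add: m_assoc)
  ultimately show "x \<in> (H \<inter> L) <#> K" using hk by (auto simp: set_mult_def)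
next
  fix x assume "x \<in> (H \<inter> L) <#> K"
  then obtain h k where hk: "h \<in> H" "h \<in> L" "k \<in> K" "x = h \<otimes> k" by (auto simp: set_mult_def)
  have "x \<in> L" unfolding hk(4) by (rule subgroup.m_closed[OF L hk(2) subsetD[OF assms(4) hk(3)]])
  then show "x \<in> (H <#> K) \<inter> L" using hk by (auto simp: set_mult_def)
qed

lemma subgroup_eq_Union_cosets:
  assumes "subgroup V G" "subgroup H G" "V \<subseteq> H"
  shows "H = \<Union>{C \<in> rcosets V. C \<subseteq> H}"
proof (intro equalityI subsetI)
  fix x assume x: "x \<in> H"
  then have xc: "x \<in> carrier G" by (rule subgroup.mem_carrier[OF assms(2)])
  have "V #> x \<subseteq> H" using x assms(3) by (auto simp: r_coset_def intro!: subgroup.m_closed[OF assms(2)])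
  moreover have "x \<in> V #> x" using rcos_self[OF xc assms(1)] .
  moreover have "V #> x \<in> rcosets V" using xc by (auto simp: RCOSETS_def)
  ultimately show "x \<in> \<Union>{C \<in> rcosets V. C \<subseteq> H}" by blast
qed auto

lemma finite_rcosets_mono:
  assumes B: "subgroup B G" "finite (rcosets B)" and S: "subgroup S G" "B \<subseteq> S"
  shows "finite (rcosets S)"
proof -
  have "rcosets S \<subseteq> (\<lambda>C. S <#> C) ` (rcosets B)"
  proof
    fix C assume "C \<in> rcosets S"
    then obtain x where x: "x \<in> carrier G" "C = S #> x" by (auto simp: RCOSETS_def)
    \<comment> \<open>Since \<open>S\<close> absorbs \<open>B\<close>, multiplication by
      \<open>S\<close> maps the cosets of \<open>B\<close> onto those of \<open>S\<close>.\<close>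
    have "S <#> B = S"
      by (intro equalityI set_mult_upper1 S(1) B(1) set_mult_least subset_refl S(2))
    then have "C = S <#> (B #> x)"
      using x setmult_rcos_assoc[OF subgroup.subset[OF S(1)] subgroup.subset[OF B(1)]] by simp
    then show "C \<in> (\<lambda>C. S <#> C) ` (rcosets B)" using x by (auto simp: RCOSETS_def)
  qed
  then show ?thesis using B(2) finite_surj by blast
qed

text \<open>An overgroup of \<open>V\<close> is a union of cosets of \<open>V\<close>. The later
  maximal and minimal choices among open subgroups rest on this finiteness, which replaces induction
  on the index.\<close>

lemma finite_overgroups:
  assumes "subgroup V G" "finite (rcosets V)"
  shows "finite {H. subgroup H G \<and> V \<subseteq> H}"
proof (rule finite_surj[of "Pow (rcosets V)" _ Union])
  show "{H. subgroup H G \<and> V \<subseteq> H} \<subseteq> Union ` Pow (rcosets V)"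
    using subgroup_eq_Union_cosets[OF assms(1)] by blast
qed (use assms in auto)

end

locale profinite = group G for G :: "'a monoid" (structure) +
  fixes T :: "'a topology"
  assumes profinite: "profinite_group G T"
begin

lemma topspace [simp]: "topspace T = carrier G"
  using profinite by (simp add: profinite_group_def topological_group_def)

lemma compact: "compact_space T" and hausdorff: "Hausdorff_space T"
  using profinite by (auto simp: profinite_group_def)

lemma continuous_mult:
  assumes "continuous_map Y T f" "continuous_map Y T g"
  shows "continuous_map Y T (\<lambda>x. f x \<otimes> g x)"
proof -
  have "continuous_map (prod_topology T T) T (\<lambda>(x,y). x \<otimes> y)"
    using profinite by (simp add: profinite_group_def topological_group_def)
  moreover have "continuous_map Y (prod_topology T T) (\<lambda>x. (f x, g x))"
    using assms by (simp add: continuous_map_pairwise o_def)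
  ultimately have "continuous_map Y T ((\<lambda>(x,y). x \<otimes> y) \<circ> (\<lambda>x. (f x, g x)))"
    by (rule continuous_map_compose[rotated])
  then show ?thesis by (simp add: o_def)
qed

lemma continuous_inv:
  assumes "continuous_map Y T f"
  shows "continuous_map Y T (\<lambda>x. inv (f x))"
proof -
  have "continuous_map T T (\<lambda>x. inv x)"
    using profinite by (simp add: profinite_group_def topological_group_def)
  from continuous_map_compose[OF assms this] show ?thesis by (simp add: o_def)
qed

lemma continuous_const: "c \<in> carrier G \<Longrightarrow> continuous_map Y T (\<lambda>x. c)"
  by simp

lemma closedin_singleton: "x \<in> carrier G \<Longrightarrow> closedin T {x}"
  using hausdorff by (simp add: closedin_Hausdorff_singleton)

lemma r_coset_eq_preimage:
  assumes "U \<subseteq> carrier G" "a \<in> carrier G"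
  shows "U #> a = {x \<in> topspace T. x \<otimes> inv a \<in> U}"
proof (intro equalityI subsetI)
  fix x assume "x \<in> {x \<in> topspace T. x \<otimes> inv a \<in> U}"
  then show "x \<in> U #> a"
    using assms(2) by (auto simp: r_coset_def m_assoc intro!: bexI[of _ "x \<otimes> inv a"])
next
  fix x assume "x \<in> U #> a"
  then obtain u where "u \<in> U" "x = u \<otimes> a" by (auto simp: r_coset_def)
  moreover have "u \<in> carrier G" using \<open>u \<in> U\<close> assms(1) by auto
  ultimately show "x \<in> {x \<in> topspace T. x \<otimes> inv a \<in> U}" using assms(2) by (simp add: m_assoc)
qed

lemma continuous_r_mult: "a \<in> carrier G \<Longrightarrow> continuous_map T T (\<lambda>x. x \<otimes> inv a)"
  by (intro continuous_mult continuous_const) auto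

lemma openin_r_coset: "openin T U \<Longrightarrow> a \<in> carrier G \<Longrightarrow> openin T (U #> a)"
  using openin_continuous_map_preimage[OF continuous_r_mult, of a U] openin_subset[of T U]
  by (simp add: r_coset_eq_preimage)

lemma closedin_r_coset: "closedin T U \<Longrightarrow> a \<in> carrier G \<Longrightarrow> closedin T (U #> a)"
  using closedin_continuous_map_preimage[OF continuous_r_mult, of a U] closedin_subset[of T U]
  by (simp add: r_coset_eq_preimage)

lemma open_overgroup:
  assumes "subgroup V G" "openin T V" "subgroup H G" "V \<subseteq> H"
  shows "openin T H"
proof -
  have "openin T (\<Union>{C \<in> rcosets V. C \<subseteq> H})"
    by (rule openin_Union) (auto simp: RCOSETS_def intro: openin_r_coset assms)
  then show ?thesis using subgroup_eq_Union_cosets[OF assms(1,3,4)] by simp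
qed

lemma complement_subgroup:
  assumes "subgroup H G"
  shows "carrier G - H = \<Union>{C \<in> rcosets H. C \<noteq> H}"
proof (intro equalityI subsetI)
  fix x assume x: "x \<in> carrier G - H"
  then have "x \<in> H #> x" using rcos_self assms by blast
  moreover have "H #> x \<in> rcosets H" using x by (auto simp: RCOSETS_def)
  moreover have "H #> x \<noteq> H" using x \<open>x \<in> H #> x\<close> by auto
  ultimately show "x \<in> \<Union>{C \<in> rcosets H. C \<noteq> H}" by blast
next
  fix x assume "x \<in> \<Union>{C \<in> rcosets H. C \<noteq> H}"
  then obtain C where C: "C \<in> rcosets H" "C \<noteq> H" "x \<in> C" by auto
  then have "x \<in> carrier G" using subgroup.rcosets_carrier[OF assms is_group] by blast
  moreover have "x \<notin> H"
    using C rcos_disjoint[OF assms] subgroup.subgroup_in_rcosets[OF assms is_group]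
    by (auto simp: pairwise_def disjnt_def)
  ultimately show "x \<in> carrier G - H" by auto
qed

lemma open_subgroup_closed:
  assumes "subgroup H G" "openin T H"
  shows "closedin T H"
proof -
  have "openin T (\<Union>{C \<in> rcosets H. C \<noteq> H})"
    by (rule openin_Union) (auto simp: RCOSETS_def intro: openin_r_coset assms)
  then show ?thesis using complement_subgroup[OF assms(1)] subgroup.subset[OF assms(1)]
    by (simp add: closedin_def)
qed

lemma finite_index_open:
  assumes "subgroup H G" "closedin T H" "finite (rcosets H)"
  shows "openin T H"
proof -
  have "closedin T (\<Union>{C \<in> rcosets H. C \<noteq> H})"
  proof (rule closedin_Union)
    show "finite {C \<in> rcosets H. C \<noteq> H}" using assms(3) by simp
  qed (auto simp: RCOSETS_def intro: closedin_r_coset assms)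
  then show ?thesis using complement_subgroup[OF assms(1)] subgroup.subset[OF assms(1)]
    by (simp add: openin_closedin_eq)
qed

lemma open_finite_index:
  assumes "subgroup H G" "openin T H"
  shows "finite (rcosets H)"
proof -
  have "\<exists>\<F>. finite \<F> \<and> \<F> \<subseteq> rcosets H \<and> topspace T \<subseteq> \<Union>\<F>"
    by (rule compact_space_alt[THEN iffD1, rule_format, OF compact])
      (use rcosets_part_G[OF assms(1)] in \<open>auto simp: RCOSETS_def intro: openin_r_coset assms\<close>)
  then obtain \<F> where F: "finite \<F>" "\<F> \<subseteq> rcosets H" "carrier G \<subseteq> \<Union>\<F>" by auto
  have "rcosets H \<subseteq> \<F>"
  proof
    fix C assume C: "C \<in> rcosets H"
    then obtain x where x: "x \<in> carrier G" "C = H #> x" by (auto simp: RCOSETS_def)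
    have "x \<in> C" using x rcos_self assms by blast
    then obtain C' where "C' \<in> \<F>" "x \<in> C'" using F x by auto
    then have "C = C'" using C F(2) rcos_disjoint[OF assms(1)] \<open>x \<in> C\<close>
      unfolding pairwise_def disjnt_def by blast
    then show "C \<in> \<F>" using \<open>C' \<in> \<F>\<close> by simp
  qed
  then show ?thesis using F(1) finite_subset by blast
qed

lemma finite_open_overgroups:
  "subgroup V G \<Longrightarrow> openin T V \<Longrightarrow> finite {H. subgroup H G \<and> V \<subseteq> H}"
  using finite_overgroups open_finite_index by blast

text \<open>The subgroup is the class of \<open>\<one>\<close> under the two-sided syntactic congruence of \<open>C\<close>: it is normal for
  free, and open because projections along compact spaces are closed.\<close>
lemma open_normal_in_clopen:
  assumes C: "openin T C" "closedin T C" and one: "\<one> \<in> C"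
  shows "\<exists>N. N \<lhd> G \<and> openin T N \<and> N \<subseteq> C"
proof -
  define N where "N = {x \<in> carrier G. \<forall>g\<in>carrier G. \<forall>h\<in>carrier G. g \<otimes> x \<otimes> h \<in> C \<longleftrightarrow> g \<otimes> h \<in> C}"
  let ?P = "prod_topology T (prod_topology T T)"
  let ?f = "\<lambda>(x,g,h). g \<otimes> x \<otimes> h" and ?g = "\<lambda>(x,g,h). g \<otimes> h"
  have f1: "continuous_map ?P T (\<lambda>z. fst z)" by (rule continuous_map_fst)
  have f2: "continuous_map ?P T (\<lambda>z. fst (snd z))" 
    using continuous_map_compose[OF continuous_map_snd continuous_map_fst] by (simp add: o_def)
  have f3: "continuous_map ?P T (\<lambda>z. snd (snd z))" 
    using continuous_map_compose[OF continuous_map_snd continuous_map_snd] by (simp add: o_def)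
  have cf: "continuous_map ?P T ?f" and cg: "continuous_map ?P T ?g"
    unfolding split_beta by (intro continuous_mult f1 f2 f3)+
  \<comment> \<open>\<open>B\<close> collects the \<open>(x, g, h)\<close> at which the congruence
    fails for \<open>x\<close>. It is closed because \<open>C\<close> and its complement both are,
    and its projection is the complement of \<open>N\<close>.\<close>
  define B where "B = {z \<in> topspace ?P. ?f z \<in> C} \<inter> {z \<in> topspace ?P. ?g z \<in> topspace T - C}
     \<union> {z \<in> topspace ?P. ?f z \<in> topspace T - C} \<inter> {z \<in> topspace ?P. ?g z \<in> C}"
  have cC: "closedin T (topspace T - C)" using C(1) by (simp only: openin_closedin_eq)
  have "closedin ?P B" unfolding B_def
    by (intro closedin_Un closedin_Int closedin_continuous_map_preimage[OF cf] closedin_continuous_map_preimage[OF cg])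
       (use C cC in auto)
  moreover have "closed_map ?P T fst"
    by (intro closed_map_fst) (simp add: compact_space_prod_topology compact)
  ultimately have "closedin T (fst ` B)" by (auto simp: closed_map_def)
  then have "openin T (topspace T - fst ` B)" by (simp add: closedin_def)
  moreover have "topspace T - fst ` B = N"
  proof -
    have "x \<in> fst ` B \<longleftrightarrow> (\<exists>g\<in>carrier G. \<exists>h\<in>carrier G. (g \<otimes> x \<otimes> h \<in> C) \<noteq> (g \<otimes> h \<in> C))"
      if "x \<in> carrier G" for x
    proof
      assume "x \<in> fst ` B"
      then obtain g h where "(x, g, h) \<in> B" by auto
      then show "\<exists>g\<in>carrier G. \<exists>h\<in>carrier G. (g \<otimes> x \<otimes> h \<in> C) \<noteq> (g \<otimes> h \<in> C)"
        unfolding B_def by (intro bexI[of _ g] bexI[of _ h]) auto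
    next
      assume "\<exists>g\<in>carrier G. \<exists>h\<in>carrier G. (g \<otimes> x \<otimes> h \<in> C) \<noteq> (g \<otimes> h \<in> C)"
      then obtain g h where "g \<in> carrier G" "h \<in> carrier G" "(g \<otimes> x \<otimes> h \<in> C) \<noteq> (g \<otimes> h \<in> C)" by blast
      then have "(x, g, h) \<in> B" unfolding B_def using that by auto
      then show "x \<in> fst ` B" by (rule rev_image_eqI) simp
    qed
    then show ?thesis unfolding N_def by auto
  qed
  ultimately have "openin T N" by simp
  moreover have "subgroup N G"
  proof (rule subgroupI)
    show "N \<subseteq> carrier G" by (auto simp: N_def)
    show "N \<noteq> {}" by (auto simp: N_def intro!: exI[of _ \<one>])
    fix x assume x: "x \<in> N"
    show "inv x \<in> N" unfolding N_def
    proof (clarsimp, intro conjI ballI)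
      show "inv x \<in> carrier G" using x by (simp add: N_def)
      fix g h assume gh: "g \<in> carrier G" "h \<in> carrier G"
      have "g \<otimes> inv x \<otimes> x \<otimes> h \<in> C \<longleftrightarrow> g \<otimes> inv x \<otimes> h \<in> C"
        using x gh unfolding N_def by blast
      then show "(g \<otimes> inv x \<otimes> h \<in> C) = (g \<otimes> h \<in> C)" using x gh by (simp add: N_def m_assoc)
    qed
    fix y assume y: "y \<in> N"
    show "x \<otimes> y \<in> N" unfolding N_def
    proof (clarsimp, intro conjI ballI)
      show "x \<otimes> y \<in> carrier G" using x y by (simp add: N_def)
      fix g h assume gh: "g \<in> carrier G" "h \<in> carrier G"
      have "(g \<otimes> x) \<otimes> y \<otimes> h \<in> C \<longleftrightarrow> g \<otimes> x \<otimes> h \<in> C"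
        using x y gh unfolding N_def by blast
      moreover have "g \<otimes> x \<otimes> h \<in> C \<longleftrightarrow> g \<otimes> h \<in> C" using x gh unfolding N_def by blast
      ultimately show "(g \<otimes> (x \<otimes> y) \<otimes> h \<in> C) = (g \<otimes> h \<in> C)" using x y gh by (simp add: N_def m_assoc)
    qed
  qed
  moreover have "normalises G (carrier G) N" unfolding normalises_def
  proof (intro ballI)
    fix a x assume a: "a \<in> carrier G" and x: "x \<in> N"
    then have xc: "x \<in> carrier G" by (simp add: N_def)
    show "a \<otimes> x \<otimes> inv a \<in> N" unfolding N_def
    proof (clarsimp simp: a xc)
      fix g h assume gh: "g \<in> carrier G" "h \<in> carrier G"
      have "(g \<otimes> a) \<otimes> x \<otimes> (inv a \<otimes> h) \<in> C \<longleftrightarrow> (g \<otimes> a) \<otimes> (inv a \<otimes> h) \<in> C"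
        using x a gh unfolding N_def by blast
      moreover have "(g \<otimes> a) \<otimes> (inv a \<otimes> h) = g \<otimes> h"
        using a gh by (simp add: group_simps)
      ultimately show "(g \<otimes> (a \<otimes> x \<otimes> inv a) \<otimes> h \<in> C) = (g \<otimes> h \<in> C)" using a gh xc by (simp add: m_assoc)
    qed
  qed
  moreover have "N \<subseteq> C"
  proof
    fix x assume x: "x \<in> N"
    then have "\<one> \<otimes> x \<otimes> \<one> \<in> C \<longleftrightarrow> \<one> \<otimes> \<one> \<in> C" unfolding N_def by blast
    then show "x \<in> C" using one x by (simp add: N_def)
  qed
  ultimately show ?thesis unfolding normal_iff_normalises by blast
qed

text \<open>In a compact Hausdorff space components and quasi-components agree, so total
  disconnectedness yields a clopen set around \<open>\<one>\<close> that misses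
  \<open>x\<close>.\<close>

lemma ex_open_normal_notin:
  assumes x: "x \<in> carrier G" "x \<noteq> \<one>"
  shows "\<exists>N. N \<lhd> G \<and> openin T N \<and> x \<notin> N"
proof -
  have "connected_component_of_set T \<one> = {\<one>}"
    using profinite by (simp add: profinite_group_def)
  moreover have "quasi_component_of T \<one> = connected_component_of T \<one>"
    by (rule quasi_eq_connected_component_of) (simp add: compact hausdorff)
  ultimately have "\<not> quasi_component_of T \<one> x" using x by auto
  then obtain C where "openin T C" "closedin T C" "\<one> \<in> C" "x \<notin> C"
    using x unfolding quasi_component_of by auto
  then show ?thesis using open_normal_in_clopen by blast
qed

end

context group
begin

text \<open>The mirror image of the modular law. Set products do not commute, and both forms are
  used: once the right factor lies in the cutting subgroup, once the left one.\<close>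

lemma dedekind_left:
  assumes H: "subgroup H G" and K: "subgroup K G" and L: "subgroup L G" and "K \<subseteq> L"
  shows "(K <#> H) \<inter> L = K <#> (H \<inter> L)"
proof (intro equalityI subsetI)
  fix x assume "x \<in> (K <#> H) \<inter> L"
  then obtain h k where hk: "h \<in> H" "k \<in> K" "x = k \<otimes> h" and x: "x \<in> L" by (auto simp: set_mult_def)
  have "inv k \<otimes> x \<in> L" using x hk assms by (meson subgroup.m_closed[OF L] subgroup.m_inv_closed[OF L] subsetD)
  moreover have "inv k \<otimes> x = h"
    using hk subgroup.mem_carrier[OF H] subgroup.mem_carrier[OF K] by (simp add: inv_mult_cancel)
  ultimately show "x \<in> K <#> (H \<inter> L)" using hk by (auto simp: set_mult_def)
next
  fix x assume "x \<in> K <#> (H \<inter> L)"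
  then obtain h k where hk: "h \<in> H" "h \<in> L" "k \<in> K" "x = k \<otimes> h" by (auto simp: set_mult_def)
  have "x \<in> L" unfolding hk(4) by (rule subgroup.m_closed[OF L subsetD[OF assms(4) hk(3)] hk(2)])
  then show "x \<in> (K <#> H) \<inter> L" using hk by (auto simp: set_mult_def)
qed

end

section \<open>Compactness for families of closed sets\<close>

context profinite
begin

text \<open>The finite intersection property relative to an open \<open>U\<close>. Intersections are
  cut down to \<open>carrier G\<close> because the empty family has intersection
  \<open>UNIV\<close>.\<close>

lemma compact_Inter:
  assumes "\<And>C. C \<in> \<F> \<Longrightarrow> closedin T C" "openin T U" "carrier G \<inter> \<Inter>\<F> \<subseteq> U"
  shows "\<exists>\<G>. finite \<G> \<and> \<G> \<subseteq> \<F> \<and> carrier G \<inter> \<Inter>\<G> \<subseteq> U"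
proof -
  let ?\<C> = "insert U ((\<lambda>C. carrier G - C) ` \<F>)"
  have "\<exists>\<V>. finite \<V> \<and> \<V> \<subseteq> ?\<C> \<and> topspace T \<subseteq> \<Union>\<V>"
    by (rule compact_space_alt[THEN iffD1, rule_format, OF compact])
      (use assms in \<open>auto simp: closedin_def\<close>)
  then obtain \<V> where V: "finite \<V>" "\<V> \<subseteq> ?\<C>" "carrier G \<subseteq> \<Union>\<V>" by auto
  have "finite (\<V> - {U})" "\<V> - {U} \<subseteq> (\<lambda>C. carrier G - C) ` \<F>" using V by auto
  from finite_subset_image[OF this] obtain \<G> where
    G: "\<G> \<subseteq> \<F>" "finite \<G>" "\<V> - {U} = (\<lambda>C. carrier G - C) ` \<G>" by auto
  have "x \<in> U" if x: "x \<in> carrier G" "x \<in> \<Inter>\<G>" for x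
  proof (rule ccontr)
    assume "x \<notin> U"
    obtain W where "W \<in> \<V>" "x \<in> W" using V(3) x by auto
    then have "W \<in> (\<lambda>C. carrier G - C) ` \<G>" using G \<open>x \<notin> U\<close> by auto
    then show False using x \<open>x \<in> W\<close> by auto
  qed
  then show ?thesis using G by blast
qed

lemma compact_decseq:
  assumes "\<And>n. closedin T (C n)" "\<And>n. C (Suc n) \<subseteq> C n" "openin T U" "(\<Inter>n. C n) \<subseteq> U"
  shows "\<exists>n. C n \<subseteq> U"
proof -
  have dec: "C n \<subseteq> C m" if "m \<le> n" for m n :: nat
    using that by (rule lift_Suc_antimono_le[of C, OF assms(2)])
  have "\<exists>\<G>. finite \<G> \<and> \<G> \<subseteq> range C \<and> carrier G \<inter> \<Inter>\<G> \<subseteq> U"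
    by (rule compact_Inter) (use assms in auto)
  then obtain \<G> where G: "finite \<G>" "\<G> \<subseteq> range C" "carrier G \<inter> \<Inter>\<G> \<subseteq> U" by auto
  from finite_subset_image[OF G(1,2)] obtain I where I: "finite I" "\<G> = C ` I" by auto
  \<comment> \<open>Inserting 0 keeps the maximum defined when the finite subfamily is
    empty.\<close>
  have "C (Max (insert 0 I)) \<subseteq> carrier G" using closedin_subset[OF assms(1)] by simp
  moreover have "C (Max (insert 0 I)) \<subseteq> C i" if "i \<in> I" for i
    using I(1) that by (intro dec Max_ge) auto
  then have "C (Max (insert 0 I)) \<subseteq> \<Inter>\<G>" using I(2) by auto
  ultimately show ?thesis using G(3) by blast
qed

section \<open>Obliquity\<close>

definition invsub :: "'a set \<Rightarrow> 'a set \<Rightarrow> bool" where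
  "invsub A H \<longleftrightarrow> subgroup H G \<and> closedin T H \<and> normalises G A H"

lemma invsubD: "invsub A H \<Longrightarrow> subgroup H G" "invsub A H \<Longrightarrow> closedin T H" "invsub A H \<Longrightarrow> normalises G A H"
  by (auto simp: invsub_def)

lemma closed_normal_iff_invsub: "closed_normal G T N \<longleftrightarrow> invsub (carrier G) N"
  by (auto simp: closed_normal_def invsub_def normal_iff_normalises)

lemma invsub_Int: "invsub A H \<Longrightarrow> invsub A K \<Longrightarrow> invsub A (H \<inter> K)"
  by (auto simp: invsub_def subgroups_Inter_pair normalises_Int)

lemma invsub_Inter: "(\<And>H. H \<in> \<H> \<Longrightarrow> invsub A H) \<Longrightarrow> \<H> \<noteq> {} \<Longrightarrow> invsub A (\<Inter>\<H>)"
  by (auto simp: invsub_def intro!: subgroups_Inter normalises_Inter closedin_Inter)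

lemma invsub_carrier: "A \<subseteq> carrier G \<Longrightarrow> invsub A (carrier G)"
  using closedin_topspace[of T] by (auto simp: invsub_def subgroup_self normalises_def)

lemma invsub_openI: "subgroup H G \<Longrightarrow> openin T H \<Longrightarrow> normalises G A H \<Longrightarrow> invsub A H"
  by (auto simp: invsub_def open_subgroup_closed)

lemma openin_Int_Inter_finite:
  assumes "finite \<H>" "\<And>H. H \<in> \<H> \<Longrightarrow> openin T H" "openin T U"
  shows "openin T (U \<inter> \<Inter>\<H>)"
  using assms by (induction) (auto simp: Int_left_commute)

lemma open_normal_in_open_subgroup:
  assumes "subgroup H G" "openin T H"
  shows "\<exists>N. N \<lhd> G \<and> openin T N \<and> N \<subseteq> H"
  by (rule open_normal_in_clopen) (use assms open_subgroup_closed subgroup.one_closed in auto)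

text \<open>The obliquity argument is run for closed subgroups normalised by a fixed open normal
  subgroup \<open>A\<close>: with \<open>A = G\<close> the hypothesis below is just infiniteness of \<open>G\<close>, and with smaller \<open>A\<close>
  it is what the hereditary property provides.\<close>
definition ji_under :: "'a set \<Rightarrow> bool" where
  "ji_under A \<longleftrightarrow> A \<lhd> G \<and> openin T A \<and> \<not> openin T {\<one>} \<and>
     (\<forall>H. invsub A H \<longrightarrow> H \<noteq> {\<one>} \<longrightarrow> openin T H)"

definition maxinv :: "'a set \<Rightarrow> 'a set \<Rightarrow> 'a set set" where
  "maxinv A L = {M. invsub A M \<and> M \<subset> L \<and> (\<forall>M'. invsub A M' \<and> M \<subseteq> M' \<and> M' \<subset> L \<longrightarrow> M' = M)}"

context
  fixes A assumes A: "ji_under A"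
begin

lemma ji_subgroup: "subgroup A G" and ji_carrier: "A \<subseteq> carrier G" and ji_open_self: "openin T A"
  and ji_invsub_self: "invsub A A"
  using A normal_imp_subgroup[of A G] subgroup.subset[of A G]
  by (auto simp: ji_under_def invsub_def open_subgroup_closed subgroup_normalises_self)

lemma ji_open: "invsub A H \<Longrightarrow> H \<noteq> {\<one>} \<Longrightarrow> openin T H"
  using A by (auto simp: ji_under_def)

text \<open>This is how infiniteness is used: the intersection of two open subgroups is never
  trivial.\<close>

lemma ji_not_open_one: "openin T H \<Longrightarrow> H \<noteq> {\<one>}"
  using A by (auto simp: ji_under_def)

lemma ji_open_if_not_subset:
  assumes "invsub A H" "\<not> H \<subseteq> U" "\<one> \<in> U"
  shows "openin T H"
  using assms by (intro ji_open) auto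

text \<open>Compactness is used twice. The intersection is not inside \<open>U\<close>, as otherwise
  some \<open>H n\<close> would be; so it is nontrivial, hence open, and then some
  \<open>H n\<close> lies inside the intersection, which stops the descent.\<close>

lemma no_descending_chain:
  assumes U: "openin T U" "\<one> \<in> U"
    and H: "\<And>n. invsub A (H n)" "\<And>n. H (Suc n) \<subset> H n" "\<And>n. \<not> H n \<subseteq> U"
  shows False
proof -
  let ?I = "\<Inter>n. H n"
  have I: "invsub A ?I" using H(1) by (intro invsub_Inter) auto
  have "\<not> ?I \<subseteq> U"
    using compact_decseq[of H U] H U invsubD(2) by (metis less_imp_le)
  then have "openin T ?I" using I U ji_open_if_not_subset by blast
  then obtain n where "H n \<subseteq> ?I"
    using compact_decseq[of H ?I] H invsubD(2) by (metis less_imp_le subset_refl)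
  then show False using H(2)[of n] by auto
qed

lemma ex_minimal_invsub:
  assumes U: "openin T U" "\<one> \<in> U" and "P H0"
    and P: "\<And>H. P H \<Longrightarrow> invsub A H \<and> \<not> H \<subseteq> U"
  shows "\<exists>H. P H \<and> (\<forall>H'. P H' \<longrightarrow> \<not> H' \<subset> H)"
proof (rule ccontr)
  assume "\<not> ?thesis"
  then have "\<forall>H. \<exists>H'. P H \<longrightarrow> P H' \<and> H' \<subset> H" by blast
  then obtain f where f: "\<And>H. P H \<Longrightarrow> P (f H) \<and> f H \<subset> H" by metis
  define S where "S n = (f ^^ n) H0" for n
  have "P (S n)" for n by (induction n) (auto simp: S_def f \<open>P H0\<close>)
  then show False using no_descending_chain[OF U, of S] f P by (auto simp: S_def)
qed

lemma ex_maxinv_above: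
  assumes "invsub A H" "H \<noteq> {\<one>}" "H \<subset> L"
  shows "\<exists>M\<in>maxinv A L. H \<subseteq> M"
proof -
  let ?S = "{M. invsub A M \<and> H \<subseteq> M \<and> M \<subset> L}"
  have "finite ?S"
    using finite_open_overgroups[OF invsubD(1)[OF assms(1)] ji_open[OF assms(1,2)]]
    by (rule rev_finite_subset) (auto simp: invsub_def)
  moreover have "H \<in> ?S" using assms by auto
  ultimately have "\<exists>M\<in>?S. H \<subseteq> M \<and> (\<forall>M'\<in>?S. M \<subseteq> M' \<longrightarrow> M = M')"
    by (rule finite_has_maximal2)
  then obtain M where "M \<in> ?S" "\<forall>M'\<in>?S. M \<subseteq> M' \<longrightarrow> M = M'" by (elim bexE conjE)
  then show ?thesis unfolding maxinv_def by (intro bexI[of _ M]) auto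
qed

lemma ex_proper_invsub:
  assumes "invsub A L" "L \<noteq> {\<one>}"
  shows "\<exists>H. invsub A H \<and> openin T H \<and> H \<subset> L"
proof -
  obtain x where x: "x \<in> L" "x \<noteq> \<one>" using assms subgroup.one_closed invsubD(1) by blast
  then obtain N where N: "N \<lhd> G" "openin T N" "x \<notin> N"
    using ex_open_normal_notin subgroup.mem_carrier[OF invsubD(1)[OF assms(1)]] by blast
  have "invsub A N"
    using N ji_carrier by (auto simp: normal_iff_normalises intro!: invsub_openI normalises_mono[of G "carrier G"])
  then have "invsub A (N \<inter> L)" using invsub_Int assms by blast
  moreover have "openin T (N \<inter> L)" using N assms ji_open by auto
  ultimately show ?thesis using x N by blast
qed

text \<open>Take \<open>M1\<close> maximal and \<open>K\<close> minimal among the invariant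
  subgroups of \<open>L\<close> not inside \<open>M1\<close>. If the intersection were trivial, some
  maximal \<open>M\<close> would miss an element of \<open>K \<inter> M1\<close>. Then
  \<open>M (K \<inter> M1) = L\<close>, and the modular law gives
  \<open>K = (K \<inter> M) (K \<inter> M1)\<close> with both factors inside \<open>M1\<close>. That
  \<open>L\<close> lies in \<open>A\<close> makes \<open>M\<close> normalise
  \<open>K \<inter> M1\<close>, so that the product is a subgroup.\<close>

lemma Inter_maxinv_nontrivial:
  assumes L: "invsub A L" "L \<noteq> {\<one>}" "L \<subseteq> A"
  shows "L \<inter> \<Inter>(maxinv A L) \<noteq> {\<one>}"
proof
  assume triv: "L \<inter> \<Inter>(maxinv A L) = {\<one>}"
  obtain H where "invsub A H" "openin T H" "H \<subset> L" using ex_proper_invsub L by blast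
  then obtain M1 where M1: "M1 \<in> maxinv A L" "H \<subseteq> M1" using ex_maxinv_above ji_not_open_one by blast
  then have i1: "invsub A M1" "M1 \<subset> L" by (auto simp: maxinv_def)
  have o1: "openin T M1"
    using open_overgroup[OF invsubD(1)[OF \<open>invsub A H\<close>] \<open>openin T H\<close> invsubD(1)[OF i1(1)] M1(2)] .
  have one1: "\<one> \<in> M1" using i1 invsubD(1) subgroup.one_closed by blast
  have "\<exists>K. (invsub A K \<and> K \<subseteq> L \<and> \<not> K \<subseteq> M1) \<and>
      (\<forall>K'. invsub A K' \<and> K' \<subseteq> L \<and> \<not> K' \<subseteq> M1 \<longrightarrow> \<not> K' \<subset> K)"
    by (rule ex_minimal_invsub[OF o1 one1, of _ L]) (use L i1 in auto)
  then obtain K where K: "invsub A K" "K \<subseteq> L" "\<not> K \<subseteq> M1"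
    and Kmin: "\<And>K'. invsub A K' \<Longrightarrow> K' \<subseteq> L \<Longrightarrow> \<not> K' \<subseteq> M1 \<Longrightarrow> \<not> K' \<subset> K"
    by metis
  have "openin T K" using K one1 ji_open_if_not_subset by blast
  then have "K \<inter> M1 \<noteq> {\<one>}" using o1 ji_not_open_one openin_Int by blast
  moreover have iKM1: "invsub A (K \<inter> M1)" using K i1 invsub_Int by blast
  ultimately obtain x where x: "x \<in> K" "x \<in> M1" "x \<noteq> \<one>" using subgroup.one_closed invsubD(1) by blast
  then obtain M where M: "M \<in> maxinv A L" "x \<notin> M" using triv K by blast
  then have iM: "invsub A M" "M \<subset> L" by (auto simp: maxinv_def)
  \<comment> \<open>\<open>x\<close> lies in \<open>K\<close> but not in \<open>M\<close>, so
    \<open>K \<inter> M\<close> is strictly below the minimal \<open>K\<close>.\<close>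
  have KM: "K \<inter> M \<subseteq> M1"
    using Kmin[of "K \<inter> M"] K x M iM invsub_Int by blast
  let ?P = "M <#> (K \<inter> M1)"
  note sg = invsubD(1)[OF iM(1)] invsubD(1)[OF iKM1]
  have "normalises G M (K \<inter> M1)"
    using invsubD(3)[OF iKM1] iM L normalises_mono by blast
  then have sP: "subgroup ?P G" using subgroup_set_mult sg by blast
  have nP: "normalises G A ?P" using normalises_set_mult[OF sg ji_carrier] invsubD(3) iM iKM1 by blast
  have MP: "M \<subseteq> ?P" using set_mult_upper1 sg by blast
  have KP: "K \<inter> M1 \<subseteq> ?P" using set_mult_upper2 sg by blast
  have "openin T (K \<inter> M1)" using o1 \<open>openin T K\<close> by blast
  then have "openin T ?P" using open_overgroup sg sP KP by blast
  then have "invsub A ?P" using sP nP invsub_openI by blast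
  moreover have "?P \<subseteq> L" by (rule set_mult_least[OF _ _ invsubD(1)[OF L(1)]]) (use iM K in auto)
  ultimately have "?P = L" using M MP KP x unfolding maxinv_def by blast
  then have "K = ?P \<inter> K" using K by blast
  also have "\<dots> = M \<inter> K <#> K \<inter> M1"
    using dedekind sg(1) sg(2) invsubD(1)[OF K(1)] by blast
  also have "\<dots> \<subseteq> M1"
    by (rule set_mult_least[OF _ _ invsubD(1)[OF i1(1)]]) (use KM in auto)
  finally show False using K by blast
qed

lemma invsub_Inter_maxinv:
  assumes "invsub A L"
  shows "invsub A (L \<inter> \<Inter>(maxinv A L))"
  using assms invsub_Inter[of "insert L (maxinv A L)"] by (auto simp: maxinv_def)

text \<open>Let \<open>Y\<close> be a minimal counterexample, and let \<open>V\<close> be the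
  intersection of \<open>Y \<inter> A\<close> with its maximal invariant subgroups. For
  \<open>H\<close> properly inside \<open>Y\<close> the product \<open>V H\<close> is still proper,
  because \<open>V\<close> consists of nongenerators. So every such \<open>H\<close> lies in one of
  the finitely many invariant subgroups from the open \<open>V\<close> up to, but excluding,
  \<open>Y\<close>, and each of these is bounded by minimality.\<close>

lemma obliquity_subgroup:
  assumes U: "openin T U" "\<one> \<in> U"
  shows "\<exists>D. subgroup D G \<and> openin T D \<and> (\<forall>H. invsub A H \<and> \<not> H \<subseteq> U \<longrightarrow> D \<subseteq> H)"
proof (rule ccontr)
  assume unb: "\<not> ?thesis"
  let ?bdd = "\<lambda>Y. \<exists>D. subgroup D G \<and> openin T D \<and> (\<forall>H. invsub A H \<and> \<not> H \<subseteq> U \<and> H \<subseteq> Y \<longrightarrow> D \<subseteq> H)"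
  \<comment> \<open>If \<open>U\<close> were everything, no \<open>H\<close> would escape it and
    \<open>carrier G\<close> itself would serve as the bound.\<close>
  have "\<not> carrier G \<subseteq> U"
    using unb subgroup_self openin_topspace[of T] invsubD(1) subgroup.subset by fastforce
  moreover have "\<not> ?bdd (carrier G)" using unb invsubD(1) subgroup.subset by metis
  ultimately obtain Y where Y: "invsub A Y" "\<not> Y \<subseteq> U" "\<not> ?bdd Y"
    and Ymin: "\<And>Y'. invsub A Y' \<and> \<not> Y' \<subseteq> U \<and> \<not> ?bdd Y' \<Longrightarrow> \<not> Y' \<subset> Y"
    using ex_minimal_invsub[OF U, of "\<lambda>Y. invsub A Y \<and> \<not> Y \<subseteq> U \<and> \<not> ?bdd Y" "carrier G"]
      invsub_carrier[OF ji_carrier] by blast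
  have oY: "openin T Y" using Y U ji_open_if_not_subset by blast
  \<comment> \<open>Cutting with \<open>A\<close> makes the previous lemma applicable, and it makes
    \<open>V\<close> normalise every invariant \<open>H\<close>.\<close>
  let ?L = "Y \<inter> A"
  have L: "invsub A ?L" "?L \<noteq> {\<one>}"
    using invsub_Int Y ji_invsub_self oY ji_open_self ji_not_open_one openin_Int by blast+
  let ?V = "?L \<inter> \<Inter>(maxinv A ?L)"
  have V: "invsub A ?V" using invsub_Inter_maxinv L by blast
  have oV: "openin T ?V" using Inter_maxinv_nontrivial L V ji_open by blast
  note sV = invsubD(1)[OF V]
  have VH: "invsub A (?V <#> H) \<and> ?V \<subseteq> ?V <#> H \<and> H \<subseteq> ?V <#> H \<and> ?V <#> H \<subset> Y"
    if H: "invsub A H" "\<not> H \<subseteq> U" "H \<subset> Y" for H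
  proof -
    note sH = invsubD(1)[OF H(1)]
    have "normalises G ?V H" by (rule normalises_mono[OF invsubD(3)[OF H(1)]]) auto
    then have s: "subgroup (?V <#> H) G" using subgroup_set_mult sV sH by blast
    have n: "normalises G A (?V <#> H)"
      using normalises_set_mult[OF sV sH ji_carrier] invsubD(3) V H by blast
    have u1: "?V \<subseteq> ?V <#> H" using set_mult_upper1 sV sH by blast
    have u2: "H \<subseteq> ?V <#> H" using set_mult_upper2 sV sH by blast
    have "openin T (?V <#> H)" using open_overgroup sV oV s u1 by blast
    then have i: "invsub A (?V <#> H)" using invsub_openI s n by blast
    have le: "?V <#> H \<subseteq> Y" by (rule set_mult_least[OF _ _ invsubD(1)[OF Y(1)]]) (use H in auto)
    moreover have "?V <#> H \<noteq> Y"
    proof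
      assume eq: "?V <#> H = Y"
      have "H \<inter> A = ?L"
      proof (rule ccontr)
        assume ne: "H \<inter> A \<noteq> ?L"
        have "openin T H" using H U ji_open_if_not_subset by blast
        then have "invsub A (H \<inter> A)" "H \<inter> A \<noteq> {\<one>}" "H \<inter> A \<subset> ?L"
          using invsub_Int H ji_invsub_self ji_open_self ji_not_open_one openin_Int ne by blast+
        then obtain M where M: "M \<in> maxinv A ?L" "H \<inter> A \<subseteq> M" using ex_maxinv_above by blast
        \<comment> \<open>The nongenerator step: \<open>V\<close> and \<open>H \<inter> A\<close>
          lie in the same maximal \<open>M\<close>, yet together they would generate all of
          \<open>Y \<inter> A\<close>.\<close>
        have "?L = ?V <#> (H \<inter> A)"
          using dedekind_left[OF sH sV ji_subgroup] eq by blast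
        also have "\<dots> \<subseteq> M"
          by (rule set_mult_least) (use M invsubD(1) in \<open>auto simp: maxinv_def\<close>)
        finally show False using M by (auto simp: maxinv_def)
      qed
      then have "?V <#> H \<subseteq> H" by (intro set_mult_least[OF _ _ sH]) auto
      then show False using eq H by blast
    qed
    ultimately show ?thesis using i u1 u2 by blast
  qed
  define \<F> where "\<F> = {Y'. invsub A Y' \<and> \<not> Y' \<subseteq> U \<and> ?V \<subseteq> Y' \<and> Y' \<subset> Y}"
  have fin: "finite \<F>"
    by (rule finite_subset[OF _ finite_open_overgroups[OF sV oV]]) (use invsubD(1) in \<open>auto simp: \<F>_def\<close>)
  have "\<forall>Y'\<in>\<F>. ?bdd Y'" using Ymin unfolding \<F>_def by blast
  then obtain d where d: "\<And>Y'. Y' \<in> \<F> \<Longrightarrow> subgroup (d Y') G \<and> openin T (d Y') \<and>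
      (\<forall>H. invsub A H \<and> \<not> H \<subseteq> U \<and> H \<subseteq> Y' \<longrightarrow> d Y' \<subseteq> H)" by metis
  \<comment> \<open>The term \<open>Y\<close> takes care of \<open>H = Y\<close>, the terms
    \<open>d Y'\<close> of all smaller \<open>H\<close>.\<close>
  let ?D = "Y \<inter> \<Inter>(d ` \<F>)"
  have "subgroup ?D G"
    using subgroups_Inter[of "insert Y (d ` \<F>)"] d invsubD(1)[OF Y(1)] by auto
  moreover have "openin T ?D"
    by (rule openin_Int_Inter_finite) (use fin d oY in auto)
  moreover have "?D \<subseteq> H" if H: "invsub A H" "\<not> H \<subseteq> U" "H \<subseteq> Y" for H
  proof (cases "H = Y")
    case False
    then have *: "invsub A (?V <#> H) \<and> ?V \<subseteq> ?V <#> H \<and> H \<subseteq> ?V <#> H \<and> ?V <#> H \<subset> Y"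
      using VH H by blast
    then have "?V <#> H \<in> \<F>" using H unfolding \<F>_def by blast
    then have "d (?V <#> H) \<subseteq> H" using d H * by blast
    then show ?thesis using \<open>?V <#> H \<in> \<F>\<close> by blast
  qed auto
  ultimately have "?bdd Y" by blast
  then show False using Y by blast
qed

lemma obliquity:
  assumes U: "openin T U" "\<one> \<in> U"
  shows "\<exists>D. D \<lhd> G \<and> openin T D \<and> (\<forall>H. invsub A H \<and> \<not> H \<subseteq> U \<longrightarrow> D \<subseteq> H)"
proof -
  obtain D where D: "subgroup D G" "openin T D" "\<And>H. invsub A H \<and> \<not> H \<subseteq> U \<Longrightarrow> D \<subseteq> H"
    using obliquity_subgroup[OF U] by blast
  obtain N where "N \<lhd> G" "openin T N" "N \<subseteq> D" using open_normal_in_open_subgroup[OF D(1,2)] by auto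
  then show ?thesis using D by blast
qed

end

end

section \<open>Subnormal sections and chief factors\<close>

text \<open>That \<open>R / S\<close> is isomorphic to \<open>Q\<close> is expressed by an epimorphism \<open>R \<rightarrow> Q\<close> with kernel \<open>S\<close>; this
  keeps all sections inside the ambient group.\<close>
definition epi_ker :: "('a, 'c) monoid_scheme \<Rightarrow> 'a set \<Rightarrow> 'a set \<Rightarrow> ('b, 'd) monoid_scheme \<Rightarrow> ('a \<Rightarrow> 'b) \<Rightarrow> bool" where
  "epi_ker G R S Q \<phi> \<longleftrightarrow> group Q \<and> S \<subseteq> R \<and> \<phi> ` R = carrier Q \<and>
     (\<forall>x\<in>R. \<forall>y\<in>R. \<phi> (x \<otimes>\<^bsub>G\<^esub> y) = \<phi> x \<otimes>\<^bsub>Q\<^esub> \<phi> y) \<and> (\<forall>x\<in>R. \<phi> x = \<one>\<^bsub>Q\<^esub> \<longleftrightarrow> x \<in> S)"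

text \<open>Subnormal subgroups of \<open>E\<close>, built downwards from \<open>E\<close>. Steps
  with \<open>H = Y\<close> are permitted, so that intersecting a chain with a fixed subgroup needs
  no case distinction.\<close>

inductive subn :: "('a, 'b) monoid_scheme \<Rightarrow> 'a set \<Rightarrow> 'a set \<Rightarrow> bool" for G E where
  refl: "subgroup E G \<Longrightarrow> subn G E E"
| step: "subn G E Y \<Longrightarrow> subgroup H G \<Longrightarrow> H \<subseteq> Y \<Longrightarrow> normalises G Y H \<Longrightarrow> subn G E H"

lemma subn_subgroup: "subn G E H \<Longrightarrow> subgroup H G"
  by (induction rule: subn.induct) auto

lemma subn_subset: "subn G E H \<Longrightarrow> H \<subseteq> E"
  by (induction rule: subn.induct) auto

definition chief :: "('a, 'b) monoid_scheme \<Rightarrow> 'a set \<Rightarrow> 'a set \<Rightarrow> bool" where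
  "chief G R S \<longleftrightarrow> R \<lhd> G \<and> S \<lhd> G \<and> S \<subset> R \<and> (\<forall>N. N \<lhd> G \<and> S \<subseteq> N \<and> N \<subseteq> R \<longrightarrow> N = S \<or> N = R)"

context group
begin

lemma subn_Int:
  assumes "subn G E H" "subgroup R G"
  shows "subn G (E \<inter> R) (H \<inter> R)"
  using assms(1)
proof (induction rule: subn.induct)
  case refl
  then show ?case using assms(2) by (intro subn.refl subgroups_Inter_pair)
next
  case (step Y H)
  have "normalises G (Y \<inter> R) (H \<inter> R)"
    using step(4) subgroup_normalises_self[OF assms(2)] by (auto simp: normalises_def)
  then show ?case using step by (intro subn.step[OF step(5)] subgroups_Inter_pair assms) auto
qed

lemma subn_simple:
  assumes "simple_group G" "subn G (carrier G) H"
  shows "H = {\<one>} \<or> H = carrier G"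
  using assms(2)
proof (induction rule: subn.induct)
  case (step Y H)
  show ?case
  proof (cases "Y = carrier G")
    case True
    then have "H \<lhd> G" using step by (simp add: normal_iff_normalises)
    then show ?thesis using simple_group.no_real_normal_subgroup[OF assms(1)] by auto
  next
    case False
    then show ?thesis using step subgroup.one_closed[OF step(2)] by auto
  qed
qed auto

context
  fixes R S and Q :: "('q, 'r) monoid_scheme" and \<phi>
  assumes e: "epi_ker G R S Q \<phi>"
begin

lemma epi_group: "group Q" and epi_ker_subset: "S \<subseteq> R" and epi_image: "\<phi> ` R = carrier Q"
  and epi_mult: "x \<in> R \<Longrightarrow> y \<in> R \<Longrightarrow> \<phi> (x \<otimes> y) = \<phi> x \<otimes>\<^bsub>Q\<^esub> \<phi> y"
  and epi_one_iff: "x \<in> R \<Longrightarrow> \<phi> x = \<one>\<^bsub>Q\<^esub> \<longleftrightarrow> x \<in> S"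
  and epi_closed: "x \<in> R \<Longrightarrow> \<phi> x \<in> carrier Q"
  using e by (auto simp: epi_ker_def)

lemma epi_restrict:
  assumes "R' \<subseteq> R" "\<phi> ` R' = carrier Q"
  shows "epi_ker G R' (R' \<inter> S) Q \<phi>"
  using assms epi_group epi_mult epi_one_iff by (auto simp: epi_ker_def subset_iff)

lemma epi_iso:
  assumes "h \<in> iso Q Q'" "group Q'"
  shows "epi_ker G R S Q' (h \<circ> \<phi>)"
proof -
  interpret Q: group Q by (rule epi_group)
  have h: "\<And>x y. x \<in> carrier Q \<Longrightarrow> y \<in> carrier Q \<Longrightarrow> h (x \<otimes>\<^bsub>Q\<^esub> y) = h x \<otimes>\<^bsub>Q'\<^esub> h y"
    and b: "bij_betw h (carrier Q) (carrier Q')" using assms(1) by (auto simp: iso_def hom_def)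
  have h1: "h \<one>\<^bsub>Q\<^esub> = \<one>\<^bsub>Q'\<^esub>"
    using hom_one[of h Q Q'] assms Q.is_group by (auto simp: iso_def)
  have "h (\<phi> x) = \<one>\<^bsub>Q'\<^esub> \<longleftrightarrow> \<phi> x = \<one>\<^bsub>Q\<^esub>" if "x \<in> R" for x
    using h1 b that epi_closed Q.one_closed by (metis bij_betw_imp_inj_on inj_onD)
  moreover have "(h \<circ> \<phi>) ` R = carrier Q'"
    using epi_image b by (metis bij_betw_imp_surj_on image_comp)
  ultimately show ?thesis using assms(2) by (auto simp: epi_ker_def epi_ker_subset[THEN subsetD] epi_mult epi_one_iff epi_closed h)
qed

end

context
  fixes R S and Q :: "('q, 'r) monoid_scheme" and \<phi>
  assumes e: "epi_ker G R S Q \<phi>" and sR: "subgroup R G"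
begin

lemma epi_hom: "group_hom (G\<lparr>carrier := R\<rparr>) Q \<phi>"
  using e subgroup_imp_group[OF sR] by (auto simp: epi_ker_def group_hom_def group_hom_axioms_def hom_def)

lemma epi_one: "\<phi> \<one> = \<one>\<^bsub>Q\<^esub>"
  using group_hom.hom_one[OF epi_hom] by simp

lemma epi_inv: "x \<in> R \<Longrightarrow> \<phi> (inv x) = inv\<^bsub>Q\<^esub> \<phi> x"
  using group_hom.hom_inv[OF epi_hom, of x] m_inv_consistent[OF sR] by simp

lemma epi_conj: "x \<in> R \<Longrightarrow> y \<in> R \<Longrightarrow> \<phi> (x \<otimes> y \<otimes> inv x) = \<phi> x \<otimes>\<^bsub>Q\<^esub> \<phi> y \<otimes>\<^bsub>Q\<^esub> inv\<^bsub>Q\<^esub> \<phi> x"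
  by (simp add: epi_mult[OF e] epi_inv subgroup.m_closed[OF sR] subgroup.m_inv_closed[OF sR])

lemma epi_eq_iff:
  assumes "x \<in> R" "y \<in> R"
  shows "\<phi> x = \<phi> y \<longleftrightarrow> x \<otimes> inv y \<in> S"
proof -
  interpret Q: group Q by (rule epi_group[OF e])
  have "x \<otimes> inv y \<in> R" using assms subgroup.m_closed[OF sR] subgroup.m_inv_closed[OF sR] by simp
  then have "x \<otimes> inv y \<in> S \<longleftrightarrow> \<phi> x \<otimes>\<^bsub>Q\<^esub> inv\<^bsub>Q\<^esub> \<phi> y = \<one>\<^bsub>Q\<^esub>"
    using epi_one_iff[OF e] epi_mult[OF e] epi_inv assms subgroup.m_inv_closed[OF sR] by metis
  also have "\<dots> \<longleftrightarrow> \<phi> x = \<phi> y"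
    using epi_closed[OF e] assms by (metis Q.inv_closed Q.inv_inv Q.inv_equality Q.r_inv)
  finally show ?thesis by simp
qed

lemma epi_ker_subgroup: "subgroup S G" and epi_ker_normalised: "normalises G R S"
proof -
  interpret Q: group Q by (rule epi_group[OF e])
  note cl = subgroup.m_closed[OF sR] subgroup.m_inv_closed[OF sR]
  have mem: "x \<in> S \<longleftrightarrow> x \<in> R \<and> \<phi> x = \<one>\<^bsub>Q\<^esub>" for x using epi_one_iff[OF e] epi_ker_subset[OF e] by auto
  show "subgroup S G"
  proof (rule subgroupI)
    show "S \<subseteq> carrier G" using epi_ker_subset[OF e] subgroup.subset[OF sR] by auto
    show "S \<noteq> {}" using mem epi_one subgroup.one_closed[OF sR] by auto
  qed (simp_all add: mem cl epi_mult[OF e] epi_inv)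
  show "normalises G R S" unfolding normalises_def
    by (auto simp: mem cl epi_conj epi_closed[OF e])
qed

lemma epi_image_subgroup:
  assumes "subgroup N G" "N \<subseteq> R"
  shows "subgroup (\<phi> ` N) Q"
proof -
  have "subgroup N (G\<lparr>carrier := R\<rparr>)" using assms subgroup_incl[OF assms(1) sR] by simp
  then show ?thesis using group_hom.subgroup_img_is_subgroup[OF epi_hom] by blast
qed

lemma epi_image_normalises:
  assumes "normalises G M N" "M \<subseteq> R" "N \<subseteq> R"
  shows "normalises Q (\<phi> ` M) (\<phi> ` N)"
  unfolding normalises_def
proof (clarsimp)
  fix x y assume xy: "x \<in> M" "y \<in> N"
  then have "\<phi> x \<otimes>\<^bsub>Q\<^esub> \<phi> y \<otimes>\<^bsub>Q\<^esub> inv\<^bsub>Q\<^esub> \<phi> x = \<phi> (x \<otimes> y \<otimes> inv x)"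
    using epi_conj assms by (metis subsetD)
  then show "\<phi> x \<otimes>\<^bsub>Q\<^esub> \<phi> y \<otimes>\<^bsub>Q\<^esub> inv\<^bsub>Q\<^esub> \<phi> x \<in> \<phi> ` N"
    using normalisesD[OF assms(1) xy] by auto
qed

lemma epi_image_subn:
  assumes "subn G E H" "E \<subseteq> R"
  shows "subn Q (\<phi> ` E) (\<phi> ` H)"
  using assms
proof (induction rule: subn.induct)
  case refl
  then show ?case by (intro subn.refl epi_image_subgroup) 
next
  case (step Y H)
  have "Y \<subseteq> R" using step subn_subset by blast
  then show ?case using step by (intro subn.step[OF step(5)] epi_image_subgroup epi_image_normalises) auto
qed

lemma epi_simple:
  assumes "simple_group Q" "subgroup N G" "N \<subseteq> R" "normalises G R N"
  shows "N \<subseteq> S \<or> \<phi> ` N = carrier Q"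
proof -
  interpret Q: group Q by (rule epi_group[OF e])
  have "\<phi> ` N \<lhd> Q"
    unfolding Q.normal_iff_normalises
    using epi_image_subgroup[OF assms(2,3)] epi_image_normalises[OF assms(4)] assms(3) epi_image[OF e] by auto
  then have "\<phi> ` N = carrier Q \<or> \<phi> ` N = {\<one>\<^bsub>Q\<^esub>}"
    using simple_group.no_real_normal_subgroup[OF assms(1)] by blast
  then show ?thesis using epi_one_iff[OF e] assms(3) by blast
qed

lemma epi_simple_proper:
  assumes "simple_group Q"
  shows "S \<noteq> R"
proof
  assume "S = R"
  then have "\<phi> ` R \<subseteq> {\<one>\<^bsub>Q\<^esub>}" using epi_one_iff[OF e] by auto
  moreover have "\<one>\<^bsub>Q\<^esub> \<in> \<phi> ` R" using epi_one subgroup.one_closed[OF sR] by force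
  ultimately show False using simple_group.simple_not_triv[OF assms] epi_image[OF e] by auto
qed

text \<open>The first isomorphism theorem in this encoding: both targets are \<open>R / S\<close>.
  Sending \<open>\<phi> x\<close> to \<open>\<psi> x\<close> is well defined and injective because
  the two maps have the same fibres.\<close>

lemma epi_unique_iso:
  assumes "epi_ker G R S Q' \<psi>"
  shows "\<exists>h. h \<in> iso Q Q'"
proof -
  interpret Q: group Q by (rule epi_group[OF e])
  have e': "epi_ker G R S Q' \<psi>" by fact
  interpret Q': group Q' using e' by (simp add: epi_ker_def)
  have eq': "\<psi> x = \<psi> y \<longleftrightarrow> x \<otimes> inv y \<in> S" if "x \<in> R" "y \<in> R" for x y
  proof -
    have "x \<otimes> inv y \<in> R" "inv y \<in> R" using that subgroup.m_closed[OF sR] subgroup.m_inv_closed[OF sR] by auto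
    have hom: "group_hom (G\<lparr>carrier := R\<rparr>) Q' \<psi>"
      using e' subgroup_imp_group[OF sR] by (auto simp: epi_ker_def group_hom_def group_hom_axioms_def hom_def)
    have "\<psi> (inv y) = inv\<^bsub>Q'\<^esub> \<psi> y"
      using group_hom.hom_inv[OF hom, of y] that m_inv_consistent[OF sR] by simp
    then have "x \<otimes> inv y \<in> S \<longleftrightarrow> \<psi> x \<otimes>\<^bsub>Q'\<^esub> inv\<^bsub>Q'\<^esub> \<psi> y = \<one>\<^bsub>Q'\<^esub>"
      using e' that \<open>x \<otimes> inv y \<in> R\<close> \<open>inv y \<in> R\<close> unfolding epi_ker_def by metis
    moreover have "\<psi> x \<in> carrier Q'" "\<psi> y \<in> carrier Q'" using e' that by (auto simp: epi_ker_def)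
    ultimately show ?thesis by (metis Q'.inv_closed Q'.inv_inv Q'.inv_equality Q'.r_inv)
  qed
  define h where "h q = \<psi> (SOME x. x \<in> R \<and> \<phi> x = q)" for q
  have h: "h (\<phi> x) = \<psi> x" if "x \<in> R" for x
  proof -
    have "(SOME y. y \<in> R \<and> \<phi> y = \<phi> x) \<in> R \<and> \<phi> (SOME y. y \<in> R \<and> \<phi> y = \<phi> x) = \<phi> x"
      by (rule someI_ex) (use that in auto)
    then show ?thesis unfolding h_def using eq' epi_eq_iff that by blast
  qed
  have im: "h ` carrier Q = carrier Q'"
  proof -
    have "h ` carrier Q = (\<lambda>x. h (\<phi> x)) ` R" unfolding epi_image[OF e, symmetric] image_image ..
    also have "\<dots> = \<psi> ` R" using h by simp
    finally show ?thesis using e' by (simp add: epi_ker_def)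
  qed
  have "h \<in> hom Q Q'"
  proof (rule homI)
    show "h q \<in> carrier Q'" if "q \<in> carrier Q" for q using im that by auto
    fix p q assume "p \<in> carrier Q" "q \<in> carrier Q"
    then obtain x y where xy: "x \<in> R" "y \<in> R" "p = \<phi> x" "q = \<phi> y" using epi_image[OF e] by blast
    have "h (p \<otimes>\<^bsub>Q\<^esub> q) = h (\<phi> (x \<otimes> y))" using xy by (simp only: epi_mult[OF e])
    also have "\<dots> = \<psi> (x \<otimes> y)" by (rule h) (rule subgroup.m_closed[OF sR xy(1,2)])
    also have "\<dots> = \<psi> x \<otimes>\<^bsub>Q'\<^esub> \<psi> y" using e' xy by (simp only: epi_ker_def)
    finally show "h (p \<otimes>\<^bsub>Q\<^esub> q) = h p \<otimes>\<^bsub>Q'\<^esub> h q" using h xy by simp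
  qed
  moreover have "inj_on h (carrier Q)"
  proof (rule inj_onI)
    fix p q assume "p \<in> carrier Q" "q \<in> carrier Q" "h p = h q"
    then obtain x y where xy: "x \<in> R" "y \<in> R" "p = \<phi> x" "q = \<phi> y" using epi_image[OF e] by blast
    then show "p = q" using \<open>h p = h q\<close> h eq' epi_eq_iff by auto
  qed
  ultimately show ?thesis using im by (auto simp: iso_def bij_betw_def)
qed

end

lemma epi_canonical:
  assumes "subgroup R G" "subgroup S G" "S \<subseteq> R" "normalises G R S"
  shows "epi_ker G R S ((G\<lparr>carrier := R\<rparr>) Mod S) (\<lambda>x. S #> x)"
proof -
  let ?R = "G\<lparr>carrier := R\<rparr>"
  interpret R: group ?R by (rule subgroup_imp_group) fact
  have "subgroup S ?R" using subgroup_incl assms by blast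
  moreover have "normalises ?R (carrier ?R) S"
    using assms(4) m_inv_consistent[OF assms(1)] by (auto simp: normalises_def)
  ultimately have n: "S \<lhd> ?R" using R.normal_iff_normalises by blast
  interpret S: normal S ?R by (rule n)
  show ?thesis unfolding epi_ker_def
  proof (intro conjI ballI)
    show "group (?R Mod S)" by (rule S.factorgroup_is_group)
    show "(#>) S ` R = carrier (?R Mod S)" by (auto simp: carrier_FactGroup)
    fix x assume x: "x \<in> R"
    then have xc: "x \<in> carrier G" using subgroup.mem_carrier[OF assms(1)] by blast
    show "(S #> x = \<one>\<^bsub>?R Mod S\<^esub>) = (x \<in> S)"
      using coset_join1[of S x] coset_join2[OF xc] subgroup.subset assms(2) xc by auto
    fix y assume y: "y \<in> R"
    show "S #> (x \<otimes> y) = (S #> x) \<otimes>\<^bsub>?R Mod S\<^esub> (S #> y)"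
      using S.rcos_sum[of x y] x y by simp
  qed (use assms in auto)
qed

lemma simple_quotient_if_maximal:
  assumes e: "epi_ker G R S Q \<phi>" and sR: "subgroup R G" and "S \<noteq> R" and fin: "finite (rcosets S)"
    and max: "\<And>M. subgroup M G \<Longrightarrow> S \<subseteq> M \<Longrightarrow> M \<subseteq> R \<Longrightarrow> normalises G R M \<Longrightarrow> M = S \<or> M = R"
  shows "simple_group Q"
proof -
  interpret Q: group Q by (rule epi_group[OF e])
  note im = epi_image[OF e]
  have S: "subgroup S G" by (rule epi_ker_subgroup[OF e sR])
  \<comment> \<open>Simplicity requires \<open>order Q > 1\<close>, and \<open>order\<close> is 0
    for an infinite carrier. So finiteness of the quotient has to be shown as well as
    nontriviality.\<close>
  have "finite (carrier Q)"
  proof -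
    have "carrier Q \<subseteq> (\<lambda>C. \<phi> (SOME x. x \<in> C \<inter> R)) ` (rcosets S)"
    proof
      fix q assume "q \<in> carrier Q"
      then obtain x where x: "x \<in> R" "q = \<phi> x" using im by auto
      then have xc: "x \<in> carrier G" using subgroup.mem_carrier[OF sR] by blast
      define y where "y = (SOME y. y \<in> (S #> x) \<inter> R)"
      have "x \<in> (S #> x) \<inter> R" using x rcos_self[OF xc S] by simp
      then have y: "y \<in> (S #> x) \<inter> R" unfolding y_def by (rule someI)
      then obtain s where s: "s \<in> S" "y = s \<otimes> x" by (auto simp: r_coset_def)
      have sR': "s \<in> R" using s epi_ker_subset[OF e] by auto
      have "\<phi> y = \<phi> s \<otimes>\<^bsub>Q\<^esub> \<phi> x" using epi_mult[OF e] sR' x s by simp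
      also have "\<phi> s = \<one>\<^bsub>Q\<^esub>" using epi_one_iff[OF e] s sR' by simp
      finally have "q = \<phi> y" using x epi_closed[OF e] by simp
      then show "q \<in> (\<lambda>C. \<phi> (SOME x. x \<in> C \<inter> R)) ` (rcosets S)"
        unfolding y_def using xc by (auto simp: RCOSETS_def)
    qed
    then show ?thesis using fin finite_surj by blast
  qed
  moreover obtain x where "x \<in> R" "x \<notin> S" using \<open>S \<noteq> R\<close> epi_ker_subset[OF e] by auto
  then have "\<phi> x \<noteq> \<one>\<^bsub>Q\<^esub>" "\<phi> x \<in> carrier Q" using epi_one_iff[OF e] epi_closed[OF e] by auto
  then have "order Q \<noteq> 1" using Q.order_one_triv_iff by blast
  ultimately have "order Q > 1" using Q.order_gt_0_iff_finite by linarith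
  moreover have "N = carrier Q \<or> N = {\<one>\<^bsub>Q\<^esub>}" if N: "N \<lhd> Q" for N
  proof -
    define M where "M = {x \<in> R. \<phi> x \<in> N}"
    note sN = normal_imp_subgroup[OF N]
    have "subgroup M G"
    proof (rule subgroupI)
      show "M \<subseteq> carrier G" using subgroup.subset[OF sR] by (auto simp: M_def)
      show "M \<noteq> {}" using subgroup.one_closed[OF sR] epi_one[OF e sR] subgroup.one_closed[OF sN]
        by (auto simp: M_def)
    qed (auto simp: M_def epi_inv[OF e sR] epi_mult[OF e] subgroup.m_closed[OF sR] subgroup.m_inv_closed[OF sR]
        subgroup.m_closed[OF sN] subgroup.m_inv_closed[OF sN])
    moreover have "S \<subseteq> M"
    proof
      fix t assume t: "t \<in> S"
      then have "t \<in> R" using epi_ker_subset[OF e] by auto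
      moreover have "\<phi> t = \<one>\<^bsub>Q\<^esub>" using epi_one_iff[OF e \<open>t \<in> R\<close>] t by simp
      ultimately show "t \<in> M" using subgroup.one_closed[OF sN] by (simp add: M_def)
    qed
    moreover have "normalises G R M"
      unfolding normalises_def M_def
      using N Q.normal_iff_normalises
      by (auto simp: epi_conj[OF e sR] epi_closed[OF e] normalises_def subgroup.m_closed[OF sR] subgroup.m_inv_closed[OF sR])
    ultimately have "M = S \<or> M = R" using max by (auto simp: M_def)
    moreover have "N = \<phi> ` M" using im subgroup.subset[OF sN] by (auto simp: M_def)
    moreover have "\<phi> ` S = {\<one>\<^bsub>Q\<^esub>}"
      using epi_one_iff[OF e] epi_ker_subset[OF e] subgroup.one_closed[OF S] epi_one[OF e sR] by (force simp: subset_iff)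
    ultimately show ?thesis using im by auto
  qed
  ultimately show ?thesis by (auto simp: simple_group_def simple_group_axioms_def Q.is_group)
qed

text \<open>For \<open>M\<close> inside a normal \<open>R\<close> this is the conjugate of
  \<open>M\<close> by \<open>inv g\<close>. As a preimage it is directly the kernel of an
  epimorphism precomposed with conjugation by \<open>g\<close>.\<close>

definition conj_set :: "'a set \<Rightarrow> 'a set \<Rightarrow> 'a \<Rightarrow> 'a set" where
  "conj_set R M g = {x \<in> R. g \<otimes> x \<otimes> inv g \<in> M}"

lemma normal_conj: "N \<lhd> G \<Longrightarrow> g \<in> carrier G \<Longrightarrow> x \<in> N \<Longrightarrow> g \<otimes> x \<otimes> inv g \<in> N"
  by (simp add: normal_iff_normalises normalises_def)

lemma normal_conj_image:
  assumes "N \<lhd> G" "g \<in> carrier G"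
  shows "(\<lambda>x. g \<otimes> x \<otimes> inv g) ` N = N"
proof (intro equalityI subsetI)
  fix x assume x: "x \<in> N"
  then have xc: "x \<in> carrier G" using subgroup.mem_carrier[OF normal_imp_subgroup[OF assms(1)]] by blast
  have "inv g \<otimes> x \<otimes> inv (inv g) \<in> N" using normal_conj[OF assms(1) inv_closed[OF assms(2)] x] .
  moreover have "g \<otimes> (inv g \<otimes> x \<otimes> inv (inv g)) \<otimes> inv g = x"
    using assms xc by (simp add: group_simps)
  ultimately show "x \<in> (\<lambda>x. g \<otimes> x \<otimes> inv g) ` N" by (metis image_eqI)
qed (use normal_conj assms in auto)

lemma epi_conj_set:
  assumes e: "epi_ker G R M Q \<theta>" and R: "R \<lhd> G" and g: "g \<in> carrier G"
  shows "epi_ker G R (conj_set R M g) Q (\<lambda>x. \<theta> (g \<otimes> x \<otimes> inv g))"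
proof -
  note sR = normal_imp_subgroup[OF R]
  have Rc: "x \<in> carrier G" if "x \<in> R" for x using subgroup.mem_carrier[OF sR that] .
  have "(\<lambda>x. \<theta> (g \<otimes> x \<otimes> inv g)) ` R = \<theta> ` (\<lambda>x. g \<otimes> x \<otimes> inv g) ` R" by (auto simp: image_image)
  then have 1: "(\<lambda>x. \<theta> (g \<otimes> x \<otimes> inv g)) ` R = carrier Q"
    using normal_conj_image[OF R g] epi_image[OF e] by simp
  have 2: "\<theta> (g \<otimes> (x \<otimes> y) \<otimes> inv g) = \<theta> (g \<otimes> x \<otimes> inv g) \<otimes>\<^bsub>Q\<^esub> \<theta> (g \<otimes> y \<otimes> inv g)"
    if "x \<in> R" "y \<in> R" for x y
  proof -
    have "g \<otimes> (x \<otimes> y) \<otimes> inv g = (g \<otimes> x \<otimes> inv g) \<otimes> (g \<otimes> y \<otimes> inv g)"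
      using g Rc that by (simp add: group_simps)
    then show ?thesis using epi_mult[OF e] normal_conj[OF R g] that by simp
  qed
  show ?thesis unfolding epi_ker_def
    using 1 2 epi_group[OF e] epi_one_iff[OF e] normal_conj[OF R g] by (auto simp: conj_set_def)
qed

text \<open>The intersection of all conjugates of \<open>M\<close> is normal in \<open>G\<close>,
  lies between \<open>S\<close> and \<open>R\<close> and is not \<open>R\<close>. So it equals
  \<open>S\<close>, which is too small to contain \<open>N\<close>.\<close>

lemma chief_not_subset_conj_set:
  assumes c: "chief G R S" and M: "S \<subseteq> M" "M \<subset> R" and sM: "subgroup M G" and N: "S \<subset> N" "N \<subseteq> R"
  shows "\<exists>g\<in>carrier G. \<not> N \<subseteq> conj_set R M g"
proof (rule ccontr)
  assume "\<not> ?thesis"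
  then have sub: "N \<subseteq> conj_set R M g" if "g \<in> carrier G" for g using that by blast
  define C where "C = {x \<in> R. \<forall>g\<in>carrier G. g \<otimes> x \<otimes> inv g \<in> M}"
  have R: "R \<lhd> G" and S: "S \<lhd> G" "S \<subset> R" using c by (auto simp: chief_def)
  note sR = normal_imp_subgroup[OF R]
  have Rc: "x \<in> carrier G" if "x \<in> R" for x using subgroup.mem_carrier[OF sR that] .
  have "subgroup C G"
  proof (rule subgroupI)
    show "C \<subseteq> carrier G" using Rc by (auto simp: C_def)
    show "C \<noteq> {}" using subgroup.one_closed[OF sR] subgroup.one_closed[OF sM] by (auto simp: C_def intro!: exI[of _ \<one>])
    fix x assume x: "x \<in> C"
    have "g \<otimes> inv x \<otimes> inv g \<in> M" if g: "g \<in> carrier G" for g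
    proof -
      have "inv (g \<otimes> x \<otimes> inv g) \<in> M" using x g by (auto simp: C_def intro: subgroup.m_inv_closed[OF sM])
      then show ?thesis using x g Rc by (simp add: C_def group_simps)
    qed
    then show "inv x \<in> C" using x by (auto simp: C_def subgroup.m_inv_closed[OF sR])
    fix y assume y: "y \<in> C"
    have "g \<otimes> (x \<otimes> y) \<otimes> inv g \<in> M" if g: "g \<in> carrier G" for g
    proof -
      have "(g \<otimes> x \<otimes> inv g) \<otimes> (g \<otimes> y \<otimes> inv g) \<in> M" using x y g by (auto simp: C_def intro: subgroup.m_closed[OF sM])
      then show ?thesis using x y g Rc by (simp add: C_def group_simps)
    qed
    then show "x \<otimes> y \<in> C" using x y by (auto simp: C_def subgroup.m_closed[OF sR])
  qed
  moreover have "normalises G (carrier G) C"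
    unfolding normalises_def
  proof (intro ballI)
    fix a x assume a: "a \<in> carrier G" and x: "x \<in> C"
    have xR: "x \<in> R" using x by (simp add: C_def)
    have "g \<otimes> (a \<otimes> x \<otimes> inv a) \<otimes> inv g \<in> M" if g: "g \<in> carrier G" for g
    proof -
      have "(g \<otimes> a) \<otimes> x \<otimes> inv (g \<otimes> a) \<in> M" using x g a by (simp add: C_def)
      then show ?thesis using xR g a Rc by (simp add: group_simps)
    qed
    then show "a \<otimes> x \<otimes> inv a \<in> C" using normal_conj[OF R a xR] by (simp add: C_def)
  qed
  ultimately have nC: "C \<lhd> G" by (simp add: normal_iff_normalises)
  have "S \<subseteq> C" using normal_conj[OF S(1)] M S by (auto simp: C_def)
  moreover have "C \<subseteq> R" by (auto simp: C_def)
  ultimately have "C = S \<or> C = R" using nC c by (auto simp: chief_def)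
  moreover have "C \<subseteq> M"
  proof
    fix x assume "x \<in> C"
    then have "\<one> \<otimes> x \<otimes> inv \<one> \<in> M" "x \<in> carrier G" using Rc by (simp_all only: C_def mem_Collect_eq one_closed)
    then show "x \<in> M" by simp
  qed
  moreover have "N \<subseteq> C" using sub N by (auto simp: C_def conj_set_def)
  ultimately show False using M N by blast
qed

text \<open>Take \<open>k\<close> maximal such that \<open>R\<close> maps onto \<open>Q^k\<close> by a tuple of conjugates of \<open>\<theta>\<close>: as long as the
  kernel is larger than \<open>S\<close>, it is not contained in some conjugate of \<open>M\<close>, which allows one more coordinate.\<close>
lemma chief_power:
  fixes Q :: "('q, 'r) monoid_scheme"
  assumes c: "chief G R S" and fin: "finite (rcosets S)"
    and e: "epi_ker G R M Q \<theta>" and Q: "simple_group Q" and SM: "S \<subseteq> M"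
  shows "\<exists>(k::nat) \<phi>. epi_ker G R S (product_group {..<k} (\<lambda>_. Q)) \<phi>"
proof -
  have R: "R \<lhd> G" and S: "S \<lhd> G" "S \<subset> R" using c by (auto simp: chief_def)
  note sR = normal_imp_subgroup[OF R] and sS = normal_imp_subgroup[OF S(1)]
  interpret Q: group Q by (rule epi_group[OF e])
  note sM = epi_ker_subgroup[OF e sR]
  have MR: "M \<subset> R" using epi_simple_proper[OF e sR Q] epi_ker_subset[OF e] by auto
  let ?P = "\<lambda>k. product_group {..<k::nat} (\<lambda>_. Q)"
  let ?S = "{N. S \<subseteq> N \<and> (\<exists>k \<phi>. epi_ker G R N (?P k) \<phi>)}"
  have sub: "subgroup N G" if "N \<in> ?S" for N using that epi_ker_subgroup[OF _ sR] by auto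
  have "finite ?S"
    by (rule finite_subset[OF _ finite_overgroups[OF sS fin]]) (use sub in auto)
  \<comment> \<open>The start \<open>k = 0\<close>: the empty product has one element, the function
    that is \<open>undefined\<close> everywhere.\<close>
  moreover have "epi_ker G R R (?P 0) (\<lambda>x. \<lambda>i\<in>{..<0}. undefined)"
    using subgroup.one_closed[OF sR] by (auto simp: epi_ker_def)
  then have "R \<in> ?S" using S by blast
  ultimately have "\<exists>N\<in>?S. N \<subseteq> R \<and> (\<forall>N'\<in>?S. N' \<subseteq> N \<longrightarrow> N = N')"
    by (rule finite_has_minimal2)
  then obtain N where N: "N \<in> ?S" and Nmin: "\<forall>N'\<in>?S. N' \<subseteq> N \<longrightarrow> N = N'" by (elim bexE conjE)
  then obtain k \<phi> where p: "epi_ker G R N (?P k) \<phi>" by blast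
  note sN = epi_ker_subgroup[OF p sR] and nN = epi_ker_normalised[OF p sR]
  have NR: "N \<subseteq> R" by (rule epi_ker_subset[OF p])
  have "N = S"
  proof (rule ccontr)
    assume "N \<noteq> S"
    then have "S \<subset> N" using N by auto
    then obtain g where g: "g \<in> carrier G" "\<not> N \<subseteq> conj_set R M g"
      using chief_not_subset_conj_set[OF c SM MR sM _ NR] by blast
    define \<theta>' where "\<theta>' = (\<lambda>x. \<theta> (g \<otimes> x \<otimes> inv g))"
    have e': "epi_ker G R (conj_set R M g) Q \<theta>'"
      unfolding \<theta>'_def by (rule epi_conj_set[OF e R g(1)])
    \<comment> \<open>As \<open>N\<close> escapes the kernel of \<open>\<theta>'\<close> and
      \<open>Q\<close> is simple, \<open>N\<close> alone covers the new coordinate. This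
      independence makes the enlarged tuple surjective.\<close>
    have im: "\<theta>' ` N = carrier Q" using epi_simple[OF e' sR Q sN NR nN] g(2) by simp
    define \<phi>' where "\<phi>' = (\<lambda>x. \<lambda>i\<in>{..<Suc k}. if i < k then \<phi> x i else \<theta>' x)"
    have \<phi>cl: "\<phi> x \<in> {..<k} \<rightarrow>\<^sub>E carrier Q" if "x \<in> R" for x using epi_closed[OF p that] by simp
    have "epi_ker G R (N \<inter> conj_set R M g) (?P (Suc k)) \<phi>'"
      unfolding epi_ker_def
    proof (intro conjI ballI)
      show "group (?P (Suc k))" by (simp add: Q.is_group)
      show "N \<inter> conj_set R M g \<subseteq> R" using NR by auto
      show "\<phi>' ` R = carrier (?P (Suc k))"
      proof (intro equalityI subsetI)
        fix v assume "v \<in> \<phi>' ` R"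
        then obtain x where x: "x \<in> R" "v = \<phi>' x" by auto
        have "\<phi> x i \<in> carrier Q" if "i < k" for i using \<phi>cl[OF x(1)] that by (auto simp: PiE_iff)
        then show "v \<in> carrier (?P (Suc k))"
          using x epi_closed[OF e'] by (auto simp: \<phi>'_def PiE_iff less_Suc_eq)
      next
        fix v assume v: "v \<in> carrier (?P (Suc k))"
        then have "restrict v {..<k} \<in> carrier (?P k)" by (auto simp: PiE_iff)
        then obtain x where x: "x \<in> R" "\<phi> x = restrict v {..<k}" using epi_image[OF p] by (metis imageE)
        have "v k \<in> carrier Q" using v by (auto simp: PiE_iff)
        \<comment> \<open>An element of \<open>N\<close> corrects the last coordinate and leaves the
          first \<open>k\<close> alone.\<close>
        then have "inv\<^bsub>Q\<^esub> (\<theta>' x) \<otimes>\<^bsub>Q\<^esub> v k \<in> carrier Q" using epi_closed[OF e' x(1)] by simp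
        then obtain n where n: "n \<in> N" "\<theta>' n = inv\<^bsub>Q\<^esub> (\<theta>' x) \<otimes>\<^bsub>Q\<^esub> v k" using im by (metis imageE)
        have nR: "n \<in> R" using n NR by auto
        have xn: "x \<otimes> n \<in> R" using x nR subgroup.m_closed[OF sR] by simp
        have a: "\<theta>' (x \<otimes> n) = v k"
          using epi_mult[OF e' x(1) nR] n \<open>v k \<in> carrier Q\<close> epi_closed[OF e' x(1)]
          by (simp add: Q.mult_inv_cancel)
        have "\<phi> (x \<otimes> n) = \<phi> x \<otimes>\<^bsub>?P k\<^esub> \<phi> n" using epi_mult[OF p x(1) nR] .
        also have "\<phi> n = \<one>\<^bsub>?P k\<^esub>" using epi_one_iff[OF p nR] n by simp
        also have "\<phi> x \<otimes>\<^bsub>?P k\<^esub> \<one>\<^bsub>?P k\<^esub> = \<phi> x"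
          by (intro monoid.r_one[OF group.is_monoid[OF epi_group[OF p]]] epi_closed[OF p] x)
        finally have b: "\<phi> (x \<otimes> n) = restrict v {..<k}" using x by simp
        have "\<phi>' (x \<otimes> n) = v"
        proof
          fix i show "\<phi>' (x \<otimes> n) i = v i"
            using a b v by (cases "i < k"; cases "i = k") (auto simp: \<phi>'_def PiE_iff extensional_def)
        qed
        then show "v \<in> \<phi>' ` R" using xn by auto
      qed
      fix x assume x: "x \<in> R"
      have "\<phi>' x = \<one>\<^bsub>?P (Suc k)\<^esub> \<longleftrightarrow> \<phi> x = \<one>\<^bsub>?P k\<^esub> \<and> \<theta>' x = \<one>\<^bsub>Q\<^esub>"
      proof
        assume *: "\<phi>' x = \<one>\<^bsub>?P (Suc k)\<^esub>"
        have "\<phi> x i = \<one>\<^bsub>Q\<^esub>" if "i < k" for i using fun_cong[OF *, of i] that by (simp add: \<phi>'_def)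
        moreover have "\<theta>' x = \<one>\<^bsub>Q\<^esub>" using fun_cong[OF *, of k] by (simp add: \<phi>'_def)
        ultimately show "\<phi> x = \<one>\<^bsub>?P k\<^esub> \<and> \<theta>' x = \<one>\<^bsub>Q\<^esub>"
          using \<phi>cl[OF x] by (auto intro!: extensionalityI[of _ "{..<k}"] simp: PiE_iff)
      next
        assume "\<phi> x = \<one>\<^bsub>?P k\<^esub> \<and> \<theta>' x = \<one>\<^bsub>Q\<^esub>"
        then show "\<phi>' x = \<one>\<^bsub>?P (Suc k)\<^esub>" by (auto simp: \<phi>'_def restrict_def)
      qed
      also have "\<dots> \<longleftrightarrow> x \<in> N \<inter> conj_set R M g"
        using epi_one_iff[OF p x] epi_one_iff[OF e' x] by auto
      finally show "(\<phi>' x = \<one>\<^bsub>?P (Suc k)\<^esub>) = (x \<in> N \<inter> conj_set R M g)" .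
      fix y assume y: "y \<in> R"
      show "\<phi>' (x \<otimes> y) = \<phi>' x \<otimes>\<^bsub>?P (Suc k)\<^esub> \<phi>' y"
        using epi_mult[OF p x y] epi_mult[OF e' x y] by (auto simp: \<phi>'_def fun_eq_iff)
    qed
    moreover have "S \<subseteq> conj_set R M g"
      using S SM normal_conj[OF S(1) g(1)] by (auto simp: conj_set_def)
    ultimately have "N \<inter> conj_set R M g \<in> ?S" using N by blast
    then show False using bspec[OF Nmin, of "N \<inter> conj_set R M g"] g(2) by auto
  qed
  then show ?thesis using p by blast
qed

lemma ex_maximal_normalised:
  assumes "subgroup S G" "finite (rcosets S)" "S \<subset> R" "normalises G A S"
  shows "\<exists>M. subgroup M G \<and> S \<subseteq> M \<and> M \<subset> R \<and> normalises G A M \<and>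
    (\<forall>M'. subgroup M' G \<longrightarrow> M \<subseteq> M' \<longrightarrow> M' \<subseteq> R \<longrightarrow> normalises G A M' \<longrightarrow> M' = M \<or> M' = R)"
proof -
  let ?S = "{M. subgroup M G \<and> S \<subseteq> M \<and> M \<subset> R \<and> normalises G A M}"
  have "finite ?S" by (rule finite_subset[OF _ finite_overgroups[OF assms(1,2)]]) auto
  moreover have "S \<in> ?S" using assms by auto
  ultimately have "\<exists>M\<in>?S. S \<subseteq> M \<and> (\<forall>M'\<in>?S. M \<subseteq> M' \<longrightarrow> M = M')" by (rule finite_has_maximal2)
  then obtain M where "M \<in> ?S" "\<forall>M'\<in>?S. M \<subseteq> M' \<longrightarrow> M = M'" by (elim bexE conjE)
  then show ?thesis by (intro exI[of _ M]) blast
qed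

text \<open>That \<open>H \<inter> N\<close> is not inside \<open>K\<close> means that
  \<open>N\<close> still contributes to the section \<open>H / K\<close>. A minimal such
  \<open>N\<close> locates the factor in which the section appears.\<close>

lemma ex_minimal_normalised:
  assumes "subgroup B G" "finite (rcosets B)" "subgroup E G" "B \<subseteq> E" "normalises G A E" "\<not> H \<inter> E \<subseteq> K"
  shows "\<exists>N. subgroup N G \<and> B \<subseteq> N \<and> N \<subseteq> E \<and> normalises G A N \<and> \<not> H \<inter> N \<subseteq> K \<and>
    (\<forall>N'. subgroup N' G \<longrightarrow> B \<subseteq> N' \<longrightarrow> N' \<subset> N \<longrightarrow> normalises G A N' \<longrightarrow> H \<inter> N' \<subseteq> K)"
proof -
  let ?S = "{N. subgroup N G \<and> B \<subseteq> N \<and> N \<subseteq> E \<and> normalises G A N \<and> \<not> H \<inter> N \<subseteq> K}"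
  have "finite ?S" by (rule finite_subset[OF _ finite_overgroups[OF assms(1,2)]]) auto
  moreover have "E \<in> ?S" using assms by auto
  ultimately have "\<exists>M\<in>?S. M \<subseteq> E \<and> (\<forall>M'\<in>?S. M' \<subseteq> M \<longrightarrow> M = M')" by (rule finite_has_minimal2)
  then obtain M where "M \<in> ?S" "\<forall>M'\<in>?S. M' \<subseteq> M \<longrightarrow> M = M'" by (elim bexE conjE)
  then show ?thesis by (intro exI[of _ M]) blast
qed

text \<open>The only part of the Jordan-Hoelder theorem that is needed.\<close>
lemma subnormal_section_chief:
  fixes Q :: "('q, 'r) monoid_scheme"
  assumes B: "B \<lhd> G" "finite (rcosets B)" and E: "E \<lhd> G" "B \<subseteq> E"
    and H: "subn G E H" and e: "epi_ker G H K Q \<psi>" and Q: "simple_group Q" and HB: "H \<inter> B \<subseteq> K"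
  shows "\<exists>R S (k::nat) \<phi>. chief G R S \<and> B \<subseteq> S \<and> R \<subseteq> E \<and>
    epi_ker G R S (product_group {..<k} (\<lambda>_. Q)) \<phi>"
proof -
  note sB = normal_imp_subgroup[OF B(1)] and sE = normal_imp_subgroup[OF E(1)]
  have nor: "N \<lhd> G \<longleftrightarrow> subgroup N G \<and> normalises G (carrier G) N" for N by (rule normal_iff_normalises)
  have sH: "subgroup H G" and HE: "H \<subseteq> E" using subn_subgroup subn_subset H by blast+
  have "\<not> H \<subseteq> K" using epi_simple_proper[OF e sH Q] epi_ker_subset[OF e] by blast
  then have "\<not> H \<inter> E \<subseteq> K" using HE by auto
  \<comment> \<open>\<open>R\<close> is the place where the section first shows up: no smaller
    normal subgroup above \<open>B\<close> contributes to \<open>H / K\<close>.\<close>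
  then obtain R where R: "subgroup R G" "B \<subseteq> R" "R \<subseteq> E" "normalises G (carrier G) R" "\<not> H \<inter> R \<subseteq> K"
    and Rmin: "\<And>N. subgroup N G \<Longrightarrow> B \<subseteq> N \<Longrightarrow> N \<subset> R \<Longrightarrow> normalises G (carrier G) N \<Longrightarrow> H \<inter> N \<subseteq> K"
    using ex_minimal_normalised[OF sB B(2) sE E(2) _ \<open>\<not> H \<inter> E \<subseteq> K\<close>, of "carrier G"] E(1)
    unfolding nor by metis
  have "B \<subset> R" using R HB by auto
  then obtain S where S: "subgroup S G" "B \<subseteq> S" "S \<subset> R" "normalises G (carrier G) S"
    and Smax: "\<And>M. subgroup M G \<Longrightarrow> S \<subseteq> M \<Longrightarrow> M \<subseteq> R \<Longrightarrow> normalises G (carrier G) M \<Longrightarrow> M = S \<or> M = R"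
    using ex_maximal_normalised[OF sB B(2), of R "carrier G"] B(1) unfolding nor by metis
  have nR: "R \<lhd> G" using R nor by blast
  have c: "chief G R S" using R S Smax by (auto simp: chief_def nor)
  have finS: "finite (rcosets S)" by (rule finite_rcosets_mono[OF sB B(2) S(1,2)])
  have HS: "H \<inter> S \<subseteq> K" using Rmin S by blast
  note sRg = subgroup.subset[OF R(1)]
  have nRS: "normalises G R S" using normalises_mono[OF S(4) sRg] .
  \<comment> \<open>The same search one level down, among subgroups normalised by \<open>R\<close>,
    because the chief factor \<open>R / S\<close> need not be simple.\<close>
  obtain N where N: "subgroup N G" "S \<subseteq> N" "N \<subseteq> R" "normalises G R N" "\<not> H \<inter> N \<subseteq> K"
    and Nmin: "\<And>N'. subgroup N' G \<Longrightarrow> S \<subseteq> N' \<Longrightarrow> N' \<subset> N \<Longrightarrow> normalises G R N' \<Longrightarrow> H \<inter> N' \<subseteq> K"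
    using ex_minimal_normalised[OF S(1) finS R(1) less_imp_le[OF S(3)] subgroup_normalises_self[OF R(1)] R(5)]
    by metis
  obtain M0 where M0: "subgroup M0 G" "S \<subseteq> M0" "M0 \<subset> R" "normalises G R M0"
    and M0max: "\<And>M. subgroup M G \<Longrightarrow> M0 \<subseteq> M \<Longrightarrow> M \<subseteq> R \<Longrightarrow> normalises G R M \<Longrightarrow> M = M0 \<or> M = R"
    using ex_maximal_normalised[OF S(1) finS S(3) nRS] by metis
  define L where "L = (G\<lparr>carrier := R\<rparr>) Mod M0"
  have e0: "epi_ker G R M0 L (\<lambda>x. M0 #> x)" unfolding L_def
    by (rule epi_canonical) (use R M0 in auto)
  have finM0: "finite (rcosets M0)" by (rule finite_rcosets_mono[OF S(1) finS M0(1,2)])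
  have L: "simple_group L"
    by (rule simple_quotient_if_maximal[OF e0 R(1) _ finM0 M0max]) (use M0 in auto)
  have "S \<subset> N" using N HS by auto
  then obtain g where g: "g \<in> carrier G" "\<not> N \<subseteq> conj_set R M0 g"
    using chief_not_subset_conj_set[OF c M0(2,3,1) _ N(3)] by blast
  define M where "M = conj_set R M0 g"
  obtain \<theta> where t: "epi_ker G R M L \<theta>" using epi_conj_set[OF e0 nR g(1)] unfolding M_def by blast
  have SM: "S \<subseteq> M" using S M0 normal_conj[of S g] g nor by (auto simp: M_def conj_set_def)
  note sM = epi_ker_subgroup[OF t R(1)]
  have imN: "\<theta> ` N = carrier L" using epi_simple[OF t R(1) L N(1,3,4)] g by (auto simp: M_def)
  \<comment> \<open>\<open>N\<close> is not inside \<open>M\<close>, so \<open>N \<inter> M\<close>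
    is strictly below the minimal \<open>N\<close>.\<close>
  have HNM: "H \<inter> (N \<inter> M) \<subseteq> K"
    by (rule Nmin)
      (use N SM g subgroups_Inter_pair[OF N(1) sM] normalises_Int[OF N(4) epi_ker_normalised[OF t R(1)]]
        in \<open>auto simp: M_def\<close>)
  define H' where "H' = H \<inter> R"
  have sH': "subgroup H' G" unfolding H'_def by (intro subgroups_Inter_pair sH R)
  have "normalises G H H'"
    unfolding H'_def
    by (intro normalises_Int subgroup_normalises_self sH normalises_mono[OF R(4) subgroup.subset[OF sH]])
  then have "\<psi> ` H' = carrier Q"
    using epi_simple[OF e sH Q sH'] R(5) by (auto simp: H'_def)
  then have e': "epi_ker G H' (H' \<inter> K) Q \<psi>"
    by (intro epi_restrict[OF e]) (auto simp: H'_def)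
  define H1 where "H1 = H' \<inter> N"
  have sH1: "subgroup H1 G" unfolding H1_def by (intro subgroups_Inter_pair sH' N)
  have "normalises G H' N"
    by (rule normalises_mono[OF N(4)]) (auto simp: H'_def)
  then have "normalises G H' H1"
    unfolding H1_def by (intro normalises_Int subgroup_normalises_self sH')
  moreover have "\<not> H1 \<subseteq> H' \<inter> K" using N(3,5) by (auto simp: H1_def H'_def)
  ultimately have "\<psi> ` H1 = carrier Q"
    using epi_simple[OF e' sH' Q sH1] by (auto simp: H1_def)
  then have e1: "epi_ker G H1 (H1 \<inter> K) Q \<psi>"
    by (intro epi_restrict[OF e]) (auto simp: H1_def H'_def)
  \<comment> \<open>Subnormality enters here: the image of \<open>H1\<close> in the simple group
    \<open>L\<close> is subnormal and nontrivial, hence all of \<open>L\<close>. Then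
    \<open>Q\<close> and \<open>L\<close> are both quotients of \<open>H1\<close>, and it remains to
    see that the kernels agree.\<close>
  have "subn G N H1"
  proof -
    have "E \<inter> N = N" "H \<inter> N = H1" using N(3) R(3) by (auto simp: H1_def H'_def)
    then show ?thesis using subn_Int[OF H N(1)] by simp
  qed
  then have "subn L (\<theta> ` N) (\<theta> ` H1)" by (rule epi_image_subn[OF t R(1) _ N(3)])
  then have "subn L (carrier L) (\<theta> ` H1)" by (simp only: imN)
  then have "\<theta> ` H1 = {\<one>\<^bsub>L\<^esub>} \<or> \<theta> ` H1 = carrier L"
    by (rule group.subn_simple[OF epi_group[OF t] L])
  moreover have "\<theta> ` H1 \<noteq> {\<one>\<^bsub>L\<^esub>}"
  proof
    assume *: "\<theta> ` H1 = {\<one>\<^bsub>L\<^esub>}"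
    have "H1 \<subseteq> M" 
    proof
      fix x assume "x \<in> H1"
      then have "\<theta> x = \<one>\<^bsub>L\<^esub>" "x \<in> R" using * by (auto simp: H1_def H'_def)
      then show "x \<in> M" using epi_one_iff[OF t] by simp
    qed
    then show False using N(3,5) HNM by (auto simp: H1_def H'_def)
  qed
  ultimately have "\<theta> ` H1 = carrier L" by blast
  then have t1: "epi_ker G H1 (H1 \<inter> M) L \<theta>"
    by (intro epi_restrict[OF t]) (auto simp: H1_def H'_def)
  have H1M: "H1 \<inter> M \<subseteq> K" using HNM by (auto simp: H1_def H'_def)
  have sH1K: "subgroup (H1 \<inter> K) G" by (rule epi_ker_subgroup[OF e1 sH1])
  have "H1 \<inter> K \<subseteq> H1 \<inter> M"
  proof (rule ccontr)
    assume "\<not> ?thesis"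
    then have im: "\<theta> ` (H1 \<inter> K) = carrier L"
      using epi_simple[OF t1 sH1 L sH1K _ epi_ker_normalised[OF e1 sH1]] by auto
    have "H1 \<subseteq> K"
    proof
      fix h assume h: "h \<in> H1"
      then have "\<theta> h \<in> \<theta> ` (H1 \<inter> K)" using im epi_closed[OF t1] by simp
      then obtain l where l: "l \<in> H1" "l \<in> K" "\<theta> h = \<theta> l" by auto
      then have "h \<otimes> inv l \<in> H1 \<inter> K" using epi_eq_iff[OF t1 sH1 h] H1M by auto
      then have "(h \<otimes> inv l) \<otimes> l \<in> H1 \<inter> K" using l subgroup.m_closed[OF sH1K] by blast
      then show "h \<in> K" using h l subgroup.mem_carrier[OF sH1] by (simp add: m_assoc)
    qed
    then show False using N(3,5) by (auto simp: H1_def H'_def)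
  qed
  then have "H1 \<inter> K = H1 \<inter> M" using H1M by auto
  then have "epi_ker G H1 (H1 \<inter> M) Q \<psi>" using e1 by simp
  from epi_unique_iso[OF t1 sH1 this] obtain h where "h \<in> iso L Q" by auto
  then have "epi_ker G R M Q (h \<circ> \<theta>)" by (rule epi_iso[OF t _ epi_group[OF e]])
  then obtain k \<phi> where "epi_ker G R S (product_group {..<k::nat} (\<lambda>_. Q)) \<phi>"
    using chief_power[OF c finS _ Q SM] by blast
  then show ?thesis using c S R by blast
qed

end

section \<open>Schur multipliers and extension of characters\<close>

text \<open>For \<open>b = 1\<close> the value \<open>a = 0\<close> would be coprime to
  \<open>b\<close>, but the equation would have no solution in natural numbers.\<close>

lemma coprime_bezout_nat:
  fixes a b :: nat
  assumes "coprime a b" "b \<noteq> 1"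
  shows "\<exists>x y. a * x = b * y + 1"
proof (cases "a = 0")
  case False
  then show ?thesis using bezout_nat[OF False, of b] assms by (metis coprime_imp_gcd_eq_1)
qed (use assms in auto)

text \<open>\<open>c\<close> is an inverse of \<open>n\<close> modulo \<open>e\<close>, so it undoes
  the \<open>n\<close>-th power map on the \<open>e\<close>-th roots of unity.\<close>

lemma coprime_root_power:
  assumes "coprime n (e::nat)"
  shows "\<exists>c. \<forall>z::complex. z ^ e = 1 \<longrightarrow> z ^ (n * c) = z"
proof (cases "e = 1")
  case True
  then show ?thesis by (intro exI[of _ 0]) auto
next
  case False
  then obtain c d where "n * c = e * d + 1" using coprime_bezout_nat assms by blast
  then show ?thesis by (intro exI[of _ c]) (auto simp: power_add power_mult)
qed

text \<open>\<open>n\<close> annihilates the second cohomology of \<open>Q\<close> with values in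
  the nonzero complex numbers. An annihilator is all that extending characters requires, so the
  order of the group and the order of the multiplier can be used alike.\<close>

definition kills_schur :: "nat \<Rightarrow> ('a, 'b) monoid_scheme \<Rightarrow> bool" where
  "kills_schur n Q \<longleftrightarrow> (\<forall>f\<in>schur_cocycles Q. \<exists>h::'a \<Rightarrow> complex. (\<forall>x\<in>carrier Q. h x \<noteq> 0) \<and>
     (\<forall>x\<in>carrier Q. \<forall>y\<in>carrier Q. f (x, y) ^ n = h x * h y / h (x \<otimes>\<^bsub>Q\<^esub> y)))"

context group
begin

text \<open>Multiplying the cocycle identity over all third arguments \<open>z\<close> exhibits the
  power of \<open>f\<close> as the coboundary of the product of the \<open>f (x, z)\<close>.\<close>

lemma kills_schur_order: "finite (carrier G) \<Longrightarrow> kills_schur (card (carrier G)) G"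
  unfolding kills_schur_def
proof
  fix f :: "'a \<times> 'a \<Rightarrow> complex" assume fin: "finite (carrier G)" and f: "f \<in> schur_cocycles G"
  define h where "h x = (\<Prod>z\<in>carrier G. f (x, z))" for x
  have nz: "f (x, y) \<noteq> 0" if "x \<in> carrier G" "y \<in> carrier G" for x y
    using f that by (auto simp: schur_cocycles_def)
  have h: "h x \<noteq> 0" if "x \<in> carrier G" for x
    using nz that fin by (auto simp: h_def)
  have "f (x, y) ^ card (carrier G) = h x * h y / h (x \<otimes> y)" if xy: "x \<in> carrier G" "y \<in> carrier G" for x y
  proof -
    have "bij_betw (\<lambda>z. y \<otimes> z) (carrier G) (carrier G)"
      by (rule bij_betw_byWitness[where f' = "\<lambda>z. inv y \<otimes> z"])
        (use xy in \<open>auto simp: mult_inv_cancel inv_mult_cancel\<close>)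
    then have 1: "(\<Prod>z\<in>carrier G. f (x, y \<otimes> z)) = h x"
      unfolding h_def by (rule prod.reindex_bij_betw)
    have "f (x, y) ^ card (carrier G) * h (x \<otimes> y) = (\<Prod>z\<in>carrier G. f (x, y) * f (x \<otimes> y, z))"
      by (simp add: h_def prod.distrib)
    also have "\<dots> = (\<Prod>z\<in>carrier G. f (x, y \<otimes> z) * f (y, z))"
      by (rule prod.cong) (use f xy in \<open>auto simp: schur_cocycles_def\<close>)
    also have "\<dots> = h x * h y" using 1 by (simp add: prod.distrib h_def)
    finally show ?thesis using h[of "x \<otimes> y"] xy by (simp add: field_simps)
  qed
  then show "\<exists>h::'a \<Rightarrow> complex. (\<forall>x\<in>carrier G. h x \<noteq> 0) \<and>
     (\<forall>x\<in>carrier G. \<forall>y\<in>carrier G. f (x, y) ^ card (carrier G) = h x * h y / h (x \<otimes> y))"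
    using h by blast
qed

text \<open>If the multiplier were infinite, its order would be the junk value 0 and the claim would be trivial.\<close>
lemma kills_schur_multiplier_order: "kills_schur (schur_multiplier_order G) G"
proof -
  \<comment> \<open>\<open>Z\<close> is the group of cocycles and \<open>B\<close> the subgroup of
    coboundaries. The classes counted by the multiplier turn out to be the cosets of
    \<open>B\<close>, so raising to the power of the order kills them.\<close>
  define Z :: "('a \<times> 'a \<Rightarrow> complex) monoid" where "Z = \<lparr>carrier = schur_cocycles G, monoid.mult = (\<lambda>f g x. f x * g x), one = (\<lambda>_. 1)\<rparr>"
  define B where "B = {f. (f, \<lambda>_. 1) \<in> schur_cohomologous G}"
  have inv: "(\<lambda>x. inverse (f x)) \<in> schur_cocycles G" if f: "f \<in> schur_cocycles G" for f
  proof -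
    have "inverse (f (x, y)) * inverse (f (x \<otimes> y, z)) = inverse (f (x, y \<otimes> z)) * inverse (f (y, z))"
      if "x \<in> carrier G" "y \<in> carrier G" "z \<in> carrier G" for x y z
      using f that by (simp add: schur_cocycles_def flip: inverse_mult_distrib)
    then show ?thesis using f by (auto simp: schur_cocycles_def)
  qed
  have mul: "(\<lambda>x. f x * g x) \<in> schur_cocycles G" if f: "f \<in> schur_cocycles G" and g: "g \<in> schur_cocycles G" for f g
  proof -
    have "(f (x, y) * g (x, y)) * (f (x \<otimes> y, z) * g (x \<otimes> y, z)) =
        (f (x, y \<otimes> z) * g (x, y \<otimes> z)) * (f (y, z) * g (y, z))"
      if xyz: "x \<in> carrier G" "y \<in> carrier G" "z \<in> carrier G" for x y z
    proof -
      have "f (x, y) * f (x \<otimes> y, z) = f (x, y \<otimes> z) * f (y, z)" 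
        "g (x, y) * g (x \<otimes> y, z) = g (x, y \<otimes> z) * g (y, z)"
        using f g xyz by (auto simp: schur_cocycles_def)
      moreover have "(a * b) * (c * d) = (a * c) * (b * d)" for a b c d :: complex by (simp add: ac_simps)
      ultimately show ?thesis by metis
    qed
    then show ?thesis using f g by (auto simp: schur_cocycles_def)
  qed
  have one: "(\<lambda>_. 1) \<in> schur_cocycles G" by (auto simp: schur_cocycles_def)
  have nz: "f p \<noteq> 0" if "f \<in> schur_cocycles G" for f p
    using that by (cases p) (fastforce simp: schur_cocycles_def)
  interpret Z: comm_group Z
  proof (rule comm_groupI)
    fix f assume f: "f \<in> carrier Z"
    show "\<exists>g\<in>carrier Z. g \<otimes>\<^bsub>Z\<^esub> f = \<one>\<^bsub>Z\<^esub>"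
      using inv[of f] f nz[of f] by (intro bexI[of _ "\<lambda>x. inverse (f x)"]) (auto simp: Z_def)
  qed (auto simp: Z_def mul one mult.assoc mult.commute)
  have coh: "(f, g) \<in> schur_cohomologous G \<longleftrightarrow> f \<in> schur_cocycles G \<and> g \<in> schur_cocycles G \<and>
      (\<lambda>x. g x * inverse (f x)) \<in> B" for f g
  proof -
    have "(\<exists>h :: 'a \<Rightarrow> complex. (\<forall>x\<in>carrier G. h x \<noteq> 0) \<and>
        (\<forall>x\<in>carrier G. \<forall>y\<in>carrier G. f (x, y) = g (x, y) * h x * h y / h (x \<otimes> y))) \<longleftrightarrow>
      (\<exists>h :: 'a \<Rightarrow> complex. (\<forall>x\<in>carrier G. h x \<noteq> 0) \<and>
        (\<forall>x\<in>carrier G. \<forall>y\<in>carrier G. g (x, y) * inverse (f (x, y)) = 1 * h x * h y / h (x \<otimes> y)))"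
      (is "Ex ?A \<longleftrightarrow> Ex ?B") if fg: "f \<in> schur_cocycles G" "g \<in> schur_cocycles G"
    proof
      assume "Ex ?A" then obtain h where h: "?A h" by blast
      \<comment> \<open>The coset condition involves \<open>g / f\<close> in place of
        \<open>f / g\<close>, whence the inverse of \<open>h\<close>.\<close>
      have "?B (\<lambda>x. inverse (h x))"
        using h nz[OF fg(1)] nz[OF fg(2)] by (simp add: field_simps)
      then show "Ex ?B" by (rule exI[of ?B "\<lambda>x. inverse (h x)"])
    next
      assume "Ex ?B" then obtain h where h: "?B h" by blast
      have "?A (\<lambda>x. inverse (h x))"
      proof (intro conjI ballI)
        fix x y assume xy: "x \<in> carrier G" "y \<in> carrier G"
        then have "g (x, y) * inverse (f (x, y)) = h x * h y / h (x \<otimes> y)" "h x \<noteq> 0" "h y \<noteq> 0" "h (x \<otimes> y) \<noteq> 0"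
          using h by auto
        then show "f (x, y) = g (x, y) * inverse (h x) * inverse (h y) / inverse (h (x \<otimes> y))"
          using nz[OF fg(1)] by (simp add: field_simps)
      qed (use h in auto)
      then show "Ex ?A" by (rule exI[of ?A "\<lambda>x. inverse (h x)"])
    qed
    then show ?thesis
      using mul[OF _ inv, of g f] one unfolding B_def schur_cohomologous_def by auto
  qed
  have Bsub: "B \<subseteq> schur_cocycles G" by (auto simp: B_def schur_cohomologous_def)
  have B: "f \<in> B \<longleftrightarrow> f \<in> schur_cocycles G \<and> (\<exists>h :: 'a \<Rightarrow> complex. (\<forall>x\<in>carrier G. h x \<noteq> 0) \<and>
        (\<forall>x\<in>carrier G. \<forall>y\<in>carrier G. f (x, y) = h x * h y / h (x \<otimes> y)))" for f
    using one by (auto simp: B_def schur_cohomologous_def)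
  have invZ: "inv\<^bsub>Z\<^esub> f = (\<lambda>x. inverse (f x))" if "f \<in> schur_cocycles G" for f
    by (rule Z.inv_equality) (use that inv nz[OF that] in \<open>auto simp: Z_def\<close>)
  have "subgroup B Z"
  proof (rule Z.subgroupI)
    show "B \<subseteq> carrier Z" using Bsub by (simp add: Z_def)
    have "(\<lambda>_. 1) \<in> B" unfolding B using one by (intro conjI exI[of _ "\<lambda>_. 1"]) auto
    then show "B \<noteq> {}" by blast
    fix f assume f: "f \<in> B"
    then obtain h where h: "f \<in> schur_cocycles G" "\<And>x. x \<in> carrier G \<Longrightarrow> h x \<noteq> 0"
      "\<And>x y. x \<in> carrier G \<Longrightarrow> y \<in> carrier G \<Longrightarrow> f (x, y) = h x * h y / h (x \<otimes> y)" unfolding B by blast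
    have "(\<lambda>x. inverse (f x)) \<in> B"
      unfolding B using h inv[OF h(1)] by (intro conjI exI[of _ "\<lambda>x. inverse (h x)"]) (auto simp: divide_inverse)
    then show "inv\<^bsub>Z\<^esub> f \<in> B" using invZ h by simp
    fix f' assume "f' \<in> B"
    then obtain h' where h': "f' \<in> schur_cocycles G" "\<And>x. x \<in> carrier G \<Longrightarrow> h' x \<noteq> 0"
      "\<And>x y. x \<in> carrier G \<Longrightarrow> y \<in> carrier G \<Longrightarrow> f' (x, y) = h' x * h' y / h' (x \<otimes> y)" unfolding B by blast
    have "(\<lambda>x. f x * f' x) \<in> B"
      unfolding B using h h' mul[OF h(1) h'(1)]
      by (intro conjI exI[of _ "\<lambda>x. h x * h' x"]) (auto simp: divide_inverse ac_simps)
    then show "f \<otimes>\<^bsub>Z\<^esub> f' \<in> B" by (simp add: Z_def)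
  qed
  then interpret B: normal B Z by (rule Z.subgroup_imp_normal)
  have "schur_cocycles G // schur_cohomologous G = rcosets\<^bsub>Z\<^esub> B"
  proof -
    have "schur_cohomologous G `` {f} = B #>\<^bsub>Z\<^esub> f" if f: "f \<in> schur_cocycles G" for f
    proof (intro equalityI subsetI)
      fix g assume "g \<in> schur_cohomologous G `` {f}"
      then have "(\<lambda>x. g x * inverse (f x)) \<in> B" using coh by auto
      moreover have "g = (\<lambda>x. g x * inverse (f x)) \<otimes>\<^bsub>Z\<^esub> f" using nz[OF f] by (simp add: Z_def fun_eq_iff)
      ultimately show "g \<in> B #>\<^bsub>Z\<^esub> f" by (auto simp: r_coset_def)
    next
      fix g assume "g \<in> B #>\<^bsub>Z\<^esub> f"
      then obtain b where b: "b \<in> B" "g = (\<lambda>x. b x * f x)" by (auto simp: r_coset_def Z_def)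
      then have "(\<lambda>x. g x * inverse (f x)) = b" using nz[OF f] by (auto simp: field_simps)
      then show "g \<in> schur_cohomologous G `` {f}" using b f mul[of b f] Bsub coh by auto
    qed
    then show ?thesis by (auto simp: quotient_def RCOSETS_def Z_def)
  qed
  then have ord: "schur_multiplier_order G = order (Z Mod B)"
    by (simp add: schur_multiplier_order_def order_def FactGroup_def)
  interpret F: group "Z Mod B" by (rule B.factorgroup_is_group)
  have "\<exists>h::'a \<Rightarrow> complex. (\<forall>x\<in>carrier G. h x \<noteq> 0) \<and>
     (\<forall>x\<in>carrier G. \<forall>y\<in>carrier G. f (x, y) ^ order (Z Mod B) = h x * h y / h (x \<otimes> y))"
    if f: "f \<in> schur_cocycles G" for f
  proof -
    have fZ: "f \<in> carrier Z" using f by (simp add: Z_def)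
    then have "B #>\<^bsub>Z\<^esub> f \<in> carrier (Z Mod B)" by (auto simp: carrier_FactGroup)
    then have "(B #>\<^bsub>Z\<^esub> f) [^]\<^bsub>Z Mod B\<^esub> order (Z Mod B) = B" using F.pow_order_eq_1 by simp
    then have "B #>\<^bsub>Z\<^esub> (f [^]\<^bsub>Z\<^esub> order (Z Mod B)) = B" using B.FactGroup_pow[OF fZ] by simp
    then have "f [^]\<^bsub>Z\<^esub> order (Z Mod B) \<in> B"
      using Z.rcos_self[OF Z.nat_pow_closed[OF fZ] B.is_subgroup] by metis
    moreover have "f [^]\<^bsub>Z\<^esub> n = (\<lambda>x. f x ^ n)" for n :: nat
      by (induction n) (auto simp: Z_def nat_pow_def)
    ultimately have "(\<lambda>x. f x ^ order (Z Mod B)) \<in> B" by simp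
    then show ?thesis unfolding B by blast
  qed
  then show ?thesis unfolding kills_schur_def ord by blast
qed

end

text \<open>The powers of \<open>y\<close> form a nontrivial normal subgroup, so they exhaust the
  group.\<close>

lemma (in group) simple_comm_iso_mod_group:
  assumes s: "simple_group G" and comm: "\<And>x y. x \<in> carrier G \<Longrightarrow> y \<in> carrier G \<Longrightarrow> x \<otimes> y = y \<otimes> x"
    and p: "Factorial_Ring.prime p" and y: "y \<in> carrier G" "y \<noteq> \<one>" "y [^] p = \<one>"
  shows "G \<cong> integer_mod_group p"
proof -
  have "ord y dvd p" using pow_eq_id[OF y(1)] y(3) by simp
  moreover have "ord y \<noteq> 1" using ord_eq_1[OF y(1)] y(2) by simp
  ultimately have oy: "ord y = p" using p by (auto simp: prime_nat_iff)
  have p0: "p > 0" using p prime_gt_0_nat by blast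
  define h where "h i = y [^] (nat i)" for i :: int
  have md: "y [^] (n mod p) = y [^] n" for n :: nat
  proof -
    have "y [^] n = y [^] (p * (n div p) + n mod p)" by simp
    also have "\<dots> = (y [^] p) [^] (n div p) \<otimes> y [^] (n mod p)"
      using y(1) by (simp only: nat_pow_mult nat_pow_pow nat_pow_closed)
    finally show ?thesis using y by simp
  qed
  have "subgroup (range (\<lambda>n::nat. y [^] n)) G"
  proof (rule subgroupI)
    fix a assume "a \<in> range (\<lambda>n::nat. y [^] n)"
    then obtain n :: nat where n: "a = y [^] n" by auto
    \<comment> \<open>Natural exponents suffice for inverses because \<open>y\<close> has finite
      order.\<close>
    have "y [^] ((p - 1) * n) \<otimes> a = (y [^] p) [^] n"
    proof -
      have "(p - 1) * n + n = p * n" using p0 by (cases p) auto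
      then show ?thesis using y(1) n by (simp only: nat_pow_mult nat_pow_pow nat_pow_closed)
    qed
    then have "inv a = y [^] ((p - 1) * n)" using y n by (intro inv_equality) auto
    then show "inv a \<in> range (\<lambda>n::nat. y [^] n)" by auto
    fix b assume "b \<in> range (\<lambda>n::nat. y [^] n)"
    then show "a \<otimes> b \<in> range (\<lambda>n::nat. y [^] n)" using n y by (auto simp: nat_pow_mult)
  qed (use y in auto)
  moreover from this have "normalises G (carrier G) (range (\<lambda>n::nat. y [^] n))"
    unfolding normalises_def
  proof (intro ballI)
    fix a b assume a: "a \<in> carrier G" and b: "b \<in> range (\<lambda>n::nat. y [^] n)"
    then have bc: "b \<in> carrier G" using y by auto
    have "a \<otimes> b \<otimes> inv a = b" using comm[OF a bc] a bc by (simp add: m_assoc)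
    then show "a \<otimes> b \<otimes> inv a \<in> range (\<lambda>n::nat. y [^] n)" using b by simp
  qed
  ultimately have "range (\<lambda>n::nat. y [^] n) = carrier G \<or> range (\<lambda>n::nat. y [^] n) = {\<one>}"
    using simple_group.no_real_normal_subgroup[OF s] normal_iff_normalises by blast
  moreover have "y \<in> range (\<lambda>n::nat. y [^] n)" using y by (intro range_eqI[of _ _ 1]) simp
  ultimately have im: "range (\<lambda>n::nat. y [^] n) = carrier G" using y by auto
  have "h \<in> iso (integer_mod_group p) G"
    unfolding iso_def
  proof (intro CollectI conjI homI)
    fix i assume "i \<in> carrier (integer_mod_group p)"
    then show "h i \<in> carrier G" using y by (simp add: h_def)
  next
    fix i j assume "i \<in> carrier (integer_mod_group p)" "j \<in> carrier (integer_mod_group p)"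
    then have "0 \<le> i" "0 \<le> j" using p0 by (auto simp: carrier_integer_mod_group)
    then have "nat ((i + j) mod int p) = (nat i + nat j) mod p"
      by (simp add: nat_mod_distrib nat_add_distrib)
    then show "h (i \<otimes>\<^bsub>integer_mod_group p\<^esub> j) = h i \<otimes> h j"
      using y by (simp add: h_def md nat_pow_mult)
  next
    have "inj_on (\<lambda>n::nat. y [^] n) {0..ord y - 1}" using ord_inj[OF y(1)] .
    then have "i = j" if "i \<in> {0..<int p}" "j \<in> {0..<int p}" "h i = h j" for i j
      using that inj_onD[of "\<lambda>n::nat. y [^] n" "{0..p - 1}" "nat i" "nat j"] oy
      by (auto simp: h_def eq_nat_nat_iff)
    then have "inj_on h {0..<int p}" by (intro inj_onI)
    moreover have "h ` {0..<int p} = carrier G"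
    proof (intro equalityI subsetI)
      fix g assume "g \<in> carrier G"
      then obtain n :: nat where "g = y [^] n" using im by auto
      then have "g = h (int (n mod p))" by (simp add: h_def md)
      then show "g \<in> h ` {0..<int p}" using p0 by auto
    qed (use y in \<open>auto simp: h_def\<close>)
    ultimately show "bij_betw h (carrier (integer_mod_group p)) (carrier G)"
      using p0 by (simp add: bij_betw_def carrier_integer_mod_group)
  qed
  then show ?thesis using group.iso_sym[OF group_integer_mod_group] by (auto simp: is_iso_def)
qed

text \<open>Write \<open>ord x = p * d\<close> for a nontrivial \<open>x\<close>; then
  \<open>x [^] d\<close> is an element of order \<open>p\<close>.\<close>

lemma (in group) simple_comm_ex_prime:
  assumes s: "simple_group G" and comm: "\<And>x y. x \<in> carrier G \<Longrightarrow> y \<in> carrier G \<Longrightarrow> x \<otimes> y = y \<otimes> x"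
    and fin: "finite (carrier G)"
  shows "\<exists>p. Factorial_Ring.prime p \<and> G \<cong> integer_mod_group p"
proof -
  obtain x where x: "x \<in> carrier G" "x \<noteq> \<one>" using simple_group.simple_not_triv[OF s] one_closed by blast
  have "ord x \<noteq> 1" using ord_eq_1[OF x(1)] x by simp
  then obtain p where p: "Factorial_Ring.prime p" "p dvd ord x" using prime_factor_nat by blast
  then obtain d where d: "ord x = p * d" by auto
  have "ord x > 0" using ord_ge_1[OF fin x(1)] by simp
  then have "d > 0" using d by (cases d) auto
  have "x [^] d \<noteq> \<one>"
  proof
    assume "x [^] d = \<one>"
    then have "p * d dvd d" using pow_eq_id[OF x(1)] d by simp
    then show False using \<open>d > 0\<close> p(1) by (auto dest!: dvd_imp_le simp: prime_nat_iff)
  qed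
  moreover have "(x [^] d) [^] p = \<one>" using x d pow_ord_eq_1[OF x(1)] by (simp add: nat_pow_pow mult.commute)
  ultimately show ?thesis using simple_comm_iso_mod_group[OF s comm p(1), of "x [^] d"] x p by auto
qed

text \<open>A linear character, given by a function of which only the values on \<open>Y\<close>
  matter. Continuity is not part of it; the kernel needed later is open because it contains an open
  subgroup.\<close>

definition char_on :: "('a, 'b) monoid_scheme \<Rightarrow> 'a set \<Rightarrow> ('a \<Rightarrow> complex) \<Rightarrow> bool" where
  "char_on G Y \<xi> \<longleftrightarrow> (\<forall>x\<in>Y. \<xi> x \<noteq> 0) \<and> (\<forall>x\<in>Y. \<forall>y\<in>Y. \<xi> (x \<otimes>\<^bsub>G\<^esub> y) = \<xi> x * \<xi> y)"

lemma char_on_mult: "char_on G Y \<xi> \<Longrightarrow> x \<in> Y \<Longrightarrow> y \<in> Y \<Longrightarrow> \<xi> (x \<otimes>\<^bsub>G\<^esub> y) = \<xi> x * \<xi> y"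
  and char_on_nonzero: "char_on G Y \<xi> \<Longrightarrow> x \<in> Y \<Longrightarrow> \<xi> x \<noteq> 0"
  by (auto simp: char_on_def)

lemma char_on_subset: "char_on G Y \<xi> \<Longrightarrow> Z \<subseteq> Y \<Longrightarrow> char_on G Z \<xi>"
  by (auto simp: char_on_def subset_iff)

lemma char_on_power: "char_on G Y \<xi> \<Longrightarrow> char_on G Y (\<lambda>x. \<xi> x ^ n)"
  by (auto simp: char_on_def power_mult_distrib)

lemma char_on_divide: "char_on G Y \<xi> \<Longrightarrow> char_on G Y \<psi> \<Longrightarrow> char_on G Y (\<lambda>x. \<xi> x / \<psi> x)"
  by (auto simp: char_on_def)

section \<open>Extending characters across a simple section\<close>

context group
begin

lemma char_on_one:
  assumes "char_on G Y \<xi>" "subgroup Y G"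
  shows "\<xi> \<one> = 1"
proof -
  have "\<xi> (\<one> \<otimes> \<one>) = \<xi> \<one> * \<xi> \<one>" "\<xi> \<one> \<noteq> 0"
    using char_on_mult[OF assms(1)] char_on_nonzero[OF assms(1)] subgroup.one_closed[OF assms(2)] by blast+
  then show ?thesis by (metis l_one one_closed mult_cancel_left1)
qed

lemma char_on_inv:
  assumes "char_on G Y \<xi>" "subgroup Y G" "x \<in> Y"
  shows "\<xi> (inv x) = inverse (\<xi> x)"
proof -
  have "\<xi> x * \<xi> (inv x) = 1"
    using char_on_mult[OF assms(1,3) subgroup.m_inv_closed[OF assms(2,3)]] char_on_one[OF assms(1,2)]
      subgroup.mem_carrier[OF assms(2,3)] by simp
  then show ?thesis by (metis inverse_unique)
qed

lemma char_on_nat_pow: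
  assumes "char_on G Y \<xi>" "subgroup Y G" "x \<in> Y"
  shows "\<xi> (x [^] (n::nat)) = \<xi> x ^ n" "x [^] n \<in> Y"
proof -
  show *: "x [^] n \<in> Y" for n :: nat
    by (induction n) (auto simp: assms subgroup.one_closed[OF assms(2)] subgroup.m_closed[OF assms(2)])
  show "\<xi> (x [^] (n::nat)) = \<xi> x ^ n"
    by (induction n) (auto simp: char_on_one[OF assms(1,2)] char_on_mult[OF assms(1) * assms(3)])
qed

text \<open>A set-theoretic section of \<open>\<psi>\<close> turns \<open>\<xi>\<close> into a 2-cocycle of \<open>Q\<close> with values in the \<open>e\<close>-th roots
  of unity; its \<open>n\<close>-th power is a coboundary and \<open>n\<close> is invertible modulo \<open>e\<close>, so the cocycle is a coboundary,
  which is the obstruction to extending \<open>\<xi>\<close>.\<close>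
lemma char_extend:
  assumes sY': "subgroup Y' G" and ep: "epi_ker G Y' Y Q \<psi>" and kill: "kills_schur n Q" and cop: "coprime n e"
    and c: "char_on G Y \<xi>" and ex: "\<And>y. y \<in> Y \<Longrightarrow> \<xi> y ^ e = 1"
    and invar: "\<And>x y. x \<in> Y' \<Longrightarrow> y \<in> Y \<Longrightarrow> \<xi> (x \<otimes> y \<otimes> inv x) = \<xi> y"
  shows "\<exists>\<xi>'. char_on G Y' \<xi>' \<and> (\<forall>y\<in>Y. \<xi>' y = \<xi> y)"
proof -
  interpret Q: group Q by (rule epi_group[OF ep])
  note sY = epi_ker_subgroup[OF ep sY'] and YY' = epi_ker_subset[OF ep]
  note norm = normalisesD[OF epi_ker_normalised[OF ep sY']]
  note cl = subgroup.m_closed[OF sY'] subgroup.m_inv_closed[OF sY'] subgroup.mem_carrier[OF sY']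
  define s where "s q = (SOME x. x \<in> Y' \<and> \<psi> x = q)" for q
  have s: "s q \<in> Y'" "\<psi> (s q) = q" if "q \<in> carrier Q" for q
  proof -
    have "\<exists>x. x \<in> Y' \<and> \<psi> x = q" using that unfolding epi_image[OF ep, symmetric] by auto
    then have "s q \<in> Y' \<and> \<psi> (s q) = q" unfolding s_def by (rule someI_ex)
    then show "s q \<in> Y'" "\<psi> (s q) = q" by auto
  qed
  have inY: "x \<otimes> inv y \<in> Y" if "x \<in> Y'" "y \<in> Y'" "\<psi> x = \<psi> y" for x y
    using epi_eq_iff[OF ep sY' that(1,2)] that(3) by simp
  \<comment> \<open>The factor set of the extension of \<open>Q\<close> by \<open>Y\<close> that
    belongs to the section \<open>s\<close>.\<close>
  define d where "d p q = s p \<otimes> s q \<otimes> inv (s (p \<otimes>\<^bsub>Q\<^esub> q))" for p q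
  have d: "d p q \<in> Y" if "p \<in> carrier Q" "q \<in> carrier Q" for p q
    unfolding d_def by (rule inY) (use that s cl epi_mult[OF ep] in auto)
  have ds: "s p \<otimes> s q = d p q \<otimes> s (p \<otimes>\<^bsub>Q\<^esub> q)" if "p \<in> carrier Q" "q \<in> carrier Q" for p q
    unfolding d_def using that s cl by (simp add: m_assoc)
  \<comment> \<open>The value 1 off the carrier is the normalisation demanded by
    \<open>schur_cocycles\<close>.\<close>
  define f where "f = (\<lambda>(p, q). if p \<in> carrier Q \<and> q \<in> carrier Q then \<xi> (d p q) else 1)"
  have f: "f (p, q) = \<xi> (d p q)" if "p \<in> carrier Q" "q \<in> carrier Q" for p q
    using that by (simp add: f_def)
  have coc: "\<xi> (d p q) * \<xi> (d (p \<otimes>\<^bsub>Q\<^esub> q) r) = \<xi> (d p (q \<otimes>\<^bsub>Q\<^esub> r)) * \<xi> (d q r)"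
    if p: "p \<in> carrier Q" and q: "q \<in> carrier Q" and r: "r \<in> carrier Q" for p q r
  proof -
    have pq: "p \<otimes>\<^bsub>Q\<^esub> q \<in> carrier Q" and qr: "q \<otimes>\<^bsub>Q\<^esub> r \<in> carrier Q" using p q r by auto
    let ?w = "s (p \<otimes>\<^bsub>Q\<^esub> q \<otimes>\<^bsub>Q\<^esub> r)"
    have w: "?w \<in> Y'" using p q r s by auto
    have dc: "d a b \<in> carrier G" if "a \<in> carrier Q" "b \<in> carrier Q" for a b
      using d[OF that] YY' cl by auto
    have sc: "s a \<in> carrier G" if "a \<in> carrier Q" for a using s that cl by auto
    \<comment> \<open>Associativity: the product of three representatives is reduced in both
      bracketings. The conjugation by \<open>s p\<close> that remains does not change the value of
      \<open>\<xi>\<close>.\<close>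
    have e1: "s p \<otimes> s q \<otimes> s r = d p q \<otimes> d (p \<otimes>\<^bsub>Q\<^esub> q) r \<otimes> ?w"
      using ds[OF p q] ds[OF pq r] p q r pq dc sc cl w by (simp add: m_assoc)
    have "s p \<otimes> s q \<otimes> s r = s p \<otimes> (d q r \<otimes> s (q \<otimes>\<^bsub>Q\<^esub> r))"
      using ds[OF q r] p q r sc by (simp add: m_assoc)
    also have "\<dots> = (s p \<otimes> d q r \<otimes> inv (s p)) \<otimes> (s p \<otimes> s (q \<otimes>\<^bsub>Q\<^esub> r))"
      using p q r qr sc dc by (simp add: group_simps)
    also have "\<dots> = (s p \<otimes> d q r \<otimes> inv (s p)) \<otimes> d p (q \<otimes>\<^bsub>Q\<^esub> r) \<otimes> ?w"
      using ds[OF p qr] p q r qr sc dc by (simp add: m_assoc Q.m_assoc)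
    finally have "d p q \<otimes> d (p \<otimes>\<^bsub>Q\<^esub> q) r = (s p \<otimes> d q r \<otimes> inv (s p)) \<otimes> d p (q \<otimes>\<^bsub>Q\<^esub> r)"
      using e1 p q r pq qr dc sc cl w by simp
    then have "\<xi> (d p q \<otimes> d (p \<otimes>\<^bsub>Q\<^esub> q) r) = \<xi> ((s p \<otimes> d q r \<otimes> inv (s p)) \<otimes> d p (q \<otimes>\<^bsub>Q\<^esub> r))" by simp
    then show ?thesis
      using char_on_mult[OF c] d p q r pq qr norm s invar by (simp add: mult.commute)
  qed
  have "f \<in> schur_cocycles Q"
    unfolding schur_cocycles_def using coc char_on_nonzero[OF c] d f
    by (auto simp: f_def)
  then obtain h where h: "\<And>x. x \<in> carrier Q \<Longrightarrow> h x \<noteq> 0"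
    "\<And>x y. x \<in> carrier Q \<Longrightarrow> y \<in> carrier Q \<Longrightarrow> f (x, y) ^ n = h x * h y / h (x \<otimes>\<^bsub>Q\<^esub> y)"
    using kill unfolding kills_schur_def by blast
  obtain a where a: "\<forall>z::complex. z ^ e = 1 \<longrightarrow> z ^ (n * a) = z" using coprime_root_power[OF cop] by blast
  \<comment> \<open>Raising to the power \<open>n * a\<close> fixes the values of
    \<open>\<xi>\<close>. As \<open>h\<close> trivialises \<open>f ^ n\<close>, its
    \<open>a\<close>-th power trivialises \<open>f\<close> itself.\<close>
  define k where "k x = h x ^ a" for x
  have k: "k x \<noteq> 0" if "x \<in> carrier Q" for x using h that by (simp add: k_def)
  have fk: "\<xi> (d x y) * k (x \<otimes>\<^bsub>Q\<^esub> y) = k x * k y" if xy: "x \<in> carrier Q" "y \<in> carrier Q" for x y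
  proof -
    have "\<xi> (d x y) = \<xi> (d x y) ^ (n * a)" using a ex d xy by simp
    also have "\<dots> = (h x * h y / h (x \<otimes>\<^bsub>Q\<^esub> y)) ^ a"
      using h(2)[OF xy] f[OF xy] by (simp add: power_mult)
    finally show ?thesis using k[of "x \<otimes>\<^bsub>Q\<^esub> y"] xy by (simp add: k_def power_mult_distrib power_divide)
  qed
  define g where "g y = y \<otimes> inv (s (\<psi> y))" for y
  have g: "g y \<in> Y" "y = g y \<otimes> s (\<psi> y)" if "y \<in> Y'" for y
    using that s epi_closed[OF ep that] cl inY unfolding g_def by (auto simp: m_assoc)
  define \<xi>' where "\<xi>' y = \<xi> (g y) * k (\<psi> y)" for y
  have "char_on G Y' \<xi>'"
    unfolding char_on_def
  proof (intro conjI ballI)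
    fix x assume x: "x \<in> Y'"
    then show "\<xi>' x \<noteq> 0"
      using char_on_nonzero[OF c g(1)[OF x]] k epi_closed[OF ep x] by (simp add: \<xi>'_def)
    fix y assume y: "y \<in> Y'"
    let ?p = "\<psi> x" and ?q = "\<psi> y"
    have pq: "?p \<in> carrier Q" "?q \<in> carrier Q" "?p \<otimes>\<^bsub>Q\<^esub> ?q \<in> carrier Q" using x y epi_closed[OF ep] by auto
    have xy: "\<psi> (x \<otimes> y) = ?p \<otimes>\<^bsub>Q\<^esub> ?q" using epi_mult[OF ep x y] .
    have Yc: "z \<in> carrier G" if "z \<in> Y" for z using that YY' cl by auto
    have m: "g x \<in> carrier G" "g y \<in> carrier G" "s ?p \<in> carrier G" "s ?q \<in> carrier G" "s (?p \<otimes>\<^bsub>Q\<^esub> ?q) \<in> carrier G"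
      "d ?p ?q \<in> carrier G"
      using g x y s pq d Yc cl by auto
    have "x \<otimes> y = (g x \<otimes> s ?p) \<otimes> (g y \<otimes> s ?q)" using g x y by simp
    also have "\<dots> = g x \<otimes> (s ?p \<otimes> g y \<otimes> inv (s ?p)) \<otimes> (s ?p \<otimes> s ?q)" using m by (simp add: group_simps)
    also have "\<dots> = g x \<otimes> (s ?p \<otimes> g y \<otimes> inv (s ?p)) \<otimes> d ?p ?q \<otimes> s (?p \<otimes>\<^bsub>Q\<^esub> ?q)"
      using ds[OF pq(1,2)] m by (simp add: m_assoc)
    finally have "g (x \<otimes> y) = g x \<otimes> (s ?p \<otimes> g y \<otimes> inv (s ?p)) \<otimes> d ?p ?q"
      using m xy by (simp add: g_def m_assoc)
    moreover have "s ?p \<otimes> g y \<otimes> inv (s ?p) \<in> Y" using norm s pq g y by auto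
    ultimately have "\<xi> (g (x \<otimes> y)) = \<xi> (g x) * \<xi> (g y) * \<xi> (d ?p ?q)"
      using char_on_mult[OF c] g x y d pq invar s subgroup.m_closed[OF sY] by simp
    then show "\<xi>' (x \<otimes> y) = \<xi>' x * \<xi>' y"
      using fk[OF pq(1,2)] xy by (simp add: \<xi>'_def)
  qed
  moreover have "\<xi>' y = \<xi> y" if y: "y \<in> Y" for y
  proof -
    have yY': "y \<in> Y'" using y YY' by auto
    have py: "\<psi> y = \<one>\<^bsub>Q\<^esub>" using epi_one_iff[OF ep yY'] y by simp
    \<comment> \<open>The section need not send the identity to the identity. Its value there lies
      in \<open>Y\<close>, and the cocycle equation at the pair of identities shows that
      \<open>k\<close> cancels it.\<close>
    have s1: "s \<one>\<^bsub>Q\<^esub> \<in> Y'" "s \<one>\<^bsub>Q\<^esub> \<in> carrier G" using s[OF Q.one_closed] cl by auto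
    have d1: "d \<one>\<^bsub>Q\<^esub> \<one>\<^bsub>Q\<^esub> = s \<one>\<^bsub>Q\<^esub>" using s1 by (simp add: d_def m_assoc)
    then have s1Y: "s \<one>\<^bsub>Q\<^esub> \<in> Y" using d[of "\<one>\<^bsub>Q\<^esub>" "\<one>\<^bsub>Q\<^esub>"] by simp
    have "\<xi> (s \<one>\<^bsub>Q\<^esub>) = k \<one>\<^bsub>Q\<^esub>" using fk[of "\<one>\<^bsub>Q\<^esub>" "\<one>\<^bsub>Q\<^esub>"] d1 k[of "\<one>\<^bsub>Q\<^esub>"] by simp
    then show ?thesis
      using char_on_mult[OF c y subgroup.m_inv_closed[OF sY s1Y]] char_on_inv[OF c sY s1Y] char_on_nonzero[OF c s1Y]
      by (simp add: \<xi>'_def py g_def)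
  qed
  ultimately show ?thesis by blast
qed

text \<open>The values of any extension are roots of unity of order dividing
  \<open>order Q * p ^ m\<close>. Write \<open>order Q = p ^ a * b\<close> with \<open>b\<close>
  prime to \<open>p\<close>, and let \<open>b * t\<close> be 1 modulo \<open>p ^ m\<close>: the
  power with exponent \<open>b * t\<close> removes the part of the order prime to \<open>p\<close>
  and leaves the values on \<open>Y\<close> unchanged.\<close>

lemma char_extend_p_power:
  assumes sY': "subgroup Y' G" and ep: "epi_ker G Y' Y Q \<psi>" and fin: "finite (carrier Q)"
    and kill: "kills_schur n Q" and cop: "coprime n p" and p: "Factorial_Ring.prime (p::nat)"
    and c: "char_on G Y \<xi>" and ex: "\<And>y. y \<in> Y \<Longrightarrow> \<xi> y ^ (p ^ m) = 1"
    and invar: "\<And>x y. x \<in> Y' \<Longrightarrow> y \<in> Y \<Longrightarrow> \<xi> (x \<otimes> y \<otimes> inv x) = \<xi> y"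
  shows "\<exists>\<xi>' m'. char_on G Y' \<xi>' \<and> (\<forall>y\<in>Y. \<xi>' y = \<xi> y) \<and> (\<forall>y\<in>Y'. \<xi>' y ^ (p ^ m') = 1)"
proof -
  interpret Q: group Q by (rule epi_group[OF ep])
  obtain \<xi>0 where c0: "char_on G Y' \<xi>0" "\<And>y. y \<in> Y \<Longrightarrow> \<xi>0 y = \<xi> y"
    using char_extend[OF sY' ep kill _ c ex invar] cop by auto
  have "order Q \<noteq> 0" using fin Q.order_gt_0_iff_finite by simp
  then obtain a b where ab: "order Q = p ^ a * b" "\<not> p dvd b"
    using multiplicity_decompose'[of "order Q" p] p by (metis not_prime_unit)
  have "coprime p b" by (rule prime_imp_coprime[OF p ab(2)])
  then have "coprime b (p ^ m)" by (simp add: coprime_commute)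
  then obtain t where t: "\<forall>z::complex. z ^ (p ^ m) = 1 \<longrightarrow> z ^ (b * t) = z" using coprime_root_power by blast
  have "(\<xi>0 y ^ (b * t)) ^ (p ^ (a + m)) = 1" if y: "y \<in> Y'" for y
  proof -
    have hom: "\<psi> (y [^] (j::nat)) = \<psi> y [^]\<^bsub>Q\<^esub> j \<and> y [^] j \<in> Y'" for j
      by (induction j) (auto simp: epi_one[OF ep sY'] epi_mult[OF ep] y subgroup.one_closed[OF sY'] subgroup.m_closed[OF sY'])
    then have "\<psi> (y [^] order Q) = \<one>\<^bsub>Q\<^esub>" using Q.pow_order_eq_1 epi_closed[OF ep y] by simp
    then have yN: "y [^] order Q \<in> Y" using epi_one_iff[OF ep] hom by blast
    have "\<xi>0 y ^ order Q = \<xi> (y [^] order Q)" using char_on_nat_pow(1)[OF c0(1) sY' y] c0(2)[OF yN] by simp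
    then have "(\<xi>0 y ^ order Q) ^ (p ^ m) = 1" using ex[OF yN] by simp
    moreover have "(\<xi>0 y ^ (b * t)) ^ (p ^ (a + m)) = ((\<xi>0 y ^ order Q) ^ (p ^ m)) ^ t"
      unfolding ab by (simp add: power_add ac_simps flip: power_mult)
    ultimately show ?thesis by simp
  qed
  moreover have "\<xi>0 y ^ (b * t) = \<xi> y" if "y \<in> Y" for y using t ex c0(2) that by simp
  moreover have "char_on G Y' (\<lambda>y. \<xi>0 y ^ (b * t))" by (rule char_on_power[OF c0(1)])
  ultimately show ?thesis by blast
qed

text \<open>The quotient of the two characters is trivial on \<open>Y\<close>. If its kernel is not
  all of \<open>Y'\<close>, simplicity makes the kernel equal to \<open>Y\<close>; then
  \<open>Q\<close> embeds into the nonzero complex numbers with elements of \<open>p\<close>-power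
  order, so it is cyclic of order \<open>p\<close>.\<close>

lemma char_unique_step:
  assumes sY': "subgroup Y' G" and ep: "epi_ker G Y' Y Q \<psi>" and Q: "simple_group Q"
    and nQ: "\<not> Q \<cong> integer_mod_group p" and p: "Factorial_Ring.prime (p::nat)"
    and l: "char_on G Y' \<eta>" "\<And>y. y \<in> Y' \<Longrightarrow> \<eta> y ^ (p ^ m) = 1"
    and k: "char_on G Y' \<kappa>" "\<And>y. y \<in> Y' \<Longrightarrow> \<kappa> y ^ (p ^ m') = 1"
    and eq: "\<And>y. y \<in> Y \<Longrightarrow> \<eta> y = \<kappa> y" and y: "y \<in> Y'"
  shows "\<eta> y = \<kappa> y"
proof -
  interpret Q: group Q by (rule epi_group[OF ep])
  note cl = subgroup.m_closed[OF sY'] subgroup.m_inv_closed[OF sY'] subgroup.mem_carrier[OF sY'] subgroup.one_closed[OF sY']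
  define \<rho> where "\<rho> x = \<eta> x / \<kappa> x" for x
  have r: "char_on G Y' \<rho>" unfolding \<rho>_def by (rule char_on_divide[OF l(1) k(1)])
  note rm = char_on_mult[OF r] and ri = char_on_inv[OF r sY'] and r1 = char_on_one[OF r sY']
  have rp: "\<rho> x ^ (p ^ (m + m')) = 1" if "x \<in> Y'" for x
  proof -
    have "\<eta> x ^ (p ^ (m + m')) = 1" "\<kappa> x ^ (p ^ (m + m')) = 1"
      using l(2)[OF that] k(2)[OF that]
      by (simp add: power_add power_mult, subst add.commute, simp add: power_add power_mult)
    then show ?thesis by (simp add: \<rho>_def power_divide)
  qed
  define M where "M = {x \<in> Y'. \<rho> x = 1}"
  have sM: "subgroup M G"
  proof (rule subgroupI)
    show "M \<noteq> {}" using cl r1 by (auto simp: M_def)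
  qed (auto simp: M_def cl rm ri)
  have nM: "normalises G Y' M"
    unfolding normalises_def using char_on_nonzero[OF r] by (auto simp: M_def cl rm ri)
  have YM: "Y \<subseteq> M" using eq epi_ker_subset[OF ep] char_on_nonzero[OF k(1)] by (auto simp: M_def \<rho>_def subset_iff)
  have "M \<subseteq> Y \<or> \<psi> ` M = carrier Q" by (rule epi_simple[OF ep sY' Q sM _ nM]) (auto simp: M_def)
  then show ?thesis
  proof
    assume MY: "M \<subseteq> Y"
    have comm: "u \<otimes>\<^bsub>Q\<^esub> v = v \<otimes>\<^bsub>Q\<^esub> u" if uv: "u \<in> carrier Q" "v \<in> carrier Q" for u v
    proof -
      obtain x z where x: "x \<in> Y'" "u = \<psi> x" and z: "z \<in> Y'" "v = \<psi> z" using uv epi_image[OF ep] by blast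
      have "(x \<otimes> z) \<otimes> inv (z \<otimes> x) \<in> M"
        using x z char_on_nonzero[OF r x(1)] char_on_nonzero[OF r z(1)]
        by (simp add: M_def cl rm ri, simp add: field_simps)
      then have "\<psi> (x \<otimes> z) = \<psi> (z \<otimes> x)" using MY epi_eq_iff[OF ep sY'] x z cl by blast
      then show ?thesis using x z epi_mult[OF ep] by simp
    qed
    obtain u where u: "u \<in> carrier Q" "u \<noteq> \<one>\<^bsub>Q\<^esub>" using simple_group.simple_not_triv[OF Q] Q.one_closed by blast
    then obtain x where x: "x \<in> Y'" "u = \<psi> x" using epi_image[OF ep] by blast
    have hom: "\<psi> (x [^] (j::nat)) = u [^]\<^bsub>Q\<^esub> j \<and> x [^] j \<in> Y'" for j
      by (induction j) (auto simp: epi_one[OF ep sY'] epi_mult[OF ep] x cl)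
    have "\<rho> (x [^] (p ^ (m + m'))) = 1" using char_on_nat_pow(1)[OF r sY' x(1)] rp x by simp
    then have "x [^] (p ^ (m + m')) \<in> Y" using hom MY by (auto simp: M_def)
    then have "u [^]\<^bsub>Q\<^esub> (p ^ (m + m')) = \<one>\<^bsub>Q\<^esub>" using epi_one_iff[OF ep] hom by metis
    then have "\<exists>j. u [^]\<^bsub>Q\<^esub> (p ^ j) = \<one>\<^bsub>Q\<^esub>" by blast
    \<comment> \<open>The last nontrivial iterated \<open>p\<close>-th power of \<open>u\<close> is
      an element of order \<open>p\<close>.\<close>
    define j where "j = (LEAST j. u [^]\<^bsub>Q\<^esub> (p ^ j) = \<one>\<^bsub>Q\<^esub>)"
    have j: "u [^]\<^bsub>Q\<^esub> (p ^ j) = \<one>\<^bsub>Q\<^esub>" unfolding j_def by (rule LeastI_ex) fact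
    have "j \<noteq> 0" using j u by (cases j) auto
    then obtain i where i: "j = Suc i" by (cases j) auto
    have "u [^]\<^bsub>Q\<^esub> (p ^ i) \<noteq> \<one>\<^bsub>Q\<^esub>" using not_less_Least[of i "\<lambda>j. u [^]\<^bsub>Q\<^esub> (p ^ j) = \<one>\<^bsub>Q\<^esub>"] i by (simp add: j_def)
    moreover have "(u [^]\<^bsub>Q\<^esub> (p ^ i)) [^]\<^bsub>Q\<^esub> p = \<one>\<^bsub>Q\<^esub>" using j i u by (simp add: Q.nat_pow_pow mult.commute)
    ultimately have "Q \<cong> integer_mod_group p"
      using Q.simple_comm_iso_mod_group[OF Q comm p, of "u [^]\<^bsub>Q\<^esub> (p ^ i)"] u by simp
    then show ?thesis using nQ by blast
  next
    assume "\<psi> ` M = carrier Q"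
    then obtain z where z: "z \<in> M" "\<psi> y = \<psi> z" using epi_closed[OF ep y] by (metis imageE)
    then have zY: "z \<in> Y'" by (simp add: M_def)
    then have "y \<otimes> inv z \<in> M" using epi_eq_iff[OF ep sY' y] z YM by auto
    then have "\<rho> y = 1" using z zY y rm[of y "inv z"] ri[of z] cl by (simp add: M_def)
    then show ?thesis using char_on_nonzero[OF k(1) y] by (simp add: \<rho>_def)
  qed
qed

end

section \<open>Chief factors in a given class\<close>

context group
begin

lemma epi_pullback:
  assumes R: "subgroup R G" and g: "epi_ker G R N F g" and V: "subgroup V F" and e: "epi_ker F V W Q \<phi>"
  shows "subgroup {x \<in> R. g x \<in> V} G" "epi_ker G {x \<in> R. g x \<in> V} {x \<in> R. g x \<in> W} Q (\<phi> \<circ> g)"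
proof -
  interpret F: group F by (rule epi_group[OF g])
  note cl = subgroup.m_closed[OF R] subgroup.m_inv_closed[OF R] subgroup.mem_carrier[OF R] subgroup.one_closed[OF R]
  show "subgroup {x \<in> R. g x \<in> V} G"
  proof (rule subgroupI)
    show "{x \<in> R. g x \<in> V} \<noteq> {}" using cl subgroup.one_closed[OF V] epi_one[OF g R] by auto
  qed (auto simp: cl epi_mult[OF g] epi_inv[OF g R] subgroup.m_closed[OF V] subgroup.m_inv_closed[OF V])
  have "g ` {x \<in> R. g x \<in> V} = V" using subgroup.subset[OF V] unfolding epi_image[OF g, symmetric] by blast
  then have "(\<phi> \<circ> g) ` {x \<in> R. g x \<in> V} = carrier Q" using F.epi_image[OF e] by (metis image_comp)
  then show "epi_ker G {x \<in> R. g x \<in> V} {x \<in> R. g x \<in> W} Q (\<phi> \<circ> g)"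
    unfolding epi_ker_def
  proof (intro conjI ballI)
    fix x y assume x: "x \<in> {x \<in> R. g x \<in> V}"
    then show "((\<phi> \<circ> g) x = \<one>\<^bsub>Q\<^esub>) = (x \<in> {x \<in> R. g x \<in> W})" using F.epi_one_iff[OF e] by simp
    assume "y \<in> {x \<in> R. g x \<in> V}"
    then show "(\<phi> \<circ> g) (x \<otimes> y) = (\<phi> \<circ> g) x \<otimes>\<^bsub>Q\<^esub> (\<phi> \<circ> g) y"
      using x by (simp add: epi_mult[OF g] F.epi_mult[OF e])
  qed (use F.epi_group[OF e] F.epi_ker_subset[OF e] in auto)
qed

text \<open>A pigeonhole argument. Pull the series back to subgroups \<open>U i\<close> of
  \<open>G\<close>. If no counted factor survived in \<open>D\<close>, the products
  \<open>U i <#> D\<close> for the counted \<open>i\<close> would be pairwise different overgroups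
  of \<open>D\<close>, of which there are too few. So some counted factor is realised by
  \<open>U (Suc i) \<inter> D\<close>.\<close>

lemma composition_factor_below:
  fixes Q
  assumes D: "D \<lhd> G" and fin: "finite {H. subgroup H G \<and> D \<subseteq> H}"
    and N: "N \<lhd> G" and cs: "composition_series (G Mod N) Hs"
    and I: "card {H. subgroup H G \<and> D \<subseteq> H} < card {i. Suc i < length Hs \<and> P (comp_factor (G Mod N) Hs i)}"
  shows "\<exists>i H K \<psi>. Suc i < length Hs \<and> P (comp_factor (G Mod N) Hs i) \<and> subn G D H \<and>
    epi_ker G H K (comp_factor (G Mod N) Hs i) \<psi> \<and> N \<inter> H \<subseteq> K \<and> simple_group (comp_factor (G Mod N) Hs i)"
proof -
  let ?F = "G Mod N" and ?g = "\<lambda>x. N #> x"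
  have sN: "subgroup N G" and nN: "normalises G (carrier G) N" using N normal_iff_normalises by auto
  have sD: "subgroup D G" and nD: "normalises G (carrier G) D" using D normal_iff_normalises by auto
  have g: "epi_ker G (carrier G) N ?F ?g"
    using epi_canonical[OF subgroup_self sN subgroup.subset[OF sN] nN] by simp
  interpret F: group ?F by (rule epi_group[OF g])
  define U where "U i = {x \<in> carrier G. ?g x \<in> Hs ! i}" for i
  have len: "Hs \<noteq> []" "Hs ! 0 = {\<one>\<^bsub>?F\<^esub>}" "Hs ! (length Hs - 1) = carrier ?F"
    using cs by (auto simp: composition_series_def hd_conv_nth last_conv_nth)
  have sH: "subgroup (Hs ! i) ?F" if "i < length Hs" for i using cs that by (auto simp: composition_series_def)
  have nH: "Hs ! i \<lhd> ?F\<lparr>carrier := Hs ! Suc i\<rparr>" and simp: "simple_group (comp_factor ?F Hs i)"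
    if "Suc i < length Hs" for i using cs that by (auto simp: composition_series_def comp_factor_def)
  have e: "subgroup (U (Suc i)) G" "epi_ker G (U (Suc i)) (U i) (comp_factor ?F Hs i) ((\<lambda>y. (Hs ! i) #>\<^bsub>?F\<^esub> y) \<circ> ?g)"
    if i: "Suc i < length Hs" for i
  proof -
    let ?H = "?F\<lparr>carrier := Hs ! Suc i\<rparr>"
    interpret H: group ?H by (rule F.subgroup_imp_group[OF sH[OF i]])
    have s: "subgroup (Hs ! i) ?F" using sH i by simp
    have "Hs ! i \<subseteq> Hs ! Suc i" using subgroup.subset[OF normal_imp_subgroup[OF nH[OF i]]] by simp
    moreover have "normalises ?F (Hs ! Suc i) (Hs ! i)"
      using nH[OF i] F.m_inv_consistent[OF sH[OF i]] unfolding H.normal_iff_normalises normalises_def by simp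
    ultimately have "epi_ker ?F (Hs ! Suc i) (Hs ! i) (comp_factor ?F Hs i) (\<lambda>y. (Hs ! i) #>\<^bsub>?F\<^esub> y)"
      unfolding comp_factor_def by (intro F.epi_canonical sH i s)
    from epi_pullback[OF subgroup_self g sH[OF i] this]
    show "subgroup (U (Suc i)) G" "epi_ker G (U (Suc i)) (U i) (comp_factor ?F Hs i) ((\<lambda>y. (Hs ! i) #>\<^bsub>?F\<^esub> y) \<circ> ?g)"
      unfolding U_def by auto
  qed
  have NU: "N \<subseteq> U i" if "i < length Hs" for i
  proof
    fix x assume x: "x \<in> N"
    then have xc: "x \<in> carrier G" using subgroup.mem_carrier[OF sN] by blast
    then have "?g x = \<one>\<^bsub>?F\<^esub>" using epi_one_iff[OF g] x by blast
    then show "x \<in> U i" using subgroup.one_closed[OF sH[OF that]] xc by (simp add: U_def)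
  qed
  have Ulast: "U (length Hs - 1) = carrier G" using epi_closed[OF g] len(3) by (auto simp: U_def)
  \<comment> \<open>The index counts down from the end of the series because \<open>subn\<close>
    descends from the whole group.\<close>
  have subn_U: "subn G (carrier G) (U (length Hs - 1 - j))" if "j < length Hs" for j
    using that
  proof (induction j)
    case 0
    then show ?case using Ulast subn.refl[OF subgroup_self] by simp
  next
    case (Suc j)
    let ?i = "length Hs - 1 - Suc j"
    have i: "Suc ?i < length Hs" "Suc ?i = length Hs - 1 - j" using Suc by auto
    have "subn G (carrier G) (U (Suc ?i))" using Suc i by simp
    then show ?case
      by (rule subn.step[OF _ epi_ker_subgroup[OF e(2,1)] epi_ker_subset[OF e(2)] epi_ker_normalised[OF e(2,1)]]) (use i in auto)
  qed
  have mono: "U i \<subseteq> U j" if "i \<le> j" "j < length Hs" for i j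
    using that
  proof (induction j)
    case (Suc j)
    then show ?case using epi_ker_subset[OF e(2)[of j]] by (cases "i = Suc j") auto
  qed auto
  have sU: "subgroup (U i) G" if "i < length Hs" for i
    using subn_subgroup[OF subn_U[of "length Hs - 1 - i"]] that by (simp add: Suc_diff_Suc)
  let ?I = "{i. Suc i < length Hs \<and> P (comp_factor ?F Hs i)}"
  have "\<exists>i\<in>?I. \<not> U (Suc i) \<inter> D \<subseteq> U i"
  proof (rule ccontr)
    assume "\<not> ?thesis"
    then have sub: "U (Suc i) \<inter> D \<subseteq> U i" if "i \<in> ?I" for i using that by blast
    have "inj_on (\<lambda>i. U i <#> D) ?I"
    proof (rule linorder_inj_onI')
      fix i j assume ij: "i \<in> ?I" "j \<in> ?I" "i < j"
      have len_ij: "Suc i < length Hs" "i < length Hs" "j < length Hs" using ij by auto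
      then have "U (Suc i) \<noteq> U i" using epi_simple_proper[OF e(2,1) simp] by metis
      then obtain x where x: "x \<in> U (Suc i)" "x \<notin> U i" using mono[of i "Suc i"] ij by auto
      have "x \<in> U j" using x mono[of "Suc i" j] ij by auto
      then have "x \<in> U j <#> D" using set_mult_upper1[OF sU[OF len_ij(3)] sD] by auto
      moreover have "x \<notin> U i <#> D"
      proof
        assume "x \<in> U i <#> D"
        then obtain u d where ud: "u \<in> U i" "d \<in> D" "x = u \<otimes> d" by (auto simp: set_mult_def)
        have uS: "u \<in> U (Suc i)" using ud mono[of i "Suc i"] ij by auto
        have c: "u \<in> carrier G" "d \<in> carrier G" using ud subgroup.mem_carrier[OF sD] by (auto simp: U_def)
        have "d = inv u \<otimes> x" using ud c by (simp add: inv_mult_cancel)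
        then have "d \<in> U (Suc i)"
          using x uS subgroup.m_closed[OF e(1)[OF len_ij(1)]] subgroup.m_inv_closed[OF e(1)[OF len_ij(1)]] by auto
        then have "d \<in> U i" using sub[OF ij(1)] ud by auto
        then have "x \<in> U i" using ud subgroup.m_closed[OF sU[OF len_ij(2)]] by auto
        then show False using x by simp
      qed
      ultimately show "U i <#> D \<noteq> U j <#> D" by auto
    qed
    moreover have "(\<lambda>i. U i <#> D) ` ?I \<subseteq> {H. subgroup H G \<and> D \<subseteq> H}"
    proof (rule image_subsetI, rule CollectI, rule conjI)
      fix i assume "i \<in> ?I"
      then have i: "Suc i < length Hs" by simp
      have "normalises G (U i) D" by (rule normalises_mono[OF nD]) (auto simp: U_def)
      then show "subgroup (U i <#> D) G" using subgroup_set_mult[OF sU sD] i by simp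
      show "D \<subseteq> U i <#> D" using set_mult_upper2[OF sU[of i] sD] i by auto
    qed
    ultimately have "card ?I \<le> card {H. subgroup H G \<and> D \<subseteq> H}" by (rule card_inj_on_le) (rule fin)
    then show False using I by simp
  qed
  then obtain i where i: "Suc i < length Hs" "P (comp_factor ?F Hs i)" "\<not> U (Suc i) \<inter> D \<subseteq> U i" by auto
  let ?H = "U (Suc i) \<inter> D" and ?\<psi> = "(\<lambda>y. (Hs ! i) #>\<^bsub>?F\<^esub> y) \<circ> ?g"
  have "subn G (carrier G) (U (Suc i))" using subn_U[of "length Hs - 1 - Suc i"] i by (simp add: Suc_diff_Suc)
  from subn_Int[OF this sD] have "subn G D ?H" using subgroup.subset[OF sD] by (simp add: Int_absorb1)
  moreover have "normalises G (U (Suc i)) ?H"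
    by (intro normalises_Int subgroup_normalises_self e i normalises_mono[OF nD]) (auto simp: U_def)
  then have "?\<psi> ` ?H = carrier (comp_factor ?F Hs i)"
    using epi_simple[OF e(2,1) simp, OF i(1) i(1) i(1) subn_subgroup[OF \<open>subn G D ?H\<close>]] i(3) by blast
  then have "epi_ker G ?H (?H \<inter> U i) (comp_factor ?F Hs i) ?\<psi>"
    by (intro epi_restrict[OF e(2)] i) auto
  moreover have "N \<inter> ?H \<subseteq> ?H \<inter> U i" using NU[of i] i by auto
  ultimately show ?thesis using i simp by blast
qed

end

section \<open>Chief factors of the class and their centralisers\<close>

context profinite
begin

definition class_chief :: "nat monoid set \<Rightarrow> 'a set \<Rightarrow> 'a set \<Rightarrow> nat monoid \<Rightarrow> bool" where
  "class_chief \<C> R S K \<longleftrightarrow> chief G R S \<and> openin T S \<and> K \<in> \<C> \<and>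
     (\<exists>(k::nat) \<phi>. epi_ker G R S (product_group {..<k} (\<lambda>_. K)) \<phi>)"

text \<open>The class condition supplies more factors than \<open>D\<close> has overgroups, so one
  of them occurs between \<open>D \<inter> N\<close> and \<open>D\<close>, and from there it is
  moved into a chief factor.\<close>

lemma ex_class_chief_below:
  assumes st: "condition_starstar G T \<C>" and cl: "class_of_finite_simple \<C>" and D: "D \<lhd> G" "openin T D"
  shows "\<exists>R S K. class_chief \<C> R S K \<and> R \<subseteq> D"
proof -
  note sD = normal_imp_subgroup[OF D(1)]
  let ?O = "{H. subgroup H G \<and> D \<subseteq> H}"
  have fin: "finite ?O" by (rule finite_open_overgroups[OF sD D(2)])
  obtain N Hs where N: "N \<lhd> G" "openin T N" "composition_series (G Mod N) Hs"
    "Suc (card ?O) \<le> card {i. Suc i < length Hs \<and> in_class (comp_factor (G Mod N) Hs i) \<C>}"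
    using st unfolding condition_starstar_def by blast
  have lt: "card ?O < card {i. Suc i < length Hs \<and> in_class (comp_factor (G Mod N) Hs i) \<C>}" using N(4) by simp
  obtain i H K0 \<psi> where i: "in_class (comp_factor (G Mod N) Hs i) \<C>" and H: "subn G D H"
    and e: "epi_ker G H K0 (comp_factor (G Mod N) Hs i) \<psi>" and NH: "N \<inter> H \<subseteq> K0"
    using composition_factor_below[OF D(1) fin N(1,3), of "\<lambda>Q. in_class Q \<C>"] lt by blast
  obtain K h where K: "K \<in> \<C>" "h \<in> iso (comp_factor (G Mod N) Hs i) K"
    using i by (auto simp: in_class_def is_iso_def)
  have sK: "simple_group K" using cl K by (auto simp: class_of_finite_simple_def)
  then have "group K" by (simp add: simple_group_def)
  then have e': "epi_ker G H K0 K (h \<circ> \<psi>)" using epi_iso[OF e K(2)] by blast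
  have B: "D \<inter> N \<lhd> G" using D N by (simp add: normal_subgroup_intersect)
  have oB: "openin T (D \<inter> N)" using D N by auto
  have "H \<inter> (D \<inter> N) \<subseteq> K0" using NH by auto
  then obtain R S and k :: nat and \<phi> where *: "chief G R S" "D \<inter> N \<subseteq> S" "R \<subseteq> D" "epi_ker G R S (product_group {..<k} (\<lambda>_. K)) \<phi>"
    using subnormal_section_chief[OF B open_finite_index[OF normal_imp_subgroup[OF B] oB] D(1) _ H e' sK] by auto
  have "S \<lhd> G" using * by (simp add: chief_def)
  then have "openin T S" using open_overgroup[OF normal_imp_subgroup[OF B] oB normal_imp_subgroup *(2)] by blast
  then show ?thesis using * K unfolding class_chief_def by blast
qed

text \<open>The centraliser of \<open>R / S\<close>, expressed by commutators. \<open>S\<close> need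
  not lie in \<open>R\<close>: a trivial \<open>S\<close> gives the centraliser of \<open>R\<close>,
  and a normal \<open>S\<close> the preimage of the centraliser of the image of \<open>R\<close> in
  \<open>G / S\<close>.\<close>

definition cent_mod :: "'a set \<Rightarrow> 'a set \<Rightarrow> 'a set" where
  "cent_mod R S = {g \<in> carrier G. \<forall>r\<in>R. g \<otimes> r \<otimes> inv g \<otimes> inv r \<in> S}"

lemma cent_mod_closed_normal:
  assumes R: "R \<lhd> G" and S: "S \<lhd> G" "closedin T S"
  shows "closed_normal G T (cent_mod R S)"
proof -
  note sR = normal_imp_subgroup[OF R] and sS = normal_imp_subgroup[OF S(1)]
  have Rc: "r \<in> carrier G" if "r \<in> R" for r using subgroup.mem_carrier[OF sR that] .
  have "closedin T {g \<in> topspace T. g \<otimes> r \<otimes> inv g \<otimes> inv r \<in> S}" if r: "r \<in> R" for r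
  proof -
    have "continuous_map T T (\<lambda>g. g \<otimes> r \<otimes> inv g \<otimes> inv r)"
      using Rc[OF r] by (intro continuous_mult continuous_inv continuous_const continuous_map_id[unfolded id_def]) auto
    then show ?thesis by (rule closedin_continuous_map_preimage) (rule S(2))
  qed
  then have "closedin T ((\<Inter>r\<in>R. {g \<in> topspace T. g \<otimes> r \<otimes> inv g \<otimes> inv r \<in> S}))"
    using subgroup.one_closed[OF sR] by (intro closedin_INT) auto
  moreover have "(\<Inter>r\<in>R. {g \<in> topspace T. g \<otimes> r \<otimes> inv g \<otimes> inv r \<in> S}) = cent_mod R S"
    using subgroup.one_closed[OF sR] by (auto simp: cent_mod_def)
  ultimately have cl: "closedin T (cent_mod R S)" by simp
  have "subgroup (cent_mod R S) G"
  proof (rule subgroupI)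
    show "cent_mod R S \<noteq> {}" using subgroup.one_closed[OF sS] Rc by (auto simp: cent_mod_def intro!: exI[of _ \<one>])
    fix g assume g: "g \<in> cent_mod R S"
    then have gc: "g \<in> carrier G" by (simp add: cent_mod_def)
    have "inv g \<otimes> r \<otimes> inv (inv g) \<otimes> inv r \<in> S" if r: "r \<in> R" for r
    proof -
      have "g \<otimes> r \<otimes> inv g \<otimes> inv r \<in> S" using g r by (simp add: cent_mod_def)
      then have "inv g \<otimes> inv (g \<otimes> r \<otimes> inv g \<otimes> inv r) \<otimes> inv (inv g) \<in> S"
        by (intro normal_conj[OF S(1)] subgroup.m_inv_closed[OF sS]) (use gc in auto)
      then show ?thesis using gc Rc[OF r] by (simp add: group_simps)
    qed
    then show "inv g \<in> cent_mod R S" using gc by (simp add: cent_mod_def)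
    fix h assume h: "h \<in> cent_mod R S"
    then have hc: "h \<in> carrier G" by (simp add: cent_mod_def)
    \<comment> \<open>The commutator identity
      \<open>[g h, r] = [g, h r h^-1] [h, r]\<close>.\<close>
    have "(g \<otimes> h) \<otimes> r \<otimes> inv (g \<otimes> h) \<otimes> inv r \<in> S" if r: "r \<in> R" for r
    proof -
      have "h \<otimes> r \<otimes> inv h \<in> R" using normal_conj[OF R hc r] .
      then have "g \<otimes> (h \<otimes> r \<otimes> inv h) \<otimes> inv g \<otimes> inv (h \<otimes> r \<otimes> inv h) \<in> S" "h \<otimes> r \<otimes> inv h \<otimes> inv r \<in> S"
        using g h r by (auto simp: cent_mod_def)
      then have "(g \<otimes> (h \<otimes> r \<otimes> inv h) \<otimes> inv g \<otimes> inv (h \<otimes> r \<otimes> inv h)) \<otimes> (h \<otimes> r \<otimes> inv h \<otimes> inv r) \<in> S"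
        by (rule subgroup.m_closed[OF sS])
      then show ?thesis using gc hc Rc[OF r] by (simp add: group_simps)
    qed
    then show "g \<otimes> h \<in> cent_mod R S" using gc hc by (simp add: cent_mod_def)
  qed (auto simp: cent_mod_def)
  moreover have "normalises G (carrier G) (cent_mod R S)"
    unfolding normalises_def
  proof (intro ballI)
    fix a g assume a: "a \<in> carrier G" and g: "g \<in> cent_mod R S"
    then have gc: "g \<in> carrier G" by (simp add: cent_mod_def)
    have "(a \<otimes> g \<otimes> inv a) \<otimes> r \<otimes> inv (a \<otimes> g \<otimes> inv a) \<otimes> inv r \<in> S" if r: "r \<in> R" for r
    proof -
      have "inv a \<otimes> r \<otimes> inv (inv a) \<in> R" using normal_conj[OF R inv_closed[OF a] r] .
      then have "g \<otimes> (inv a \<otimes> r \<otimes> inv (inv a)) \<otimes> inv g \<otimes> inv (inv a \<otimes> r \<otimes> inv (inv a)) \<in> S"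
        using g by (simp add: cent_mod_def)
      from normal_conj[OF S(1) a this] show ?thesis using a gc Rc[OF r] by (simp add: group_simps)
    qed
    then show "a \<otimes> g \<otimes> inv a \<in> cent_mod R S" using a gc by (simp add: cent_mod_def)
  qed
  ultimately show ?thesis using cl by (simp add: closed_normal_def normal_iff_normalises)
qed

lemma just_infinite_ji_under:
  assumes "just_infinite G T"
  shows "ji_under (carrier G)"
  unfolding ji_under_def
proof (intro conjI allI impI)
  show "carrier G \<lhd> G" by (simp add: normal_iff_normalises subgroup_self normalises_def)
  show "openin T (carrier G)" using openin_topspace[of T] by simp
  show "\<not> openin T {\<one>}"
  proof
    assume "openin T {\<one>}"
    then have "finite (rcosets {\<one>})" by (intro open_finite_index triv_subgroup)
    moreover have "inj_on (\<lambda>x. {\<one>} #> x) (carrier G)" by (auto simp: inj_on_def r_coset_def)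
    then have "infinite ((\<lambda>x. {\<one>} #> x) ` carrier G)"
      using assms finite_imageD by (auto simp: just_infinite_def)
    moreover have "(\<lambda>x. {\<one>} #> x) ` carrier G = rcosets {\<one>}" by (auto simp: RCOSETS_def)
    ultimately show False by simp
  qed
  fix H assume "invsub (carrier G) H" "H \<noteq> {\<one>}"
  then show "openin T H"
    using assms finite_index_open[of H] by (auto simp: just_infinite_def closed_normal_iff_invsub dest: invsubD)
qed

text \<open>Let \<open>R\<close> be minimal among the closed normal subgroups of \<open>R0\<close>
  not inside \<open>S0\<close>. Minimality forces everything smaller into
  \<open>R \<inter> S0\<close>, and since \<open>R\<close> covers the chief factor, the quotient of
  the new pair is isomorphic to \<open>R0 / S0\<close>.\<close>

lemma chief_to_critical:
  assumes ji: "ji_under (carrier G)" and c: "chief G R0 S0" and o: "openin T S0"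
  shows "\<exists>R. critical_pair G T R (R \<inter> S0) \<and> R \<subseteq> R0 \<and> R <#> S0 = R0 \<and> openin T R"
proof -
  have R0: "R0 \<lhd> G" and S0: "S0 \<lhd> G" "S0 \<subset> R0" using c by (auto simp: chief_def)
  note sR0 = normal_imp_subgroup[OF R0] and sS0 = normal_imp_subgroup[OF S0(1)]
  have one: "\<one> \<in> S0" using subgroup.one_closed[OF sS0] .
  have oR0: "openin T R0" using open_overgroup[OF sS0 o sR0] S0 by auto
  have iS0: "invsub (carrier G) S0" and iR0: "invsub (carrier G) R0"
    using S0 R0 o oR0 by (auto simp: normal_iff_normalises intro: invsub_openI)
  have "\<exists>R. (invsub (carrier G) R \<and> R \<subseteq> R0 \<and> \<not> R \<subseteq> S0) \<and>
    (\<forall>R'. invsub (carrier G) R' \<and> R' \<subseteq> R0 \<and> \<not> R' \<subseteq> S0 \<longrightarrow> \<not> R' \<subset> R)"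
    by (rule ex_minimal_invsub[OF ji o one, of _ R0]) (use iR0 S0 in auto)
  then obtain R where R: "invsub (carrier G) R" "R \<subseteq> R0" "\<not> R \<subseteq> S0"
    and Rmin: "\<And>R'. invsub (carrier G) R' \<Longrightarrow> R' \<subseteq> R0 \<Longrightarrow> \<not> R' \<subseteq> S0 \<Longrightarrow> \<not> R' \<subset> R" by metis
  have oR: "openin T R" using ji_open_if_not_subset[OF ji R(1,3) one] .
  have "critical_pair G T R (R \<inter> S0)"
    unfolding critical_pair_def closed_normal_iff_invsub
    using R Rmin invsub_Int[OF R(1) iS0] by blast
  moreover have "R <#> S0 = R0"
  proof -
    have sR: "subgroup R G" and nR: "normalises G (carrier G) R" using R invsubD by auto
    have nS0: "normalises G (carrier G) S0" using invsubD(3)[OF iS0] .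
    have "subgroup (R <#> S0) G"
      by (rule subgroup_set_mult[OF sR sS0 normalises_mono[OF nS0 subgroup.subset[OF sR]]])
    moreover have "normalises G (carrier G) (R <#> S0)"
      by (rule normalises_set_mult[OF sR sS0 _ nR nS0]) simp
    ultimately have "R <#> S0 \<lhd> G" by (simp add: normal_iff_normalises)
    moreover have "S0 \<subseteq> R <#> S0" by (rule set_mult_upper2[OF sR sS0])
    moreover have "R <#> S0 \<subseteq> R0" by (rule set_mult_least[OF R(2) _ sR0]) (use S0 in auto)
    moreover have "R <#> S0 \<noteq> S0" using set_mult_upper1[OF sR sS0] R(3) by auto
    ultimately show ?thesis using c by (auto simp: chief_def)
  qed
  ultimately show ?thesis using R oR by blast
qed

end

section \<open>Quotients of prime power exponent\<close>

text \<open>If another prime \<open>q\<close> divided the order, a nontrivial element of a Sylow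
  \<open>q\<close>-subgroup would have an order dividing a power of \<open>q\<close> and a power of
  \<open>p\<close>.\<close>

lemma (in group) order_p_power:
  assumes fin: "finite (carrier G)" and p: "Factorial_Ring.prime (p::nat)"
    and pp: "\<And>x. x \<in> carrier G \<Longrightarrow> \<exists>k::nat. x [^] (p ^ k) = \<one>"
  shows "\<exists>k. order G = p ^ k"
proof (rule ccontr)
  assume no: "\<not> ?thesis"
  have n0: "order G \<noteq> 0" using fin order_gt_0_iff_finite by simp
  have "\<exists>q. Factorial_Ring.prime q \<and> q \<noteq> p \<and> q dvd order G"
  proof (rule ccontr)
    assume *: "\<not> ?thesis"
    obtain a b where ab: "order G = p ^ a * b" "\<not> p dvd b"
      using multiplicity_decompose'[of "order G" p] n0 p by (metis not_prime_unit)
    have "b = 1"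
    proof (rule ccontr)
      assume "b \<noteq> 1"
      then obtain q where "Factorial_Ring.prime q" "q dvd b" using prime_factor_nat by blast
      then show False using * ab by auto
    qed
    then show False using no ab by auto
  qed
  then obtain q where q: "Factorial_Ring.prime q" "q \<noteq> p" "q dvd order G" by blast
  obtain c b where cb: "order G = q ^ c * b" "\<not> q dvd b"
    using multiplicity_decompose'[of "order G" q] n0 q by (metis not_prime_unit)
  obtain H where H: "subgroup H G" "card H = q ^ c"
    using sylow_thm[OF q(1) is_group cb(1) fin] by blast
  have "c \<noteq> 0" using q cb by (cases c) auto
  then have "card H > 1" unfolding H(2) using prime_gt_1_nat[OF q(1)] by (intro one_less_power) auto
  then have "\<not> H \<subseteq> {\<one>}" by (metis card.empty card_insert_disjoint card_mono empty_iff finite.emptyI finite_insert not_less One_nat_def)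
  then obtain x where x: "x \<in> H" "x \<noteq> \<one>" by auto
  have xc: "x \<in> carrier G" using x subgroup.mem_carrier[OF H(1)] by simp
  interpret H: group "G\<lparr>carrier := H\<rparr>" by (rule subgroup_imp_group[OF H(1)])
  have "x [^]\<^bsub>G\<lparr>carrier := H\<rparr>\<^esub> order (G\<lparr>carrier := H\<rparr>) = \<one>" using H.pow_order_eq_1 x by simp
  then have "x [^] (q ^ c) = \<one>" using H(2) by (simp add: order_def nat_pow_def)
  then have "ord x dvd q ^ c" using pow_eq_id[OF xc] by simp
  moreover obtain k where "x [^] (p ^ k) = \<one>" using pp[OF xc] by blast
  then have "ord x dvd p ^ k" using pow_eq_id[OF xc] by simp
  moreover have "coprime (q ^ c) (p ^ k)" using primes_coprime[OF q(1) p q(2)] by simp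
  ultimately have "ord x = 1" by (metis coprime_common_divisor nat_dvd_1_iff_1)
  then show False using ord_eq_1[OF xc] x by simp
qed

section \<open>Open normal subgroups with a p-group quotient\<close>

context profinite
begin

lemma profinite_open_subgroup:
  assumes H: "subgroup H G" "openin T H"
  shows "profinite_group (G\<lparr>carrier := H\<rparr>) (subtopology T H)"
proof -
  have HG: "H \<subseteq> carrier G" using subgroup.subset[OF H(1)] .
  have cl: "closedin T H" by (rule open_subgroup_closed[OF H])
  have ts: "topspace (subtopology T H) = H" using HG by (simp add: Int_absorb1)
  have "continuous_map (prod_topology (subtopology T H) (subtopology T H)) (subtopology T H)
      (\<lambda>(x,y). x \<otimes>\<^bsub>G\<lparr>carrier := H\<rparr>\<^esub> y)"
    unfolding continuous_map_in_subtopology split_beta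
  proof
    show "continuous_map (prod_topology (subtopology T H) (subtopology T H)) T
      (\<lambda>x. fst x \<otimes>\<^bsub>G\<lparr>carrier := H\<rparr>\<^esub> snd x)"
    proof (simp, rule continuous_mult)
      show "continuous_map (prod_topology (subtopology T H) (subtopology T H)) T fst"
        by (rule continuous_map_into_fulltopology[OF continuous_map_fst])
      show "continuous_map (prod_topology (subtopology T H) (subtopology T H)) T snd"
        by (rule continuous_map_into_fulltopology[OF continuous_map_snd])
    qed
    show "(\<lambda>x. fst x \<otimes>\<^bsub>G\<lparr>carrier := H\<rparr>\<^esub> snd x) \<in> topspace (prod_topology (subtopology T H) (subtopology T H)) \<rightarrow> H"
      unfolding topspace_prod_topology ts by (auto intro: subgroup.m_closed[OF H(1)])
  qed
  moreover have "continuous_map (subtopology T H) (subtopology T H) (\<lambda>x. inv\<^bsub>G\<lparr>carrier := H\<rparr>\<^esub> x)"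
  proof -
    have "continuous_map (subtopology T H) (subtopology T H) (\<lambda>x. inv x)"
      unfolding continuous_map_in_subtopology
    proof
      show "continuous_map (subtopology T H) T (\<lambda>x. inv x)"
        by (rule continuous_inv) (rule continuous_map_from_subtopology[OF continuous_map_id[unfolded id_def]])
      show "(\<lambda>x. inv x) \<in> topspace (subtopology T H) \<rightarrow> H"
        using ts subgroup.m_inv_closed[OF H(1)] by auto
    qed
    then show ?thesis
      by (rule continuous_map_eq) (use ts m_inv_consistent[OF H(1)] in auto)
  qed
  moreover have "compact_space (subtopology T H)"
    using closedin_compact_space[OF compact cl] compactin_subspace by blast
  moreover have "connected_component_of_set (subtopology T H) x = {x}" if x: "x \<in> topspace (subtopology T H)" for x
  proof (intro equalityI subsetI)
    fix y assume "y \<in> connected_component_of_set (subtopology T H) x"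
    then obtain C where "connectedin (subtopology T H) C" "x \<in> C" "y \<in> C"
      by (auto simp: connected_component_of_def)
    then have "connected_component_of T x y"
      unfolding connected_component_of_def by (auto simp: connectedin_subtopology)
    moreover have "connected_component_of_set T x = {x}"
      using profinite x ts HG by (auto simp: profinite_group_def)
    ultimately show "y \<in> {x}" by blast
  qed (use x in \<open>auto simp: connected_component_of_refl\<close>)
  ultimately show ?thesis
    unfolding profinite_group_def topological_group_def
    using subgroup_imp_group[OF H(1)] ts Hausdorff_space_subtopology[OF hausdorff] by auto
qed

text \<open>\<open>pro_p\<close> tests all open normal subgroups of \<open>D\<close>, which need not
  be normal in \<open>G\<close>; hence \<open>pp\<close> ranges over arbitrary open subgroups
  \<open>N\<close>.\<close>

lemma virtually_pro_p_if_p_powers: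
  assumes D: "subgroup D G" "openin T D" and p: "Factorial_Ring.prime (p::nat)"
    and pp: "\<And>N d. subgroup N G \<Longrightarrow> openin T N \<Longrightarrow> d \<in> D \<Longrightarrow> \<exists>k::nat. d [^] (p ^ k) \<in> N"
  shows "virtually_pro_p G T p"
proof -
  let ?D = "G\<lparr>carrier := D\<rparr>"
  interpret D: group ?D by (rule subgroup_imp_group[OF D(1)])
  have "\<exists>k. card (rcosets\<^bsub>?D\<^esub> N) = p ^ k" if N: "N \<lhd> ?D" "openin (subtopology T D) N" for N
  proof -
    interpret N: normal N ?D by (rule N(1))
    have oN: "openin T N" using N(2) D(2) by (simp add: openin_open_subtopology)
    have sN: "subgroup N G" using incl_subgroup[OF D(1) N.is_subgroup] .
    interpret F: group "?D Mod N" by (rule N.factorgroup_is_group)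
    have "rcosets\<^bsub>?D\<^esub> N \<subseteq> rcosets N" using subgroup.mem_carrier[OF D(1)] by (auto simp: RCOSETS_def)
    then have "finite (carrier (?D Mod N))"
      using open_finite_index[OF sN oN] finite_subset by (auto simp: FactGroup_def)
    moreover have "\<exists>k::nat. C [^]\<^bsub>?D Mod N\<^esub> (p ^ k) = \<one>\<^bsub>?D Mod N\<^esub>" if C: "C \<in> carrier (?D Mod N)" for C
    proof -
      obtain d where d: "d \<in> D" "C = N #>\<^bsub>?D\<^esub> d"
        using C by (auto simp: carrier_FactGroup simp del: r_coset_consistent)
      obtain k :: nat where k: "d [^] (p ^ k) \<in> N" using pp[OF sN oN d(1)] by blast
      have "d [^]\<^bsub>?D\<^esub> (p ^ k) \<in> N" using k by (simp add: nat_pow_def)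
      then have "N #>\<^bsub>?D\<^esub> (d [^]\<^bsub>?D\<^esub> (p ^ k)) = N" by (rule N.rcos_const[OF D.is_group])
      then show ?thesis using d N.FactGroup_pow[of d "p ^ k"] by auto
    qed
    ultimately have "\<exists>k. order (?D Mod N) = p ^ k" by (rule F.order_p_power[OF _ p])
    then show ?thesis by (simp add: order_def FactGroup_def)
  qed
  then show ?thesis
    unfolding virtually_pro_p_def pro_p_def using profinite_open_subgroup[OF D] D by blast
qed

text \<open>Says that \<open>D / M\<close> is a \<open>p\<close>-group, through powers of elements
  and with an exponent depending on the element. No quotient group has to be formed, and stability
  under intersections is immediate.\<close>

definition p_quotient :: "'a set \<Rightarrow> nat \<Rightarrow> 'a set \<Rightarrow> bool" where
  "p_quotient D p M \<longleftrightarrow> M \<lhd> G \<and> openin T M \<and> M \<subseteq> D \<and> (\<forall>d\<in>D. \<exists>k::nat. d [^] (p ^ k) \<in> M)"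

lemma nat_pow_mem: "subgroup H G \<Longrightarrow> x \<in> H \<Longrightarrow> x [^] (n::nat) \<in> H"
  by (induction n) (auto simp: subgroup.one_closed subgroup.m_closed)

lemma p_quotient_Int:
  assumes "p_quotient D p M" "p_quotient D p N" "D \<subseteq> carrier G"
  shows "p_quotient D p (M \<inter> N)"
  unfolding p_quotient_def
proof (intro conjI ballI)
  fix d assume d: "d \<in> D"
  then obtain k l :: nat where kl: "d [^] (p ^ k) \<in> M" "d [^] (p ^ l) \<in> N" using assms by (meson p_quotient_def)
  have dc: "d \<in> carrier G" using d assms by auto
  have "d [^] (p ^ (k + l)) = (d [^] (p ^ k)) [^] (p ^ l)" "d [^] (p ^ (k + l)) = (d [^] (p ^ l)) [^] (p ^ k)"
    using dc by (simp_all add: nat_pow_pow power_add mult.commute)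
  then have "d [^] (p ^ (k + l)) \<in> M \<inter> N"
    using kl nat_pow_mem[of M] nat_pow_mem[of N] assms normal_imp_subgroup by (metis Int_iff p_quotient_def)
  then show "\<exists>k::nat. d [^] (p ^ k) \<in> M \<inter> N" by blast
qed (use assms in \<open>auto simp: p_quotient_def normal_subgroup_intersect\<close>)

text \<open>Otherwise there is an infinite strict descent from \<open>D\<close>. Its intersection
  cannot be open, so it is trivial, and by compactness every open subgroup contains a term of the
  descent; this makes \<open>D\<close> pro-\<open>p\<close>. A minimal one is least since
  intersections are again \<open>p\<close>-quotients.\<close>

lemma ex_least_p_quotient:
  assumes ji: "ji_under (carrier G)" and D: "D \<lhd> G" "openin T D" and p: "Factorial_Ring.prime (p::nat)"
    and nv: "\<not> virtually_pro_p G T p"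
  shows "\<exists>E. p_quotient D p E \<and> (\<forall>M. p_quotient D p M \<longrightarrow> E \<subseteq> M)"
proof -
  note sD = normal_imp_subgroup[OF D(1)]
  have "\<exists>E. p_quotient D p E \<and> (\<forall>M. p_quotient D p M \<longrightarrow> \<not> M \<subset> E)"
  proof (rule ccontr)
    assume "\<not> ?thesis"
    then have "\<forall>M. \<exists>M'. p_quotient D p M \<longrightarrow> p_quotient D p M' \<and> M' \<subset> M" by blast
    then obtain f where f: "\<And>M. p_quotient D p M \<Longrightarrow> p_quotient D p (f M) \<and> f M \<subset> M" by metis
    define S where "S n = (f ^^ n) D" for n
    have "p_quotient D p D" using D subgroup.mem_carrier[OF sD] by (auto simp: p_quotient_def intro!: exI[of _ 0])
    then have S: "p_quotient D p (S n)" for n by (induction n) (auto simp: S_def f)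
    have dec: "S (Suc n) \<subset> S n" for n using f S by (simp add: S_def)
    have iS: "invsub (carrier G) (S n)" and cS: "closedin T (S n)" for n
      using S[of n] open_subgroup_closed normal_iff_normalises by (auto simp: p_quotient_def invsub_def)
    let ?I = "\<Inter>n. S n"
    have I: "invsub (carrier G) ?I" using iS by (intro invsub_Inter) auto
    have triv: "?I = {\<one>}"
    proof (rule ccontr)
      assume "?I \<noteq> {\<one>}"
      then have "openin T ?I" using ji_open[OF ji I] by simp
      then obtain n where "S n \<subseteq> ?I" using compact_decseq[of S ?I] cS dec by (metis less_imp_le subset_refl)
      then show False using dec[of n] by auto
    qed
    have "\<exists>k::nat. d [^] (p ^ k) \<in> N" if N: "subgroup N G" "openin T N" and d: "d \<in> D" for N d
    proof -
      have "?I \<subseteq> N" using triv subgroup.one_closed[OF N(1)] by simp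
      then obtain n where "S n \<subseteq> N" using compact_decseq[of S N] cS dec N by (metis less_imp_le)
      moreover obtain k :: nat where "d [^] (p ^ k) \<in> S n" using S[of n] d by (auto simp: p_quotient_def)
      ultimately show ?thesis by blast
    qed
    then show False using virtually_pro_p_if_p_powers[OF sD D(2) p] nv by blast
  qed
  then obtain E where E: "p_quotient D p E" "\<And>M. p_quotient D p M \<Longrightarrow> \<not> M \<subset> E" by blast
  have "E \<subseteq> M" if "p_quotient D p M" for M
    using p_quotient_Int[OF that E(1) subgroup.subset[OF sD]] E(2)[of "M \<inter> E"] by blast
  then show ?thesis using E by blast
qed

end

text \<open>The class and the condition on multipliers speak of groups on \<open>nat\<close>,
  whereas the simple sections met in the proof live on sets of cosets.\<close>

lemma ex_nat_copy:
  assumes "group Q" "finite (carrier Q)"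
  shows "\<exists>(N :: nat monoid) h. group N \<and> finite (carrier N) \<and> h \<in> iso Q N"
proof -
  interpret Q: group Q by fact
  obtain h :: "'a \<Rightarrow> nat" where h: "inj_on h (carrier Q)" using finite_imp_inj_to_nat_seg[OF assms(2)] by blast
  define g where "g = inv_into (carrier Q) h"
  define N :: "nat monoid" where "N = \<lparr>carrier = h ` carrier Q, monoid.mult = (\<lambda>x y. h (g x \<otimes>\<^bsub>Q\<^esub> g y)), one = h \<one>\<^bsub>Q\<^esub>\<rparr>"
  have gh: "g (h x) = x" if "x \<in> carrier Q" for x using h that by (simp add: g_def)
  have "h \<in> iso Q N" using h by (auto simp: iso_def hom_def N_def gh bij_betw_def)
  moreover have "group N"
  proof (rule groupI)
    fix x assume "x \<in> carrier N"
    then obtain a where "a \<in> carrier Q" "x = h a" by (auto simp: N_def)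
    then show "\<exists>y\<in>carrier N. y \<otimes>\<^bsub>N\<^esub> x = \<one>\<^bsub>N\<^esub>"
      by (intro bexI[of _ "h (inv\<^bsub>Q\<^esub> a)"]) (auto simp: N_def gh)
  qed (auto simp: N_def gh Q.m_assoc)
  ultimately show ?thesis using assms(2) by (auto simp: N_def)
qed

lemma (in group) subn_next:
  assumes "subn G E Y" "Y \<noteq> E"
  shows "\<exists>Z. subn G E Z \<and> Y \<subset> Z \<and> normalises G Z Y"
  using assms
proof (induction rule: subn.induct)
  case (step Y H)
  show ?case
  proof (cases "H = Y")
    case True
    then show ?thesis using step by auto
  next
    case False
    then show ?thesis using step by blast
  qed
qed auto

lemma ex_root_of_unity:
  assumes "Factorial_Ring.prime (p::nat)"
  shows "\<exists>w::complex. w ^ p = 1 \<and> w \<noteq> 1"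
proof (rule ccontr)
  assume "\<not> ?thesis"
  then have "{z::complex. z ^ p = 1} = {1}" by auto
  then have "card {z::complex. z ^ p = 1} = 1" by simp
  moreover have "card {z::complex. z ^ p = 1} = p"
    using card_roots_unity_eq[of p] prime_gt_0_nat[OF assms] by simp
  ultimately show False using prime_gt_1_nat[OF assms] by simp
qed

context group
begin

lemma power_epi_nontrivial:
  assumes e: "epi_ker G R S (product_group {..<k::nat} (\<lambda>_. K)) \<phi>" and "S \<noteq> R" and sR: "subgroup R G"
  shows "k > 0"
proof (rule ccontr)
  assume "\<not> k > 0"
  then have "\<phi> x = \<one>\<^bsub>product_group {..<k} (\<lambda>_. K)\<^esub>" if "x \<in> R" for x
    using epi_closed[OF e that] by (auto simp: PiE_iff)
  then show False using epi_one_iff[OF e] epi_ker_subset[OF e] \<open>S \<noteq> R\<close> by blast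
qed

text \<open>One coordinate turns a map onto a power into a map onto \<open>K\<close>. Coordinate 0
  exists because a proper \<open>S\<close> forces \<open>k > 0\<close>.\<close>

lemma power_epi_coordinate:
  assumes e: "epi_ker G R S (product_group {..<k::nat} (\<lambda>_. K)) \<phi>" and "S \<noteq> R" and sR: "subgroup R G" and K: "group K"
  shows "\<exists>M. epi_ker G R M K (\<lambda>x. \<phi> x 0) \<and> S \<subseteq> M"
proof -
  interpret K: group K by (rule K)
  have k: "0 < k" by (rule power_epi_nontrivial[OF e assms(2,3)])
  have im: "(\<lambda>x. \<phi> x 0) ` R = carrier K"
  proof (intro equalityI subsetI)
    fix u assume "u \<in> carrier K"
    then have "(\<lambda>i\<in>{..<k}. u) \<in> \<phi> ` R" unfolding epi_image[OF e] by auto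
    then obtain x where "x \<in> R" "\<phi> x = (\<lambda>i\<in>{..<k}. u)" by auto
    then show "u \<in> (\<lambda>x. \<phi> x 0) ` R" using k by (intro image_eqI[of _ _ x]) auto
  next
    fix u assume "u \<in> (\<lambda>x. \<phi> x 0) ` R"
    then show "u \<in> carrier K" using epi_closed[OF e] k by (auto simp: PiE_iff)
  qed
  have "epi_ker G R {x \<in> R. \<phi> x 0 = \<one>\<^bsub>K\<^esub>} K (\<lambda>x. \<phi> x 0)"
    unfolding epi_ker_def using im k epi_mult[OF e] by (auto simp: K.is_group)
  moreover have "S \<subseteq> {x \<in> R. \<phi> x 0 = \<one>\<^bsub>K\<^esub>}"
  proof
    fix x assume x: "x \<in> S"
    then have "x \<in> R" using epi_ker_subset[OF e] by auto
    then have "\<phi> x = \<one>\<^bsub>product_group {..<k} (\<lambda>_. K)\<^esub>" using epi_one_iff[OF e] x by simp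
    then show "x \<in> {x \<in> R. \<phi> x 0 = \<one>\<^bsub>K\<^esub>}" using k \<open>x \<in> R\<close> by simp
  qed
  ultimately show ?thesis by blast
qed

lemma epi_comm:
  assumes e: "epi_ker G R M K \<theta>" and sR: "subgroup R G"
    and comm: "\<And>x y. x \<in> R \<Longrightarrow> y \<in> R \<Longrightarrow> x \<otimes> y \<otimes> inv x \<otimes> inv y \<in> M"
    and u: "u \<in> carrier K" "v \<in> carrier K"
  shows "u \<otimes>\<^bsub>K\<^esub> v = v \<otimes>\<^bsub>K\<^esub> u"
proof -
  obtain x y where xy: "x \<in> R" "y \<in> R" "u = \<theta> x" "v = \<theta> y" using u unfolding epi_image[OF e, symmetric] by auto
  have c: "x \<in> carrier G" "y \<in> carrier G" using xy subgroup.mem_carrier[OF sR] by auto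
  have "(x \<otimes> y) \<otimes> inv (y \<otimes> x) \<in> M" using comm[OF xy(1,2)] c by (simp add: group_simps)
  then have "\<theta> (x \<otimes> y) = \<theta> (y \<otimes> x)"
    using epi_eq_iff[OF e sR] xy subgroup.m_closed[OF sR] by simp
  then show ?thesis using xy epi_mult[OF e] by simp
qed

end

context profinite
begin

section \<open>Chief factors below a subgroup that centralises all of them\<close>

context
  fixes \<C> :: "nat monoid set" and D :: "'a set"
  assumes ji: "ji_under (carrier G)" and cl: "class_of_finite_simple \<C>" and st: "condition_starstar G T \<C>"
    and D: "D \<lhd> G" "openin T D"
    and central: "\<And>R S K. class_chief \<C> R S K \<Longrightarrow> R \<subseteq> D \<Longrightarrow> D \<subseteq> cent_mod R S"
begin

text \<open>\<open>R\<close> lies in \<open>D\<close> and so centralises \<open>R / S\<close>; the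
  factor, and with it \<open>K\<close>, is abelian.\<close>

lemma class_chief_comm:
  assumes c: "class_chief \<C> R S K" "R \<subseteq> D" and u: "u \<in> carrier K" "v \<in> carrier K"
  shows "u \<otimes>\<^bsub>K\<^esub> v = v \<otimes>\<^bsub>K\<^esub> u"
proof -
  obtain k :: nat and \<phi> where e: "epi_ker G R S (product_group {..<k} (\<lambda>_. K)) \<phi>"
    and R: "R \<lhd> G" "S \<noteq> R" and K: "K \<in> \<C>" using c by (auto simp: class_chief_def chief_def)
  have "group K" using cl K by (auto simp: class_of_finite_simple_def simple_group_def)
  then obtain M where M: "epi_ker G R M K (\<lambda>x. \<phi> x 0)" "S \<subseteq> M"
    using power_epi_coordinate[OF e R(2) normal_imp_subgroup[OF R(1)]] by blast
  show ?thesis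
  proof (rule epi_comm[OF M(1) normal_imp_subgroup[OF R(1)] _ u])
    fix x y assume "x \<in> R" "y \<in> R"
    moreover have "R \<subseteq> cent_mod R S" using central[OF c] c(2) by simp
    ultimately show "x \<otimes> y \<otimes> inv x \<otimes> inv y \<in> M" using M(2) by (auto simp: cent_mod_def)
  qed
qed

lemma section_below_D:
  assumes B: "B \<lhd> G" "openin T B" and E: "E \<lhd> G" "B \<subseteq> E" "E \<subseteq> D"
    and H: "subn G E H" and e: "epi_ker G H K0 Q \<psi>" and Q: "simple_group Q" and HB: "H \<inter> B \<subseteq> K0"
    and inc: "K \<in> \<C>" "Q \<cong> K"
  shows "\<exists>R S. class_chief \<C> R S K \<and> B \<subseteq> S \<and> R \<subseteq> E"
proof -
  have K: "simple_group K" using cl inc by (auto simp: class_of_finite_simple_def)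
  then have gK: "group K" by (simp add: simple_group_def)
  obtain h where h: "h \<in> iso Q K" using inc by (auto simp: is_iso_def)
  have e': "epi_ker G H K0 K (h \<circ> \<psi>)" by (rule epi_iso[OF e h gK])
  obtain R S and k :: nat and \<phi> where *: "chief G R S" "B \<subseteq> S" "R \<subseteq> E" "epi_ker G R S (product_group {..<k} (\<lambda>_. K)) \<phi>"
    using subnormal_section_chief[OF B(1) open_finite_index[OF normal_imp_subgroup[OF B(1)] B(2)] E(1,2) H e' K HB] by auto
  have "S \<lhd> G" using * by (simp add: chief_def)
  then have "openin T S" using open_overgroup[OF normal_imp_subgroup[OF B(1)] B(2) normal_imp_subgroup *(2)] by blast
  then show ?thesis using * inc unfolding class_chief_def by blast
qed

context
  fixes p :: nat and E :: "'a set"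
  assumes p: "Factorial_Ring.prime p" and pC: "in_class (integer_mod_group p) \<C>"
    and E: "p_quotient D p E" and Emin: "\<And>M. p_quotient D p M \<Longrightarrow> E \<subseteq> M"
begin

text \<open>The condition on multipliers enters here. A section of order \<open>p\<close> would
  produce a chief factor excluded by \<open>top\<close>. An abelian section of another prime order
  is handled by its own order. A non-abelian one is not in the class, because members that occur
  below \<open>D\<close> are abelian, so \<open>p\<close> does not divide the order of its
  multiplier.\<close>

lemma simple_section_kills:
  assumes B: "B \<lhd> G" "openin T B" "B \<subseteq> E"
    and top: "\<And>R S K. class_chief \<C> R S K \<Longrightarrow> R \<subseteq> E \<Longrightarrow> B \<subseteq> S \<Longrightarrow> \<not> K \<cong> integer_mod_group p"
    and H: "subn G E H" and e: "epi_ker G H K0 Q \<psi>" and Q: "simple_group (Q :: nat monoid)" and HB: "B \<subseteq> K0"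
    and fin: "finite (carrier Q)"
  shows "\<not> Q \<cong> integer_mod_group p \<and> (\<exists>n. coprime n p \<and> kills_schur n Q)"
proof -
  interpret Q: group Q using Q by (simp add: simple_group_def)
  have En: "E \<lhd> G" "E \<subseteq> D" using E by (auto simp: p_quotient_def)
  have HB': "H \<inter> B \<subseteq> K0" using HB by auto
  note sec = section_below_D[OF B(1,2) En(1) B(3) En(2) H e Q HB']
  have A: "\<not> Q \<cong> integer_mod_group p"
  proof
    assume q: "Q \<cong> integer_mod_group p"
    obtain K where K: "K \<in> \<C>" "integer_mod_group p \<cong> K" using pC by (auto simp: in_class_def)
    have "Q \<cong> K" using q K(2) by (rule iso_trans)
    then obtain R S where "class_chief \<C> R S K" "B \<subseteq> S" "R \<subseteq> E" using sec K(1) by blast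
    moreover have "K \<cong> integer_mod_group p" using group.iso_sym[OF group_integer_mod_group K(2)] .
    ultimately show False using top by blast
  qed
  moreover have "\<exists>n. coprime n p \<and> kills_schur n Q"
  proof (cases "\<forall>x\<in>carrier Q. \<forall>y\<in>carrier Q. x \<otimes>\<^bsub>Q\<^esub> y = y \<otimes>\<^bsub>Q\<^esub> x")
    case True
    then obtain q where q: "Factorial_Ring.prime q" "Q \<cong> integer_mod_group q"
      using Q.simple_comm_ex_prime[OF Q _ fin] by blast
    then have "q \<noteq> p" using A by auto
    have "card (carrier Q) = card (carrier (integer_mod_group q))" by (rule iso_same_card[OF q(2)])
    also have "\<dots> = q" using prime_gt_0_nat[OF q(1)] by (simp add: carrier_integer_mod_group)
    finally have "coprime (card (carrier Q)) p" using primes_coprime[OF q(1) p \<open>q \<noteq> p\<close>] by simp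
    then show ?thesis using Q.kills_schur_order[OF fin] by blast
  next
    case False
    have "\<not> in_class Q \<C>"
    proof
      assume "in_class Q \<C>"
      then obtain K where K: "K \<in> \<C>" "Q \<cong> K" by (auto simp: in_class_def)
      then obtain R S where RS: "class_chief \<C> R S K" "R \<subseteq> E" using sec by blast
      then have comm: "u \<otimes>\<^bsub>K\<^esub> v = v \<otimes>\<^bsub>K\<^esub> u" if "u \<in> carrier K" "v \<in> carrier K" for u v
        using class_chief_comm[OF RS(1) _ that] En(2) by blast
      obtain h where h: "h \<in> iso Q K" using K by (auto simp: is_iso_def)
      have "x \<otimes>\<^bsub>Q\<^esub> y = y \<otimes>\<^bsub>Q\<^esub> x" if xy: "x \<in> carrier Q" "y \<in> carrier Q" for x y
      proof -
        have "h (x \<otimes>\<^bsub>Q\<^esub> y) = h (y \<otimes>\<^bsub>Q\<^esub> x)"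
          using h xy comm[of "h x" "h y"] by (auto simp: iso_def hom_def)
        moreover have "inj_on h (carrier Q)" using h by (auto simp: iso_def bij_betw_def)
        ultimately show ?thesis using xy by (meson Q.m_closed inj_onD)
      qed
      then show False using False by blast
    qed
    moreover have "\<not> comm_group Q" using False by (meson comm_groupE(4))
    ultimately have "\<not> p dvd schur_multiplier_order Q"
      using st p pC Q fin unfolding condition_starstar_def by blast
    then have "coprime (schur_multiplier_order Q) p"
      using prime_imp_coprime[OF p] coprime_commute by blast
    then show ?thesis using Q.kills_schur_multiplier_order by blast
  qed
  ultimately show ?thesis by blast
qed

text \<open>Extensions of \<open>\<xi>\<close> of \<open>p\<close>-power order are unique at every subnormal stage, hence invariant under
  conjugation, so that the extension can be continued to the next stage.\<close>
lemma extend_char_to_residual: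
  assumes B: "B \<lhd> G" "openin T B" "B \<subseteq> E"
    and top: "\<And>R S K. class_chief \<C> R S K \<Longrightarrow> R \<subseteq> E \<Longrightarrow> B \<subseteq> S \<Longrightarrow> \<not> K \<cong> integer_mod_group p"
    and x0: "char_on G B \<xi>0" "\<And>b. b \<in> B \<Longrightarrow> \<xi>0 b ^ p = 1"
    and inv0: "\<And>x b. x \<in> E \<Longrightarrow> b \<in> B \<Longrightarrow> \<xi>0 (x \<otimes> b \<otimes> inv x) = \<xi>0 b"
  shows "\<exists>\<xi> m. char_on G E \<xi> \<and> (\<forall>b\<in>B. \<xi> b = \<xi>0 b) \<and> (\<forall>x\<in>E. \<xi> x ^ (p ^ m) = 1)"
proof -
  have En: "E \<lhd> G" "E \<subseteq> D" using E by (auto simp: p_quotient_def)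
  note sE = normal_imp_subgroup[OF En(1)] and sB = normal_imp_subgroup[OF B(1)]
  let ?ext = "\<lambda>Y \<xi> m. char_on G Y \<xi> \<and> (\<forall>b\<in>B. \<xi> b = \<xi>0 b) \<and> (\<forall>x\<in>Y. \<xi> x ^ (p ^ m) = 1)"
  \<comment> \<open>Existence and uniqueness are bundled, so that a maximal \<open>Y\<close> can be
    taken among the finitely many subgroups above \<open>B\<close>.\<close>
  let ?P = "\<lambda>Y. subn G E Y \<and> B \<subseteq> Y \<and> (\<exists>\<xi> m. ?ext Y \<xi> m) \<and>
    (\<forall>\<xi> \<eta> m m'. ?ext Y \<xi> m \<longrightarrow> ?ext Y \<eta> m' \<longrightarrow> (\<forall>y\<in>Y. \<xi> y = \<eta> y))"
  have finite_over: "finite {H. subgroup H G \<and> B \<subseteq> H}" by (rule finite_open_overgroups[OF sB B(2)])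
  have "finite {Y. ?P Y}"
    by (rule finite_subset[OF _ finite_over]) (auto dest: subn_subgroup)
  moreover have "?P B"
  proof -
    have "subn G E B"
      using subn.step[OF subn.refl[OF sE] sB B(3)] B(1) normal_iff_normalises normalises_mono subgroup.subset[OF sE] by blast
    moreover have "?ext B \<xi>0 1" using x0 by simp
    ultimately show ?thesis by (metis subset_refl)
  qed
  ultimately have "\<exists>Y\<in>{Y. ?P Y}. B \<subseteq> Y \<and> (\<forall>Y'\<in>{Y. ?P Y}. Y \<subseteq> Y' \<longrightarrow> Y = Y')"
    by (intro finite_has_maximal2) auto
  then obtain Y where "?P Y" and Ymax: "\<And>Y'. ?P Y' \<Longrightarrow> Y \<subseteq> Y' \<Longrightarrow> Y = Y'" by auto
  then have sn: "subn G E Y" and BY: "B \<subseteq> Y"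
    and uniq: "\<And>\<xi> \<eta> m m' y. ?ext Y \<xi> m \<Longrightarrow> ?ext Y \<eta> m' \<Longrightarrow> y \<in> Y \<Longrightarrow> \<xi> y = \<eta> y" by blast+
  obtain \<xi> m where ext: "?ext Y \<xi> m" using \<open>?P Y\<close> by blast
  note sY = subn_subgroup[OF sn]
  have "Y = E"
  proof (rule ccontr)
    assume "Y \<noteq> E"
    \<comment> \<open>A minimal step above \<open>Y\<close>, which makes the section
      \<open>Z / Y\<close> simple.\<close>
    let ?S = "{Z. subn G E Z \<and> Y \<subset> Z \<and> normalises G Z Y}"
    have "finite ?S"
      by (rule finite_subset[OF _ finite_over]) (use BY in \<open>auto dest: subn_subgroup\<close>)
    moreover obtain Z0 where "Z0 \<in> ?S" using subn_next[OF sn \<open>Y \<noteq> E\<close>] by blast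
    ultimately have "\<exists>Z\<in>?S. Z \<subseteq> Z0 \<and> (\<forall>Z'\<in>?S. Z' \<subseteq> Z \<longrightarrow> Z = Z')" by (rule finite_has_minimal2)
    then obtain Z where "Z \<in> ?S" and Zmin: "\<forall>Z'\<in>?S. Z' \<subseteq> Z \<longrightarrow> Z = Z'" by (elim bexE conjE)
    then have Z: "subn G E Z" "Y \<subset> Z" "normalises G Z Y" by auto
    note sZ = subn_subgroup[OF Z(1)]
    have ZE: "Z \<subseteq> E" by (rule subn_subset[OF Z(1)])
    define L where "L = (G\<lparr>carrier := Z\<rparr>) Mod Y"
    have e0: "epi_ker G Z Y L (\<lambda>x. Y #> x)" unfolding L_def
      by (rule epi_canonical) (use Z sZ sY in auto)
    have oY: "openin T Y" by (rule open_overgroup[OF sB B(2) sY BY])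
    have finY: "finite (rcosets Y)" by (rule open_finite_index[OF sY oY])
    have L: "simple_group L"
    proof (rule simple_quotient_if_maximal[OF e0 sZ _ finY])
      fix M assume M: "subgroup M G" "Y \<subseteq> M" "M \<subseteq> Z" "normalises G Z M"
      show "M = Y \<or> M = Z"
      proof (cases "M = Y")
        case False
        have "subn G E M" by (rule subn.step[OF Z(1) M(1,3,4)])
        moreover have "normalises G M Y" by (rule normalises_mono[OF Z(3) M(3)])
        ultimately show ?thesis using Zmin M False by blast
      qed simp
    qed (use Z in auto)
    have "finite (carrier L)"
    proof -
      have "carrier L \<subseteq> rcosets Y"
        using subgroup.mem_carrier[OF sZ] by (auto simp: L_def carrier_FactGroup RCOSETS_def)
      then show ?thesis using finY finite_subset by blast
    qed
    moreover have "group L" using L by (simp add: simple_group_def)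
    ultimately obtain Q :: "nat monoid" and h where Qh: "group Q" "finite (carrier Q)" "h \<in> iso L Q"
      using ex_nat_copy by blast
    have Q: "simple_group Q" by (rule simple_group.iso_simple[OF L Qh(1,3)])
    have e: "epi_ker G Z Y Q (h \<circ> (\<lambda>x. Y #> x))" by (rule epi_iso[OF e0 Qh(3,1)])
    have "\<not> Q \<cong> integer_mod_group p \<and> (\<exists>n. coprime n p \<and> kills_schur n Q)"
      by (rule simple_section_kills[OF B _ Z(1) e Q BY Qh(2)]) (rule top)
    then obtain n where n: "\<not> Q \<cong> integer_mod_group p" "coprime n p" "kills_schur n Q" by blast
    have invar: "\<xi> (x \<otimes> y \<otimes> inv x) = \<xi> y" if x: "x \<in> Z" and y: "y \<in> Y" for x y
    proof -
      have xc: "x \<in> carrier G" using x subgroup.mem_carrier[OF sZ] by simp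
      have Yc: "y \<in> carrier G" if "y \<in> Y" for y using that subgroup.mem_carrier[OF sY] by simp
      have cj: "x \<otimes> y \<otimes> inv x \<in> Y" if "y \<in> Y" for y using normalisesD[OF Z(3) x that] .
      have "?ext Y (\<lambda>y. \<xi> (x \<otimes> y \<otimes> inv x)) m"
      proof (intro conjI ballI)
        show "char_on G Y (\<lambda>y. \<xi> (x \<otimes> y \<otimes> inv x))"
          unfolding char_on_def
        proof (intro conjI ballI)
          fix a assume a: "a \<in> Y"
          show "\<xi> (x \<otimes> a \<otimes> inv x) \<noteq> 0" by (rule char_on_nonzero[OF conjunct1[OF ext] cj[OF a]])
          fix b assume b: "b \<in> Y"
          have "x \<otimes> (a \<otimes> b) \<otimes> inv x = (x \<otimes> a \<otimes> inv x) \<otimes> (x \<otimes> b \<otimes> inv x)"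
            using xc Yc[OF a] Yc[OF b] by (simp add: group_simps)
          then show "\<xi> (x \<otimes> (a \<otimes> b) \<otimes> inv x) = \<xi> (x \<otimes> a \<otimes> inv x) * \<xi> (x \<otimes> b \<otimes> inv x)"
            using char_on_mult[OF conjunct1[OF ext] cj[OF a] cj[OF b]] by simp
        qed
        show "\<xi> (x \<otimes> b \<otimes> inv x) = \<xi>0 b" if b: "b \<in> B" for b
        proof -
          have "x \<otimes> b \<otimes> inv x \<in> B" using normal_conj[OF B(1) xc b] .
          then show ?thesis using ext inv0[OF _ b] x ZE by auto
        qed
        show "\<xi> (x \<otimes> y \<otimes> inv x) ^ (p ^ m) = 1" if "y \<in> Y" for y using ext cj[OF that] by auto
      qed
      then show ?thesis using uniq[OF _ ext y] by blast
    qed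
    obtain \<eta> m' where eta: "char_on G Z \<eta>" "\<forall>y\<in>Y. \<eta> y = \<xi> y" "\<forall>y\<in>Z. \<eta> y ^ (p ^ m') = 1"
      using char_extend_p_power[OF sZ e Qh(2) n(3,2) p conjunct1[OF ext] _ invar] ext by blast
    have "?P Z"
    proof (intro conjI allI impI ballI)
      show "\<exists>\<xi> m. ?ext Z \<xi> m" using eta ext BY by (intro exI[of _ \<eta>] exI[of _ m']) auto
      fix \<xi>1 \<xi>2 m1 m2 y assume 1: "?ext Z \<xi>1 m1" and 2: "?ext Z \<xi>2 m2" and y: "y \<in> Z"
      have "?ext Y \<xi>1 m1" "?ext Y \<xi>2 m2" using 1 2 Z(2) char_on_subset[of G Z _ Y] by auto
      then have "\<xi>1 y = \<xi>2 y" if "y \<in> Y" for y using uniq that by blast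
      then show "\<xi>1 y = \<xi>2 y"
        using char_unique_step[OF sZ e Q n(1) p, of \<xi>1 m1 \<xi>2 m2 y] 1 2 y by blast
    qed (use Z BY in auto)
    then show False using Ymax[of Z] Z(2) by blast
  qed
  then show ?thesis using ext by blast
qed

text \<open>A topmost \<open>p\<close>-factor inside \<open>E\<close> gives a character of
  \<open>R0\<close> that is invariant under \<open>E\<close>, because \<open>E\<close> centralises
  \<open>R0 / S0\<close>. The common kernel of the conjugates of its extension to \<open>E\<close>
  is a \<open>p\<close>-quotient of \<open>D\<close>, so it contains \<open>E\<close> by leastness;
  but the character is nontrivial on \<open>R0\<close>.\<close>

lemma no_p_chief_in_residual: "class_chief \<C> R S K \<Longrightarrow> R \<subseteq> E \<Longrightarrow> \<not> K \<cong> integer_mod_group p"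
proof
  assume R1: "class_chief \<C> R S K" "R \<subseteq> E" "K \<cong> integer_mod_group p"
  have En: "E \<lhd> G" "E \<subseteq> D" using E by (auto simp: p_quotient_def)
  note sE = normal_imp_subgroup[OF En(1)]
  let ?S = "{S'. S \<subseteq> S' \<and> (\<exists>R K. class_chief \<C> R S' K \<and> R \<subseteq> E \<and> K \<cong> integer_mod_group p)}"
  have S: "S \<lhd> G" "openin T S" using R1 by (auto simp: class_chief_def chief_def)
  have "finite ?S"
    by (rule finite_subset[OF _ finite_open_overgroups[OF normal_imp_subgroup[OF S(1)] S(2)]])
      (auto simp: class_chief_def chief_def normal_imp_subgroup)
  moreover have "S \<in> ?S" using R1 by blast
  ultimately have "\<exists>M\<in>?S. S \<subseteq> M \<and> (\<forall>M'\<in>?S. M \<subseteq> M' \<longrightarrow> M = M')" by (rule finite_has_maximal2)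
  then obtain S0 where "S0 \<in> ?S" and S0max: "\<forall>M'\<in>?S. S0 \<subseteq> M' \<longrightarrow> S0 = M'" by (elim bexE conjE)
  then obtain R0 K0 where c: "class_chief \<C> R0 S0 K0" "R0 \<subseteq> E" "K0 \<cong> integer_mod_group p" "S \<subseteq> S0" by blast
  have R0: "R0 \<lhd> G" "S0 \<lhd> G" "S0 \<subset> R0" "openin T S0" and K0: "K0 \<in> \<C>"
    using c by (auto simp: class_chief_def chief_def)
  note sR0 = normal_imp_subgroup[OF R0(1)] and sS0 = normal_imp_subgroup[OF R0(2)]
  have oR0: "openin T R0" using open_overgroup[OF sS0 R0(4) sR0] R0 by auto
  \<comment> \<open>A \<open>p\<close>-factor above \<open>R0\<close> would have a lower term
    strictly above \<open>S0\<close>, against the maximal choice of \<open>S0\<close>.\<close>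
  have top: "\<not> K' \<cong> integer_mod_group p" if R': "class_chief \<C> R' S' K'" "R' \<subseteq> E" "R0 \<subseteq> S'" for R' S' K'
  proof
    assume "K' \<cong> integer_mod_group p"
    moreover have "S \<subseteq> S'" using R'(3) R0(3) c(4) by auto
    ultimately have "S' \<in> ?S" using R' by auto
    then have "S0 = S'" using S0max R0(3) R'(3) by auto
    then show False using R0(3) R'(3) by auto
  qed
  have gK0: "group K0" using cl K0 by (auto simp: class_of_finite_simple_def simple_group_def)
  obtain k :: nat and \<phi> where "epi_ker G R0 S0 (product_group {..<k} (\<lambda>_. K0)) \<phi>"
    using c by (auto simp: class_chief_def)
  then obtain M where M: "epi_ker G R0 M K0 (\<lambda>x. \<phi> x 0)" "S0 \<subseteq> M"
    using power_epi_coordinate[of R0 S0 k K0 \<phi>] R0 sR0 gK0 by blast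
  obtain h where h: "h \<in> iso K0 (integer_mod_group p)" using c by (auto simp: is_iso_def)
  define \<theta> where "\<theta> = h \<circ> (\<lambda>x. \<phi> x 0)"
  have t: "epi_ker G R0 M (integer_mod_group p) \<theta>"
    unfolding \<theta>_def by (rule epi_iso[OF M(1) h group_integer_mod_group])
  obtain w :: complex where w: "w ^ p = 1" "w \<noteq> 1" using ex_root_of_unity[OF p] by blast
  have p0: "p > 0" "p \<noteq> 1" using prime_gt_0_nat[OF p] prime_gt_1_nat[OF p] by auto
  \<comment> \<open>On \<open>R0\<close> the values of \<open>\<theta>\<close> are integers in
    \<open>{0..<p}\<close>, so \<open>nat\<close> loses nothing, and \<open>w ^ p = 1\<close>
    absorbs the reduction modulo \<open>p\<close>.\<close>
  define \<xi>0 where "\<xi>0 x = w ^ nat (\<theta> x)" for x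
  have wm: "w ^ (n mod p) = w ^ n" for n
  proof -
    have "w ^ n = w ^ (p * (n div p) + n mod p)" by simp
    also have "\<dots> = w ^ (n mod p)" by (simp only: power_add power_mult w(1) power_one mult_1_left)
    finally show ?thesis by simp
  qed
  have "w \<noteq> 0" using w p0 by (auto simp: power_0_left)
  have pos: "0 \<le> \<theta> x" if "x \<in> R0" for x
    using epi_closed[OF t that] p0 by (simp add: carrier_integer_mod_group)
  have ch: "char_on G R0 \<xi>0"
    unfolding char_on_def
  proof (intro conjI ballI)
    fix x y assume x: "x \<in> R0"
    show "\<xi>0 x \<noteq> 0" using \<open>w \<noteq> 0\<close> by (simp add: \<xi>0_def)
    assume y: "y \<in> R0"
    have "nat (\<theta> (x \<otimes> y)) = (nat (\<theta> x) + nat (\<theta> y)) mod p"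
      using epi_mult[OF t x y] pos[OF x] pos[OF y] by (simp add: nat_mod_distrib nat_add_distrib)
    then show "\<xi>0 (x \<otimes> y) = \<xi>0 x * \<xi>0 y" by (simp add: \<xi>0_def wm power_add)
  qed
  have trivS0: "\<xi>0 x = 1" if "x \<in> S0" for x
  proof -
    have "x \<in> R0" "x \<in> M" using that R0(3) M(2) by auto
    then have "\<theta> x = 0" using epi_one_iff[OF t] by simp
    then show ?thesis by (simp add: \<xi>0_def)
  qed
  have inv0: "\<xi>0 (x \<otimes> b \<otimes> inv x) = \<xi>0 b" if x: "x \<in> E" and b: "b \<in> R0" for x b
  proof -
    have c': "x \<in> carrier G" "b \<in> carrier G"
      using x b subgroup.mem_carrier[OF sE] subgroup.mem_carrier[OF sR0] by auto
    have "x \<in> cent_mod R0 S0" using central[OF c(1)] c(2) En x by blast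
    then have "x \<otimes> b \<otimes> inv x \<otimes> inv b \<in> S0" using b by (auto simp: cent_mod_def)
    moreover have "x \<otimes> b \<otimes> inv x = (x \<otimes> b \<otimes> inv x \<otimes> inv b) \<otimes> b" using c' by (simp add: m_assoc)
    ultimately show ?thesis using char_on_mult[OF ch _ b] trivS0 R0(3) by (metis mult_1_left psubsetD)
  qed
  obtain \<xi> m where ext: "char_on G E \<xi>" "\<forall>b\<in>R0. \<xi> b = \<xi>0 b" "\<forall>x\<in>E. \<xi> x ^ (p ^ m) = 1"
  proof -
    have "\<xi>0 b ^ p = (w ^ p) ^ nat (\<theta> b)" for b by (simp add: \<xi>0_def mult.commute flip: power_mult)
    then have "\<xi>0 b ^ p = 1" for b using w(1) by simp
    then have "\<exists>\<xi> m. char_on G E \<xi> \<and> (\<forall>b\<in>R0. \<xi> b = \<xi>0 b) \<and> (\<forall>x\<in>E. \<xi> x ^ (p ^ m) = 1)"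
      by (intro extend_char_to_residual[OF R0(1) oR0 c(2) _ ch _ inv0] top)
    then show ?thesis using that by blast
  qed
  \<comment> \<open>The kernel of \<open>\<xi>\<close> is known to be normal in \<open>E\<close>;
    intersecting its conjugates makes it normal in \<open>G\<close>, as \<open>p_quotient\<close>
    requires.\<close>
  define M' where "M' = {x \<in> E. \<forall>g\<in>carrier G. \<xi> (g \<otimes> x \<otimes> inv g) = 1}"
  have Ec: "x \<in> carrier G" if "x \<in> E" for x using subgroup.mem_carrier[OF sE that] .
  have cj: "g \<otimes> x \<otimes> inv g \<in> E" if "g \<in> carrier G" "x \<in> E" for g x using normal_conj[OF En(1) that] .
  have hom: "\<xi> (g \<otimes> (x \<otimes> y) \<otimes> inv g) = \<xi> (g \<otimes> x \<otimes> inv g) * \<xi> (g \<otimes> y \<otimes> inv g)"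
    if "g \<in> carrier G" "x \<in> E" "y \<in> E" for g x y
  proof -
    have "g \<otimes> (x \<otimes> y) \<otimes> inv g = (g \<otimes> x \<otimes> inv g) \<otimes> (g \<otimes> y \<otimes> inv g)"
      using that Ec by (simp add: group_simps)
    then show ?thesis using char_on_mult[OF ext(1) cj cj] that by simp
  qed
  have sM': "subgroup M' G"
  proof (rule subgroupI)
    show "M' \<subseteq> carrier G" using Ec by (auto simp: M'_def)
    show "M' \<noteq> {}" using subgroup.one_closed[OF sE] char_on_one[OF ext(1) sE] by (auto simp: M'_def intro!: exI[of _ \<one>])
    fix x assume x: "x \<in> M'"
    then have xE: "x \<in> E" by (simp add: M'_def)
    have "\<xi> (g \<otimes> inv x \<otimes> inv g) = 1" if g: "g \<in> carrier G" for g
    proof -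
      have "g \<otimes> inv x \<otimes> inv g = inv (g \<otimes> x \<otimes> inv g)" using g Ec[OF xE] by (simp add: group_simps)
      then show ?thesis using char_on_inv[OF ext(1) sE cj[OF g xE]] x g by (simp add: M'_def)
    qed
    then show "inv x \<in> M'" using subgroup.m_inv_closed[OF sE xE] by (simp add: M'_def)
    fix y assume y: "y \<in> M'"
    then show "x \<otimes> y \<in> M'" using x hom subgroup.m_closed[OF sE] by (simp add: M'_def)
  qed
  have "normalises G (carrier G) M'"
    unfolding normalises_def
  proof (intro ballI)
    fix a x assume a: "a \<in> carrier G" and x: "x \<in> M'"
    then have xE: "x \<in> E" by (simp add: M'_def)
    have "\<xi> (g \<otimes> (a \<otimes> x \<otimes> inv a) \<otimes> inv g) = 1" if g: "g \<in> carrier G" for g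
    proof -
      have "\<xi> ((g \<otimes> a) \<otimes> x \<otimes> inv (g \<otimes> a)) = 1" using x g a by (simp add: M'_def)
      then show ?thesis using xE g a Ec by (simp add: group_simps)
    qed
    then show "a \<otimes> x \<otimes> inv a \<in> M'" using cj[OF a xE] by (simp add: M'_def)
  qed
  then have nM': "M' \<lhd> G" using sM' by (simp add: normal_iff_normalises)
  have "S0 \<subseteq> M'"
  proof
    fix x assume x: "x \<in> S0"
    have "\<xi> (g \<otimes> x \<otimes> inv g) = 1" if g: "g \<in> carrier G" for g
      using normal_conj[OF R0(2) g x] ext(2) trivS0 R0(3) by auto
    then show "x \<in> M'" using x R0(3) c(2) by (auto simp: M'_def)
  qed
  then have "openin T M'" using open_overgroup[OF sS0 R0(4) sM'] by blast
  moreover have "\<exists>k::nat. d [^] (p ^ k) \<in> M'" if d: "d \<in> D" for d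
  proof -
    obtain k :: nat where k: "d [^] (p ^ k) \<in> E" using E d by (auto simp: p_quotient_def)
    let ?x = "d [^] (p ^ k)"
    have dc: "d \<in> carrier G" using subgroup.mem_carrier[OF normal_imp_subgroup[OF D(1)] d] .
    have "\<xi> (g \<otimes> (?x [^] (p ^ m)) \<otimes> inv g) = 1" if g: "g \<in> carrier G" for g
    proof -
      have "\<xi> (g \<otimes> (?x [^] j) \<otimes> inv g) = \<xi> (g \<otimes> ?x \<otimes> inv g) ^ j" for j :: nat
      proof (induction j)
        case 0
        then show ?case using g char_on_one[OF ext(1) sE] by simp
      next
        case (Suc j)
        then show ?case using hom[OF g nat_pow_mem[OF sE k] k] by simp
      qed
      then show ?thesis using ext(3) cj[OF g k] by simp
    qed
    then have "?x [^] (p ^ m) \<in> M'" using nat_pow_mem[OF sE k] by (simp add: M'_def)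
    then have "d [^] (p ^ (k + m)) \<in> M'" using dc by (simp add: nat_pow_pow power_add)
    then show ?thesis by blast
  qed
  ultimately have "p_quotient D p M'"
    using nM' En unfolding p_quotient_def by (auto simp: M'_def)
  then have EM: "E \<subseteq> M'" by (rule Emin)
  \<comment> \<open>An element of \<open>R0\<close> mapped to the generator 1 has
    \<open>\<xi> x = w\<close>, which is not 1.\<close>
  have "1 \<in> carrier (integer_mod_group p)" using p0 by simp
  then have "1 \<in> \<theta> ` R0" unfolding epi_image[OF t] .
  then obtain x where x: "x \<in> R0" "\<theta> x = 1" by auto
  have xM: "x \<in> M'" using x c(2) EM by blast
  have xc: "x \<in> carrier G" using x subgroup.mem_carrier[OF sR0] by simp
  have "\<xi> (\<one> \<otimes> x \<otimes> inv \<one>) = 1" using xM one_closed unfolding M'_def by blast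
  then have "\<xi> x = 1" using xc by simp
  then show False using ext(2) x w by (simp add: \<xi>0_def)
qed

end

end

end

section \<open>Critical pairs with small centraliser\<close>

lemma (in group) coprime_pow_mem:
  assumes H: "subgroup H G" and d: "d \<in> carrier G" and "d [^] (a::nat) \<in> H" "d [^] (b::nat) \<in> H" "coprime a b"
  shows "d \<in> H"
proof (cases "b = 1")
  case True
  then show ?thesis using assms by simp
next
  case False
  then obtain x y where xy: "a * x = b * y + 1" using coprime_bezout_nat assms by blast
  have mem: "(d [^] n) [^] (k::nat) \<in> H" if "d [^] n \<in> H" for n k :: nat
    using that by (induction k) (auto simp: subgroup.one_closed[OF H] subgroup.m_closed[OF H])
  have "d [^] (a * x) \<in> H" "d [^] (b * y) \<in> H" using mem[OF assms(3), of x] mem[OF assms(4), of y] d by (simp_all add: nat_pow_pow)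
  moreover have "d = inv (d [^] (b * y)) \<otimes> d [^] (a * x)" unfolding xy using d by (simp add: inv_mult_cancel)
  ultimately show ?thesis using subgroup.m_closed[OF H] subgroup.m_inv_closed[OF H] by metis
qed

context profinite
begin

text \<open>The second isomorphism theorem: restricted to \<open>R'\<close>, the map is still
  onto.\<close>

lemma epi_image_complement:
  assumes e: "epi_ker G R S Q \<phi>" and R: "subgroup R G" and R': "R' \<subseteq> R" "R' <#> S = R"
  shows "epi_ker G R' (R' \<inter> S) Q \<phi>"
proof (rule epi_restrict[OF e R'(1)])
  interpret Q: group Q by (rule epi_group[OF e])
  have "\<phi> x \<in> \<phi> ` R'" if "x \<in> R" for x
  proof -
    have "x \<in> R' <#> S" using that R'(2) by simp
    then obtain r s where rs: "r \<in> R'" "s \<in> S" "x = r \<otimes> s" by (auto simp: set_mult_def)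
    then have "r \<in> R" "s \<in> R" using R'(1) epi_ker_subset[OF e] by auto
    then have "\<phi> x = \<phi> r" using epi_mult[OF e] epi_one_iff[OF e] epi_closed[OF e] rs by simp
    then show ?thesis using rs by blast
  qed
  then show "\<phi> ` R' = carrier Q" using R'(1) unfolding epi_image[OF e, symmetric] by blast
qed

definition class_section :: "nat monoid set \<Rightarrow> 'a set \<Rightarrow> 'a set \<Rightarrow> bool" where
  "class_section \<C> R S \<longleftrightarrow> critical_pair G T R S \<and> openin T S \<and>
     (\<exists>K\<in>\<C>. \<exists>(k::nat) \<phi>. epi_ker G R S (product_group {..<k} (\<lambda>_. K)) \<phi>)"

context
  fixes \<C> :: "nat monoid set"
  assumes ji: "ji_under (carrier G)" and cl: "class_of_finite_simple \<C>" and st: "condition_starstar G T \<C>"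
    and nv: "\<And>p. Factorial_Ring.prime p \<Longrightarrow> \<not> virtually_pro_p G T p"
begin

text \<open>To exploit the trivial intersection, omit one prime \<open>p\<close> for which
  \<open>E p\<close> is not \<open>D\<close>. The rest still intersects trivially, because a
  nontrivial closed normal subgroup is open and would meet the open \<open>E p\<close> nontrivially.
  By compactness finitely many of the other \<open>E q\<close>, together with \<open>D\<close>,
  intersect inside \<open>E p\<close>, so every element of \<open>D\<close> has two powers of
  coprime exponents in \<open>E p\<close>.\<close>

lemma not_all_class_chief_central:
  assumes D: "D \<lhd> G" "openin T D"
    and central: "\<And>R S K. class_chief \<C> R S K \<Longrightarrow> R \<subseteq> D \<Longrightarrow> D \<subseteq> cent_mod R S"
  shows False
proof -
  note sD = normal_imp_subgroup[OF D(1)]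
  let ?p = "{p. Factorial_Ring.prime p \<and> in_class (integer_mod_group p) \<C>}"
  have "\<forall>p\<in>?p. \<exists>E. p_quotient D p E \<and> (\<forall>M. p_quotient D p M \<longrightarrow> E \<subseteq> M)"
    by (intro ballI ex_least_p_quotient[OF ji D]) (use nv in auto)
  from bchoice[OF this] obtain E where
    "\<forall>p\<in>?p. p_quotient D p (E p) \<and> (\<forall>M. p_quotient D p M \<longrightarrow> E p \<subseteq> M)" by (rule exE)
  then have E: "\<And>p. p \<in> ?p \<Longrightarrow> p_quotient D p (E p)"
    "\<And>p M. p \<in> ?p \<Longrightarrow> p_quotient D p M \<Longrightarrow> E p \<subseteq> M" by blast+
  have type: "\<exists>q\<in>?p. \<not> R \<subseteq> E q" if c: "class_chief \<C> R S K" "R \<subseteq> D" for R S K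
  proof -
    have K: "K \<in> \<C>" using c by (simp add: class_chief_def)
    then have sK: "simple_group K" "finite (carrier K)" using cl by (auto simp: class_of_finite_simple_def)
    interpret K: group K using sK by (simp add: simple_group_def)
    have "u \<otimes>\<^bsub>K\<^esub> v = v \<otimes>\<^bsub>K\<^esub> u" if "u \<in> carrier K" "v \<in> carrier K" for u v
      by (rule class_chief_comm[OF ji cl st D _ c that]) (rule central)
    then obtain q where q: "Factorial_Ring.prime q" "K \<cong> integer_mod_group q"
      using K.simple_comm_ex_prime[OF sK(1) _ sK(2)] by blast
    then have "integer_mod_group q \<cong> K" using K.iso_sym by blast
    then have qp: "q \<in> ?p" using q K by (auto simp: in_class_def)
    moreover have "\<not> R \<subseteq> E q"
    proof
      assume "R \<subseteq> E q"
      then have "\<not> K \<cong> integer_mod_group q"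
        using no_p_chief_in_residual[OF ji cl st D _ q(1) _ E(1)[OF qp] _ c(1)] qp central E(2)[OF qp] by blast
      then show False using q by simp
    qed
    ultimately show ?thesis by blast
  qed
  have inv: "invsub (carrier G) (E p)" and oE: "openin T (E p)" and ED: "E p \<subseteq> D" and sE: "subgroup (E p) G" if "p \<in> ?p" for p
    using E(1)[OF that] by (auto simp: p_quotient_def normal_iff_normalises intro!: invsub_openI)
  have invD: "invsub (carrier G) D" using D by (auto simp: normal_iff_normalises intro!: invsub_openI)
  have triv: "D \<inter> \<Inter>(E ` ?p) = {\<one>}"
  proof (rule ccontr)
    assume ne: "D \<inter> \<Inter>(E ` ?p) \<noteq> {\<one>}"
    have i: "invsub (carrier G) (D \<inter> \<Inter>(E ` ?p))"
      using invsub_Inter[of "insert D (E ` ?p)" "carrier G"] inv invD by auto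
    then have "openin T (D \<inter> \<Inter>(E ` ?p))" by (rule ji_open[OF ji _ ne])
    moreover have "D \<inter> \<Inter>(E ` ?p) \<lhd> G" using i by (simp add: invsub_def normal_iff_normalises)
    ultimately obtain R S K where "class_chief \<C> R S K" "R \<subseteq> D \<inter> \<Inter>(E ` ?p)"
      using ex_class_chief_below[OF st cl] by blast
    then show False using type by blast
  qed
  obtain R S K where "class_chief \<C> R S K" "R \<subseteq> D" using ex_class_chief_below[OF st cl D] by blast
  then obtain p where p: "p \<in> ?p" "\<not> R \<subseteq> E p" using type by blast
  let ?q = "?p - {p}"
  let ?Y = "D \<inter> \<Inter>(E ` ?q)"
  have "?Y = {\<one>}"
  proof (rule ccontr)
    assume ne: "?Y \<noteq> {\<one>}"
    have "invsub (carrier G) ?Y"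
      using invsub_Inter[of "insert D (E ` ?q)" "carrier G"] inv invD by auto
    then have "openin T (?Y \<inter> E p)" using ji_open[OF ji _ ne] oE[OF p(1)] by blast
    moreover have "?Y \<inter> E p = D \<inter> \<Inter>(E ` ?p)" using p(1) by auto
    ultimately show False using triv ji_not_open_one[OF ji] by metis
  qed
  then have "carrier G \<inter> \<Inter>(insert D (E ` ?q)) \<subseteq> E p" using subgroup.one_closed[OF sE[OF p(1)]] by auto
  moreover have "closedin T C" if "C \<in> insert D (E ` ?q)" for C
    using that inv invD invsubD(2) by blast
  ultimately obtain \<G> where G: "finite \<G>" "\<G> \<subseteq> insert D (E ` ?q)" "carrier G \<inter> \<Inter>\<G> \<subseteq> E p"
    using compact_Inter[of "insert D (E ` ?q)" "E p"] oE[OF p(1)] by blast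
  have "D \<subseteq> E p"
  proof
    fix d assume d: "d \<in> D"
    have dc: "d \<in> carrier G" by (rule subgroup.mem_carrier[OF sD d])
    \<comment> \<open>\<open>m\<close> is a product of powers of the other primes that occur in the
      finite family; the member \<open>D\<close> can be served by the exponent 1.\<close>
    have "\<exists>m::nat. coprime m p \<and> (\<forall>H\<in>\<G>. d [^] m \<in> H)" using G(1,2)
    proof (induction \<G>)
      case empty
      then show ?case by (intro exI[of _ 1]) auto
    next
      case (insert H \<G>)
      then obtain m :: nat where m: "coprime m p" "\<And>H. H \<in> \<G> \<Longrightarrow> d [^] m \<in> H" by auto
      have "\<exists>j::nat. coprime j p \<and> subgroup H G \<and> d [^] j \<in> H"
      proof (cases "H = D")
        case True
        then show ?thesis using d sD dc by (intro exI[of _ 1]) auto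
      next
        case False
        then obtain q where q: "q \<in> ?q" "H = E q" using insert(4) by auto
        then obtain j :: nat where "d [^] (q ^ j) \<in> H" using E(1)[of q] d by (auto simp: p_quotient_def)
        moreover have "coprime (q ^ j) p" using primes_coprime[of q p] q p by auto
        ultimately show ?thesis using q sE by blast
      qed
      then obtain j :: nat where j: "coprime j p" "subgroup H G" "d [^] j \<in> H" by blast
      have "d [^] (m * j) \<in> H" using nat_pow_mem[OF j(2,3), of m] dc by (simp add: nat_pow_pow mult.commute)
      moreover have "d [^] (m * j) \<in> H'" if "H' \<in> \<G>" for H'
      proof -
        have "subgroup H' G" using that insert(4) sD sE by auto
        then show ?thesis using nat_pow_mem[OF _ m(2)[OF that], of j] dc by (simp add: nat_pow_pow)
      qed
      moreover have "coprime (m * j) p" using m j by simp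
      ultimately show ?case by blast
    qed
    then obtain m :: nat where m: "coprime m p" "\<forall>H\<in>\<G>. d [^] m \<in> H" by blast
    then have "d [^] m \<in> E p" using G(3) dc by auto
    moreover obtain k :: nat where "d [^] (p ^ k) \<in> E p" using E(1)[OF p(1)] d by (auto simp: p_quotient_def)
    ultimately show "d \<in> E p" using coprime_pow_mem[OF sE[OF p(1)] dc] m(1) by simp
  qed
  then show False using p \<open>R \<subseteq> D\<close> by blast
qed

text \<open>Obliquity is applied with \<open>A\<close> the whole group and the open set
  \<open>W\<close>: a centraliser not inside \<open>W\<close> contains \<open>D0\<close>. Chief
  factors are first traded for critical pairs with the same quotient, and what centralises
  \<open>R' / (R' \<inter> S)\<close> and normalises \<open>S\<close> also centralises
  \<open>R / S\<close>, as \<open>R = R' S\<close>.\<close>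

lemma ex_class_section:
  assumes W: "W \<lhd> G" "openin T W"
  shows "\<exists>R S. class_section \<C> R S \<and> R \<subseteq> W \<and> cent_mod R S \<subseteq> W"
proof (rule ccontr)
  assume no: "\<not> ?thesis"
  have oneW: "\<one> \<in> W" using subgroup.one_closed[OF normal_imp_subgroup[OF W(1)]] .
  obtain D0 where D0: "D0 \<lhd> G" "openin T D0" "\<And>H. invsub (carrier G) H \<and> \<not> H \<subseteq> W \<Longrightarrow> D0 \<subseteq> H"
    using obliquity[OF ji W(2) oneW] by blast
  let ?D = "D0 \<inter> W"
  show False
  proof (rule not_all_class_chief_central[of ?D])
    show "?D \<lhd> G" using D0 W by (simp add: normal_subgroup_intersect)
    show "openin T ?D" using D0 W by blast
    fix R S K assume c: "class_chief \<C> R S K" "R \<subseteq> ?D"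
    have ch: "chief G R S" "openin T S" and K: "K \<in> \<C>" using c by (auto simp: class_chief_def)
    obtain k :: nat and \<phi> where e: "epi_ker G R S (product_group {..<k} (\<lambda>_. K)) \<phi>" using c by (auto simp: class_chief_def)
    have R: "R \<lhd> G" "S \<lhd> G" using ch by (auto simp: chief_def)
    obtain R' where R': "critical_pair G T R' (R' \<inter> S)" "R' \<subseteq> R" "R' <#> S = R" "openin T R'"
      using chief_to_critical[OF ji ch] by blast
    have e': "epi_ker G R' (R' \<inter> S) (product_group {..<k} (\<lambda>_. K)) \<phi>"
      by (rule epi_image_complement[OF e normal_imp_subgroup[OF R(1)] R'(2,3)])
    have "openin T (R' \<inter> S)" using R' ch by blast
    then have cs: "class_section \<C> R' (R' \<inter> S)" using R'(1) e' K unfolding class_section_def by blast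
    moreover have "R' \<subseteq> W" using R'(2) c(2) by auto
    ultimately have "\<not> cent_mod R' (R' \<inter> S) \<subseteq> W" using no by blast
    moreover have "invsub (carrier G) (cent_mod R' (R' \<inter> S))"
      using cent_mod_closed_normal R'(1) unfolding critical_pair_def closed_normal_iff_invsub[symmetric]
      by (auto simp: closed_normal_def)
    ultimately have sub: "D0 \<subseteq> cent_mod R' (R' \<inter> S)" using D0(3) by blast
    show "?D \<subseteq> cent_mod R S"
    proof
      fix d assume d: "d \<in> ?D"
      then have dc: "d \<in> carrier G" using sub by (auto simp: cent_mod_def)
      have "d \<otimes> x \<otimes> inv d \<otimes> inv x \<in> S" if "x \<in> R" for x
      proof -
        have "x \<in> R' <#> S" using that R'(3) by simp
        then obtain r s where rs: "r \<in> R'" "s \<in> S" "x = r \<otimes> s" by (auto simp: set_mult_def)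
        note sS = normal_imp_subgroup[OF R(2)]
        have c': "r \<in> carrier G" "s \<in> carrier G"
          using rs R'(2) subgroup.mem_carrier[OF normal_imp_subgroup[OF R(1)]] subgroup.mem_carrier[OF sS] by auto
        have "d \<otimes> r \<otimes> inv d \<otimes> inv r \<in> S" using sub d rs by (auto simp: cent_mod_def)
        moreover have "d \<otimes> s \<otimes> inv d \<otimes> inv s \<in> S"
          using normal_conj[OF R(2) dc rs(2)] rs(2) subgroup.m_closed[OF sS] subgroup.m_inv_closed[OF sS] by blast
        then have "r \<otimes> (d \<otimes> s \<otimes> inv d \<otimes> inv s) \<otimes> inv r \<in> S" using normal_conj[OF R(2) c'(1)] by blast
        \<comment> \<open>The commutator identity
          \<open>[d, r s] = [d, r] (r [d, s] r^-1)\<close>.\<close>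
        ultimately have "(d \<otimes> r \<otimes> inv d \<otimes> inv r) \<otimes> (r \<otimes> (d \<otimes> s \<otimes> inv d \<otimes> inv s) \<otimes> inv r) \<in> S"
          using subgroup.m_closed[OF sS] by blast
        then show ?thesis using rs(3) c' dc by (simp add: group_simps)
      qed
      then show "d \<in> cent_mod R S" using dc by (simp add: cent_mod_def)
    qed
  qed
qed

text \<open>An element of an abelian \<open>A\<close> centralises every section inside
  \<open>A\<close>; but some section there has its centraliser inside an open normal subgroup that
  misses the element.\<close>

lemma open_normal_not_commutative:
  assumes A: "A \<lhd> G" "openin T A"
  shows "\<exists>x\<in>A. \<exists>y\<in>A. x \<otimes> y \<noteq> y \<otimes> x"
proof (rule ccontr)
  assume "\<not> ?thesis"
  then have comm: "x \<otimes> y = y \<otimes> x" if "x \<in> A" "y \<in> A" for x y using that by blast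
  note sA = normal_imp_subgroup[OF A(1)]
  have "A \<noteq> {\<one>}" using ji_not_open_one[OF ji A(2)] .
  then obtain x where x: "x \<in> A" "x \<noteq> \<one>" using subgroup.one_closed[OF sA] by blast
  then obtain N where N: "N \<lhd> G" "openin T N" "x \<notin> N" using ex_open_normal_notin subgroup.mem_carrier[OF sA] by blast
  have "N \<inter> A \<lhd> G" "openin T (N \<inter> A)" using N A by (auto simp: normal_subgroup_intersect)
  then obtain R S where RS: "class_section \<C> R S" "R \<subseteq> N \<inter> A" "cent_mod R S \<subseteq> N \<inter> A"
    using ex_class_section by blast
  have "S \<lhd> G" using RS(1) by (auto simp: class_section_def critical_pair_def closed_normal_def)
  have "x \<otimes> r \<otimes> inv x \<otimes> inv r \<in> S" if "r \<in> R" for r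
  proof -
    have "r \<in> A" using that RS by auto
    then have "x \<otimes> r = r \<otimes> x" "r \<in> carrier G" "x \<in> carrier G" using comm x subgroup.mem_carrier[OF sA] by auto
    then have "x \<otimes> r \<otimes> inv x \<otimes> inv r = \<one>" by (simp add: m_assoc)
    then show ?thesis using subgroup.one_closed[OF normal_imp_subgroup[OF \<open>S \<lhd> G\<close>]] by simp
  qed
  then have "x \<in> cent_mod R S" using x subgroup.mem_carrier[OF sA] by (simp add: cent_mod_def)
  then show False using RS N by blast
qed

text \<open>\<open>H\<close> need not lie in \<open>A\<close>, so the hereditary property is applied
  to \<open>H \<inter> A\<close>. If that were trivial, \<open>H\<close> and \<open>A\<close> would
  commute, the centraliser of \<open>A\<close> would be nontrivial and hence open, and it would meet
  \<open>A\<close> in an open abelian normal subgroup.\<close>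

lemma hereditary_ji_under:
  assumes hji: "hereditarily_just_infinite G T" and A: "A \<lhd> G" "openin T A"
  shows "ji_under A"
  unfolding ji_under_def
proof (intro conjI allI impI)
  note sA = normal_imp_subgroup[OF A(1)]
  have AG: "A \<subseteq> carrier G" using subgroup.subset[OF sA] .
  show "\<not> openin T {\<one>}" using ji_not_open_one[OF ji] by blast
  fix H assume H: "invsub A H" "H \<noteq> {\<one>}"
  note sH = invsubD(1)[OF H(1)]
  have sHA: "subgroup (H \<inter> A) G" using sH sA subgroups_Inter_pair by blast
  have "H \<inter> A \<noteq> {\<one>}"
  proof
    assume triv: "H \<inter> A = {\<one>}"
    have one: "{\<one>} \<lhd> G" "closedin T {\<one>}" using one_is_normal closedin_singleton by auto
    let ?C = "cent_mod A {\<one>}"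
    have "h \<in> ?C" if h: "h \<in> H" for h
      unfolding cent_mod_def
    proof (intro CollectI conjI ballI)
      show hc: "h \<in> carrier G" using subgroup.mem_carrier[OF sH h] .
      fix a assume a: "a \<in> A"
      have ac: "a \<in> carrier G" using a AG by auto
      \<comment> \<open>The commutator is read in two ways: it lies in \<open>A\<close> because
        \<open>A\<close> is normal, and in \<open>H\<close> because \<open>A\<close> normalises
        \<open>H\<close>.\<close>
      have "(h \<otimes> a \<otimes> inv h) \<otimes> inv a \<in> A"
        using normal_conj[OF A(1) hc a] a subgroup.m_closed[OF sA] subgroup.m_inv_closed[OF sA] by blast
      moreover have "h \<otimes> (a \<otimes> inv h \<otimes> inv a) \<in> H"
        using normalisesD[OF invsubD(3)[OF H(1)] a subgroup.m_inv_closed[OF sH h]] h subgroup.m_closed[OF sH] by blast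
      then have "(h \<otimes> a \<otimes> inv h) \<otimes> inv a \<in> H" using hc ac by (simp add: m_assoc)
      ultimately show "h \<otimes> a \<otimes> inv h \<otimes> inv a \<in> {\<one>}" using triv by blast
    qed
    then have ne: "?C \<noteq> {\<one>}" using H subgroup.one_closed[OF sH] by blast
    have C: "invsub (carrier G) ?C" using cent_mod_closed_normal[OF A(1) one] by (simp add: closed_normal_iff_invsub)
    then have "openin T ?C" using ji_open[OF ji _ ne] by blast
    then have "openin T (?C \<inter> A)" using A by blast
    moreover have "?C \<inter> A \<lhd> G"
      using C A by (auto simp: invsub_def normal_iff_normalises subgroups_Inter_pair normalises_Int)
    ultimately obtain x y where xy: "x \<in> ?C \<inter> A" "y \<in> ?C \<inter> A" "x \<otimes> y \<noteq> y \<otimes> x"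
      using open_normal_not_commutative by blast
    have c: "x \<in> carrier G" "y \<in> carrier G" using xy AG by auto
    have "x \<otimes> y \<otimes> inv x \<otimes> inv y = \<one>" using xy by (auto simp: cent_mod_def)
    then have "x \<otimes> y \<otimes> inv x \<otimes> inv y \<otimes> (y \<otimes> x) = y \<otimes> x" using c by simp
    then show False using xy(3) c by (simp add: group_simps)
  qed
  moreover have "just_infinite (G\<lparr>carrier := A\<rparr>) (subtopology T A)"
    using hji sA A(2) by (simp add: hereditarily_just_infinite_def)
  moreover have "closed_normal (G\<lparr>carrier := A\<rparr>) (subtopology T A) (H \<inter> A)"
  proof -
    interpret A: group "G\<lparr>carrier := A\<rparr>" by (rule subgroup_imp_group[OF sA])
    have "subgroup (H \<inter> A) (G\<lparr>carrier := A\<rparr>)" using subgroup_incl[OF sHA sA] by simp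
    moreover have "normalises G A (H \<inter> A)"
      by (intro normalises_Int invsubD(3)[OF H(1)] subgroup_normalises_self[OF sA])
    then have "normalises (G\<lparr>carrier := A\<rparr>) A (H \<inter> A)"
      using m_inv_consistent[OF sA] by (simp add: normalises_def)
    ultimately show ?thesis
      using invsubD(2)[OF H(1)] by (auto simp: closed_normal_def A.normal_iff_normalises closedin_subtopology)
  qed
  ultimately have fin: "finite (rcosets\<^bsub>G\<lparr>carrier := A\<rparr>\<^esub> (H \<inter> A))" "closedin (subtopology T A) (H \<inter> A)"
    "subgroup (H \<inter> A) (G\<lparr>carrier := A\<rparr>)"
    by (auto simp: just_infinite_def closed_normal_def normal_imp_subgroup)
  interpret A: profinite "G\<lparr>carrier := A\<rparr>" "subtopology T A"
    using subgroup_imp_group[OF sA] profinite_open_subgroup[OF sA A(2)]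
    by (simp add: profinite_def profinite_axioms_def)
  have "openin (subtopology T A) (H \<inter> A)" by (rule A.finite_index_open[OF fin(3,2,1)])
  then have "openin T (H \<inter> A)" using A(2) by (simp add: openin_open_subtopology)
  then show "openin T H" using open_overgroup[OF sHA _ sH] by blast
qed (use A in auto)

end

end

section \<open>Quotients and the inverse limit\<close>

lemma (in group) normal_restrict_iff:
  assumes "subgroup A G"
  shows "M \<lhd> G\<lparr>carrier := A\<rparr> \<longleftrightarrow> subgroup M G \<and> M \<subseteq> A \<and> normalises G A M"
proof -
  interpret A: group "G\<lparr>carrier := A\<rparr>" by (rule subgroup_imp_group[OF assms])
  have "subgroup M (G\<lparr>carrier := A\<rparr>) \<longleftrightarrow> subgroup M G \<and> M \<subseteq> A"
    using subgroup_incl[OF _ assms] incl_subgroup[OF assms] subgroup.subset[of M "G\<lparr>carrier := A\<rparr>"] by auto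
  moreover have "normalises (G\<lparr>carrier := A\<rparr>) A M \<longleftrightarrow> normalises G A M"
    using m_inv_consistent[OF assms] by (simp add: normalises_def)
  ultimately show ?thesis unfolding A.normal_iff_normalises by auto
qed

context profinite
begin

lemma quot_top_discrete:
  assumes "openin T N"
  shows "quot_top G T N = discrete_topology (rcosets N)"
proof -
  have "openin T (\<Union>U)" if U: "U \<subseteq> rcosets N" for U
  proof (rule openin_Union)
    fix C assume "C \<in> U"
    then obtain a where "a \<in> carrier G" "C = N #> a" using U by (auto simp: RCOSETS_def)
    then show "openin T C" using openin_r_coset[OF assms] by simp
  qed
  then have "(\<lambda>U. U \<subseteq> rcosets N \<and> openin T (\<Union>U)) = (\<lambda>U. U \<subseteq> rcosets N)" by (auto simp: fun_eq_iff)
  then show ?thesis unfolding quot_top_def discrete_topology_def by simp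
qed

section \<open>The correspondence theorem for an open normal subgroup\<close>

context
  fixes N assumes N: "N \<lhd> G" "openin T N"
begin

abbreviation (input) "proj \<equiv> (\<lambda>x. N #> x)"

lemma quo_epi: "epi_ker G (carrier G) N (G Mod N) proj"
  using epi_canonical[OF subgroup_self normal_imp_subgroup[OF N(1)] subgroup.subset[OF normal_imp_subgroup[OF N(1)]]] N
  by (simp add: normal_iff_normalises)

lemma quo_group: "group (G Mod N)"
  by (rule epi_group[OF quo_epi])

lemma closedin_quo: "closedin (quot_top G T N) V \<longleftrightarrow> V \<subseteq> carrier (G Mod N)"
  by (simp add: quot_top_discrete[OF N(2)] FactGroup_def)

definition preimg :: "'a set set \<Rightarrow> 'a set" where
  "preimg V = {x \<in> carrier G. N #> x \<in> V}"

lemma proj_preimg: "V \<subseteq> carrier (G Mod N) \<Longrightarrow> proj ` preimg V = V"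
  by (auto simp: preimg_def carrier_FactGroup)

lemma preimg_proj:
  assumes "subgroup A G" "N \<subseteq> A"
  shows "preimg (proj ` A) = A"
proof (intro equalityI subsetI)
  fix x assume "x \<in> preimg (proj ` A)"
  then obtain a where a: "a \<in> A" "x \<in> carrier G" "N #> x = N #> a" by (auto simp: preimg_def)
  have ac: "a \<in> carrier G" using a subgroup.mem_carrier[OF assms(1)] by auto
  have "x \<otimes> inv a \<in> A" using epi_eq_iff[OF quo_epi subgroup_self a(2) ac] a(3) assms(2) by auto
  then have "(x \<otimes> inv a) \<otimes> a \<in> A" using subgroup.m_closed[OF assms(1)] a by blast
  then show "x \<in> A" using a ac by (simp add: m_assoc)
qed (use subgroup.mem_carrier[OF assms(1)] in \<open>auto simp: preimg_def\<close>)

lemma preimg_mono: "V \<subseteq> W \<Longrightarrow> preimg V \<subseteq> preimg W"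
  by (auto simp: preimg_def)

lemma preimg_subgroup:
  assumes V: "subgroup V (G Mod N)"
  shows "subgroup (preimg V) G" "N \<subseteq> preimg V" "openin T (preimg V)"
proof -
  note cl = subgroup.m_closed[OF V] subgroup.m_inv_closed[OF V]
  have sN: "subgroup N G" using normal_imp_subgroup[OF N(1)] .
  show s: "subgroup (preimg V) G"
  proof (rule subgroupI)
    show "preimg V \<noteq> {}"
      using subgroup.one_closed[OF V] epi_one[OF quo_epi subgroup_self] by (auto simp: preimg_def intro!: exI[of _ \<one>])
  qed (auto simp: preimg_def cl cl[unfolded mult_FactGroup] epi_mult[OF quo_epi] epi_inv[OF quo_epi subgroup_self])
  show n: "N \<subseteq> preimg V"
  proof
    fix x assume x: "x \<in> N"
    then have xc: "x \<in> carrier G" by (rule subgroup.mem_carrier[OF sN])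
    then have "N #> x = \<one>\<^bsub>G Mod N\<^esub>" using epi_one_iff[OF quo_epi] x by blast
    then show "x \<in> preimg V" using subgroup.one_closed[OF V] xc by (simp add: preimg_def)
  qed
  show "openin T (preimg V)" by (rule open_overgroup[OF sN N(2) s n])
qed

lemma proj_subgroup: "subgroup A G \<Longrightarrow> subgroup (proj ` A) (G Mod N)"
  using epi_image_subgroup[OF quo_epi subgroup_self] subgroup.subset by blast

lemma proj_normalises: "A \<subseteq> carrier G \<Longrightarrow> B \<subseteq> carrier G \<Longrightarrow> normalises G A B \<Longrightarrow> normalises (G Mod N) (proj ` A) (proj ` B)"
  using epi_image_normalises[OF quo_epi subgroup_self] by blast

lemma preimg_normalises:
  assumes "normalises (G Mod N) (proj ` A) V" "A \<subseteq> carrier G"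
  shows "normalises G A (preimg V)"
  unfolding normalises_def
proof (intro ballI)
  fix a x assume a: "a \<in> A" and x: "x \<in> preimg V"
  then have c: "a \<in> carrier G" "x \<in> carrier G" using assms by (auto simp: preimg_def)
  have "N #> (a \<otimes> x \<otimes> inv a) = (N #> a) \<otimes>\<^bsub>G Mod N\<^esub> (N #> x) \<otimes>\<^bsub>G Mod N\<^esub> inv\<^bsub>G Mod N\<^esub> (N #> a)"
    by (rule epi_conj[OF quo_epi subgroup_self c])
  also have "\<dots> \<in> V" by (rule normalisesD[OF assms(1)]) (use a x in \<open>auto simp: preimg_def\<close>)
  finally show "a \<otimes> x \<otimes> inv a \<in> preimg V" using c by (simp add: preimg_def)
qed

lemma proj_carrier: "proj ` carrier G = carrier (G Mod N)"
  by (rule epi_image[OF quo_epi])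

lemma quo_closed_normal_iff: "closed_normal (G Mod N) (quot_top G T N) V \<longleftrightarrow> V \<lhd> G Mod N"
  using normal_imp_subgroup[THEN subgroup.subset] by (auto simp: closed_normal_def closedin_quo)

lemma quo_normal_proj:
  assumes "A \<lhd> G"
  shows "proj ` A \<lhd> G Mod N"
  using proj_subgroup[OF normal_imp_subgroup[OF assms]]
    proj_normalises[of "carrier G" A] subgroup.subset[OF normal_imp_subgroup[OF assms]] assms
  unfolding group.normal_iff_normalises[OF quo_group] normal_iff_normalises proj_carrier by blast

lemma quo_normal_preimg: "V \<lhd> G Mod N \<Longrightarrow> closed_normal G T (preimg V)"
  using group.normal_iff_normalises[OF quo_group] preimg_subgroup[of V] preimg_normalises[of "carrier G" V] proj_carrier
  by (auto simp: closed_normal_iff_invsub intro!: invsub_openI)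

lemma quo_critical_pair:
  assumes cp: "critical_pair G T A B" and NB: "N \<subseteq> B"
  shows "critical_pair (G Mod N) (quot_top G T N) (proj ` A) (proj ` B)"
proof -
  have A: "A \<lhd> G" and B: "B \<lhd> G" "B \<subset> A" using cp by (auto simp: critical_pair_def closed_normal_def)
  note sA = normal_imp_subgroup[OF A] and sB = normal_imp_subgroup[OF B(1)]
  have pA: "preimg (proj ` A) = A" and pB: "preimg (proj ` B) = B"
    using preimg_proj[OF sA] preimg_proj[OF sB] NB B by auto
  show ?thesis
    unfolding critical_pair_def quo_closed_normal_iff
  proof (intro conjI allI impI)
    show "proj ` B \<subset> proj ` A" using B pA pB by (metis image_mono psubset_eq)
    fix V assume V: "V \<lhd> G Mod N \<and> V \<subset> proj ` A"
    then have Vc: "V \<subseteq> carrier (G Mod N)" using normal_imp_subgroup[THEN subgroup.subset] by blast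
    have "preimg V \<subseteq> A" using preimg_mono[of V "proj ` A"] V pA by auto
    moreover have "preimg V \<noteq> A" using proj_preimg[OF Vc] V by auto
    ultimately have "preimg V \<subseteq> B" using cp quo_normal_preimg V unfolding critical_pair_def by blast
    then have "proj ` preimg V \<subseteq> proj ` B" by (rule image_mono)
    then show "V \<subseteq> proj ` B" unfolding proj_preimg[OF Vc] .
  qed (use quo_normal_proj A B in auto)
qed

text \<open>The third isomorphism theorem: the canonical map in the quotient, pulled back along the
  projection, has domain \<open>A\<close> and kernel \<open>B\<close>, just as \<open>\<phi>\<close>
  has.\<close>

lemma quo_section_iso:
  assumes A: "subgroup A G" and B: "N \<subseteq> B" and e: "epi_ker G A B Q \<phi>"
  shows "((G Mod N)\<lparr>carrier := proj ` A\<rparr> Mod (proj ` B)) \<cong> Q"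
proof -
  note sB = epi_ker_subgroup[OF e A] and BA = epi_ker_subset[OF e]
  have "N \<subseteq> A" using B BA by simp
  have Ac: "A \<subseteq> carrier G" and Bc: "B \<subseteq> carrier G" using subgroup.subset A sB by auto
  interpret F: group "G Mod N" by (rule quo_group)
  let ?Q = "(G Mod N)\<lparr>carrier := proj ` A\<rparr> Mod (proj ` B)"
  have "epi_ker (G Mod N) (proj ` A) (proj ` B) ?Q (\<lambda>x. proj ` B #>\<^bsub>G Mod N\<^esub> x)"
    by (rule F.epi_canonical[OF proj_subgroup[OF A] proj_subgroup[OF sB] image_mono[OF BA]
      proj_normalises[OF Ac Bc epi_ker_normalised[OF e A]]])
  from epi_pullback(2)[OF subgroup_self quo_epi proj_subgroup[OF A] this]
  have "epi_ker G (preimg (proj ` A)) (preimg (proj ` B)) ?Q ((\<lambda>x. proj ` B #>\<^bsub>G Mod N\<^esub> x) \<circ> proj)"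
    unfolding preimg_def .
  then have "epi_ker G A B ?Q ((\<lambda>x. proj ` B #>\<^bsub>G Mod N\<^esub> x) \<circ> proj)"
    using preimg_proj A sB B \<open>N \<subseteq> A\<close> by simp
  from epi_unique_iso[OF this A e] show ?thesis by (auto simp: is_iso_def)
qed

lemma quo_centralizer:
  assumes "R \<subseteq> carrier G"
  shows "centralizer_of (G Mod N) (proj ` R) = proj ` (cent_mod R N)"
proof -
  have *: "(N #> g) \<otimes>\<^bsub>G Mod N\<^esub> (N #> r) = (N #> r) \<otimes>\<^bsub>G Mod N\<^esub> (N #> g) \<longleftrightarrow> g \<otimes> r \<otimes> inv g \<otimes> inv r \<in> N"
    if "g \<in> carrier G" "r \<in> carrier G" for g r
  proof -
    have "(N #> g) \<otimes>\<^bsub>G Mod N\<^esub> (N #> r) = (N #> r) \<otimes>\<^bsub>G Mod N\<^esub> (N #> g) \<longleftrightarrow> N #> (g \<otimes> r) = N #> (r \<otimes> g)"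
      using that epi_mult[OF quo_epi, symmetric] by simp
    also have "\<dots> \<longleftrightarrow> (g \<otimes> r) \<otimes> inv (r \<otimes> g) \<in> N"
      using epi_eq_iff[OF quo_epi subgroup_self] that by simp
    also have "(g \<otimes> r) \<otimes> inv (r \<otimes> g) = g \<otimes> r \<otimes> inv g \<otimes> inv r" using that by (simp add: group_simps)
    finally show ?thesis .
  qed
  show ?thesis
  proof (intro equalityI subsetI)
    fix a assume a: "a \<in> centralizer_of (G Mod N) (proj ` R)"
    then obtain g where g: "g \<in> carrier G" "a = N #> g" by (auto simp: centralizer_of_def carrier_FactGroup)
    have "g \<otimes> r \<otimes> inv g \<otimes> inv r \<in> N" if r: "r \<in> R" for r
    proof -
      have "(N #> g) \<otimes>\<^bsub>G Mod N\<^esub> (N #> r) = (N #> r) \<otimes>\<^bsub>G Mod N\<^esub> (N #> g)"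
        using a r unfolding g(2) centralizer_of_def by blast
      then show ?thesis using *[OF g(1) subsetD[OF assms r]] by blast
    qed
    then have "g \<in> cent_mod R N" using g by (simp add: cent_mod_def)
    then show "a \<in> proj ` cent_mod R N" using g by auto
  next
    fix a assume "a \<in> proj ` cent_mod R N"
    then obtain g where g: "g \<in> cent_mod R N" "a = N #> g" by auto
    then have gc: "g \<in> carrier G" by (simp add: cent_mod_def)
    have "(N #> g) \<otimes>\<^bsub>G Mod N\<^esub> (N #> r) = (N #> r) \<otimes>\<^bsub>G Mod N\<^esub> (N #> g)" if r: "r \<in> R" for r
      using *[OF gc subsetD[OF assms r]] g(1) r by (simp add: cent_mod_def)
    moreover have "a \<in> carrier (G Mod N)" using g(2) gc by (auto simp: carrier_FactGroup)
    ultimately show "a \<in> centralizer_of (G Mod N) (proj ` R)"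
      unfolding centralizer_of_def g(2) by blast
  qed
qed

lemma quo_product_subset:
  assumes "R \<subseteq> carrier G" "R \<subseteq> W" "cent_mod R N \<subseteq> W" "proj ` W \<subseteq> H" "subgroup H (G Mod N)"
  shows "proj ` R <#>\<^bsub>G Mod N\<^esub> centralizer_of (G Mod N) (proj ` R) \<subseteq> H"
proof (rule group.set_mult_least[OF quo_group _ _ assms(5)])
  show "proj ` R \<subseteq> H" using assms(2,4) by blast
  show "centralizer_of (G Mod N) (proj ` R) \<subseteq> H" unfolding quo_centralizer[OF assms(1)] using assms(3,4) by blast
qed

text \<open>Pull \<open>H\<close> back to \<open>G\<close>. If the preimage lies in all maximal
  invariant subgroups of \<open>A\<close>, then \<open>H\<close> lies in all maximal normal
  subgroups of the image of \<open>A\<close>, since these pull back to members of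
  \<open>maxinv A A\<close>. Otherwise the preimage contains the obliquity bound \<open>W\<close>,
  which contains both \<open>R\<close> and its centraliser modulo \<open>N\<close>.\<close>

lemma quo_dichotomy:
  assumes A: "A \<lhd> G" "N \<subseteq> A" and R: "R \<subseteq> carrier G" "R \<subseteq> W" "cent_mod R N \<subseteq> W"
    and W: "\<And>H. invsub A H \<Longrightarrow> \<not> H \<subseteq> A \<inter> \<Inter>(maxinv A A) \<Longrightarrow> W \<subseteq> H"
    and H: "subgroup H (G Mod N)" "normalises (G Mod N) (proj ` A) H"
  shows "proj ` R <#>\<^bsub>G Mod N\<^esub> centralizer_of (G Mod N) (proj ` R) \<subseteq> H \<or>
    (\<forall>M. subgroup M (G Mod N) \<and> M \<subset> proj ` A \<and> normalises (G Mod N) (proj ` A) M \<and>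
      (\<forall>M'. subgroup M' (G Mod N) \<longrightarrow> M \<subseteq> M' \<longrightarrow> M' \<subset> proj ` A \<longrightarrow> normalises (G Mod N) (proj ` A) M' \<longrightarrow> M' = M)
      \<longrightarrow> H \<subseteq> M)"
proof (cases "preimg H \<subseteq> A \<inter> \<Inter>(maxinv A A)")
  case True
  note sA = normal_imp_subgroup[OF A(1)] and Ac = subgroup.subset[OF normal_imp_subgroup[OF A(1)]]
  have key: "H \<subseteq> M" if M: "subgroup M (G Mod N)" "M \<subset> proj ` A" "normalises (G Mod N) (proj ` A) M"
    and max: "\<And>M'. subgroup M' (G Mod N) \<Longrightarrow> M \<subseteq> M' \<Longrightarrow> M' \<subset> proj ` A \<Longrightarrow> normalises (G Mod N) (proj ` A) M' \<Longrightarrow> M' = M" for M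
  proof -
    note Mc = subgroup.subset[OF M(1)]
    have "preimg M \<in> maxinv A A"
      unfolding maxinv_def
    proof (intro CollectI conjI allI impI)
      show "invsub A (preimg M)"
        using preimg_subgroup[OF M(1)] preimg_normalises[OF M(3) Ac] by (intro invsub_openI)
      have "preimg M \<subseteq> A" using preimg_mono[of M "proj ` A"] M(2) preimg_proj[OF sA A(2)] by auto
      moreover have "preimg M \<noteq> A" using proj_preimg[OF Mc] M(2) by auto
      ultimately show "preimg M \<subset> A" by auto
      fix M' assume M': "invsub A M' \<and> preimg M \<subseteq> M' \<and> M' \<subset> A"
      then have s': "subgroup M' G" "normalises G A M'" by (auto simp: invsub_def)
      have NM': "N \<subseteq> M'" using preimg_subgroup(2)[OF M(1)] M' by auto
      have pM': "preimg (proj ` M') = M'" using preimg_proj[OF s'(1) NM'] .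
      have "proj ` M' = M"
      proof (rule max)
        show "subgroup (proj ` M') (G Mod N)" using proj_subgroup s' by blast
        have "proj ` preimg M \<subseteq> proj ` M'" using M' by blast
        then show "M \<subseteq> proj ` M'" unfolding proj_preimg[OF Mc] .
        have "proj ` M' \<noteq> proj ` A"
        proof
          assume "proj ` M' = proj ` A"
          then have "preimg (proj ` M') = preimg (proj ` A)" by (rule arg_cong)
          then have "M' = A" unfolding pM' preimg_proj[OF sA A(2)] .
          then show False using M' by blast
        qed
        moreover have "M' \<subseteq> A" using M' by auto
        ultimately show "proj ` M' \<subset> proj ` A" by (intro psubsetI image_mono)
        show "normalises (G Mod N) (proj ` A) (proj ` M')"
          using proj_normalises[OF Ac subgroup.subset[OF s'(1)] s'(2)] .
      qed
      then show "M' = preimg M" using pM' by simp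
    qed
    then have "preimg H \<subseteq> preimg M" using True by auto
    then have "proj ` preimg H \<subseteq> proj ` preimg M" by (rule image_mono)
    then show "H \<subseteq> M" unfolding proj_preimg[OF Mc] proj_preimg[OF subgroup.subset[OF H(1)]] .
  qed
  show ?thesis
  proof (intro disjI2 allI impI, elim conjE)
    fix M assume M: "subgroup M (G Mod N)" "M \<subset> proj ` A" "normalises (G Mod N) (proj ` A) M"
      and max: "\<forall>M'. subgroup M' (G Mod N) \<longrightarrow> M \<subseteq> M' \<longrightarrow> M' \<subset> proj ` A \<longrightarrow>
        normalises (G Mod N) (proj ` A) M' \<longrightarrow> M' = M"
    show "H \<subseteq> M" by (rule key[OF M]) (rule max[rule_format])
  qed
next
  case False
  have "invsub A (preimg H)"
    using preimg_subgroup[OF H(1)] preimg_normalises[OF H(2)] subgroup.subset[OF normal_imp_subgroup[OF A(1)]]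
    by (intro invsub_openI)
  then have "W \<subseteq> preimg H" using W False by blast
  then have "proj ` W \<subseteq> proj ` preimg H" by (rule image_mono)
  then have "proj ` W \<subseteq> H" unfolding proj_preimg[OF subgroup.subset[OF H(1)]] .
  then show ?thesis by (intro disjI1 quo_product_subset[OF R _ H(1)])
qed

lemma finite_quo: "finite (carrier (G Mod N))"
  using open_finite_index[OF normal_imp_subgroup[OF N(1)] N(2)] by (simp add: FactGroup_def)

end

end

text \<open>If all factors of a central product are either large or contained in \<open>M\<close>, then some factor is large,
  hence contains all the factors that centralise it.\<close>
lemma not_centrally_decomposable:
  fixes G :: "'a monoid" (structure)
  assumes "group G" and N: "subgroup N G" "A \<subseteq> N" and M: "subgroup M G" "M \<subset> A" and PA: "P \<subseteq> C" "centralizer_of G P \<subseteq> C"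
    and dich: "\<And>H. subgroup H G \<Longrightarrow> normalises G A H \<Longrightarrow> C \<subseteq> H \<or> H \<subseteq> M"
  shows "\<not> centrally_decomposable (G\<lparr>carrier := N\<rparr>)"
proof
  interpret group G by fact
  assume "centrally_decomposable (G\<lparr>carrier := N\<rparr>)"
  then obtain \<H> where raw: "\<forall>H\<in>\<H>. subgroup H (G\<lparr>carrier := N\<rparr>) \<and> H \<noteq> carrier (G\<lparr>carrier := N\<rparr>)"
    "generate (G\<lparr>carrier := N\<rparr>) (\<Union>\<H>) = carrier (G\<lparr>carrier := N\<rparr>)"
    "\<forall>H\<in>\<H>. \<forall>H'\<in>\<H>. H \<noteq> H' \<longrightarrow> (\<forall>x\<in>H. \<forall>y\<in>H'. x \<otimes>\<^bsub>G\<lparr>carrier := N\<rparr>\<^esub> y = y \<otimes>\<^bsub>G\<lparr>carrier := N\<rparr>\<^esub> x)"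
    unfolding centrally_decomposable_def by (elim exE conjE)
  have H: "subgroup H (G\<lparr>carrier := N\<rparr>) \<and> H \<noteq> N" if "H \<in> \<H>" for H using raw(1) that by simp
  have gen: "generate (G\<lparr>carrier := N\<rparr>) (\<Union>\<H>) = N" using raw(2) by simp
  have com: "x \<otimes> y = y \<otimes> x" if "H \<in> \<H>" "H' \<in> \<H>" "H \<noteq> H'" "x \<in> H" "y \<in> H'" for H H' x y
    using raw(3) that by simp
  have sH: "subgroup H G" if "H \<in> \<H>" for H using H[OF that] incl_subgroup[OF N(1)] by blast
  have HN: "H \<subseteq> N" if "H \<in> \<H>" for H using H[OF that] subgroup.subset[of H "G\<lparr>carrier := N\<rparr>"] by simp
  have gen': "generate G (\<Union>\<H>) = N"
    using gen generate_consistent[OF _ N(1), of "\<Union>\<H>"] HN by blast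
  have genle: "N \<subseteq> Z" if "subgroup Z G" "\<And>H. H \<in> \<H> \<Longrightarrow> H \<subseteq> Z" for Z
    unfolding gen'[symmetric] by (rule generate_subgroup_incl) (use that in auto)
  have norm: "normalises G N H" if h: "H \<in> \<H>" for H
  proof -
    \<comment> \<open>The normaliser of \<open>H\<close>, with conjugation in both directions so
      that closure under inverses is immediate. The other factors lie in it because they commute
      with \<open>H\<close>.\<close>
    let ?Z = "{x \<in> carrier G. (\<forall>h\<in>H. x \<otimes> h \<otimes> inv x \<in> H) \<and> (\<forall>h\<in>H. inv x \<otimes> h \<otimes> x \<in> H)}"
    have Hc: "y \<in> carrier G" if "y \<in> H" for y using subgroup.mem_carrier[OF sH[OF h] that] .
    have "subgroup ?Z G"
    proof (rule subgroupI)
      show "?Z \<noteq> {}" using Hc by (auto intro!: exI[of _ \<one>])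
      fix x assume x: "x \<in> ?Z"
      then show "inv x \<in> ?Z" by auto
      fix y assume y: "y \<in> ?Z"
      have "(x \<otimes> y) \<otimes> k \<otimes> inv (x \<otimes> y) \<in> H" "inv (x \<otimes> y) \<otimes> k \<otimes> (x \<otimes> y) \<in> H" if k: "k \<in> H" for k
      proof -
        have "x \<otimes> (y \<otimes> k \<otimes> inv y) \<otimes> inv x \<in> H" "inv y \<otimes> (inv x \<otimes> k \<otimes> x) \<otimes> y \<in> H" using x y k by auto
        then show "(x \<otimes> y) \<otimes> k \<otimes> inv (x \<otimes> y) \<in> H" "inv (x \<otimes> y) \<otimes> k \<otimes> (x \<otimes> y) \<in> H"
          using x y Hc[OF k] by (simp_all add: group_simps)
      qed
      then show "x \<otimes> y \<in> ?Z" using x y by auto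
    qed auto
    moreover have "H' \<subseteq> ?Z" if h': "H' \<in> \<H>" for H'
    proof
      fix x assume x: "x \<in> H'"
      have xc: "x \<in> carrier G" using subgroup.mem_carrier[OF sH[OF h'] x] .
      have "x \<otimes> k \<otimes> inv x \<in> H \<and> inv x \<otimes> k \<otimes> x \<in> H" if k: "k \<in> H" for k
      proof (cases "H' = H")
        case True
        then show ?thesis using x k subgroup.m_closed[OF sH[OF h]] subgroup.m_inv_closed[OF sH[OF h]] by simp
      next
        case False
        then have "x \<otimes> k = k \<otimes> x" using com[OF h' h _ x k] by simp
        then have "x \<otimes> k \<otimes> inv x = k" "inv x \<otimes> k \<otimes> x = k"
          using xc Hc[OF k] by (simp_all add: m_assoc, metis inv_mult_cancel)
        then show ?thesis using k by simp
      qed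
      then show "x \<in> ?Z" using xc by auto
    qed
    ultimately have "N \<subseteq> ?Z" by (rule genle)
    then show ?thesis by (auto simp: normalises_def)
  qed
  \<comment> \<open>If all factors were inside \<open>M\<close>, so would be the group
    \<open>N\<close> that they generate, although \<open>M\<close> is properly inside
    \<open>A\<close>.\<close>
  have "\<exists>H\<in>\<H>. \<not> H \<subseteq> M"
    using genle[OF M(1)] N(2) M(2) by blast
  then obtain H0 where H0: "H0 \<in> \<H>" "\<not> H0 \<subseteq> M" by blast
  then have CH: "C \<subseteq> H0" using dich[OF sH[OF H0(1)] normalises_mono[OF norm[OF H0(1)] N(2)]] by blast
  have "N \<subseteq> H0"
  proof (rule genle[OF sH[OF H0(1)]])
    fix H assume h: "H \<in> \<H>"
    show "H \<subseteq> H0"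
    proof (cases "H = H0")
      case False
      have "x \<in> centralizer_of G P" if x: "x \<in> H" for x
        using com[OF h H0(1) False x] PA(1) CH subgroup.mem_carrier[OF sH[OF h] x] by (auto simp: centralizer_of_def)
      then show ?thesis using PA(2) CH by blast
    qed simp
  qed
  then show False using H[OF H0(1)] HN[OF H0(1)] by blast
qed

context profinite
begin

text \<open>A compatible family is a decreasing sequence of nonempty closed cosets, and a point of
  its intersection is a preimage. The homeomorphism is then automatic for a continuous bijection
  from a compact to a Hausdorff space.\<close>

lemma inverse_limit:
  assumes S: "\<And>n. S n \<lhd> G" "\<And>n. openin T (S n)" and dec: "\<And>n. S (Suc n) \<subseteq> S n"
    and triv: "(\<Inter>n. S n) = {\<one>}"
  shows "(\<lambda>x n. qmap G S n x) \<in> iso G (inv_lim_group G S)"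
    and "homeomorphic_map T (inv_lim_top G T S) (\<lambda>x n. qmap G S n x)"
proof -
  let ?\<Phi> = "\<lambda>x n. qmap G S n x"
  have sS: "subgroup (S n) G" for n by (rule normal_imp_subgroup[OF S(1)])
  have e: "epi_ker G (carrier G) (S (Suc n)) (Gq G S n) (\<lambda>x. qmap G S n x)" for n
    unfolding Gq_def qmap_def by (rule quo_epi[OF S(1,2)])
  have cc: "carrier (Gq G S n) = rcosets (S (Suc n))" for n by (simp add: Gq_def FactGroup_def)
  have top: "Tq G T S n = discrete_topology (rcosets (S (Suc n)))" for n
    unfolding Tq_def by (rule quot_top_discrete[OF S(2)])
  have absorb: "S n <#> S (Suc n) = S n" for n
    by (intro equalityI set_mult_upper1 sS set_mult_least dec subset_refl)
  have im: "?\<Phi> x \<in> inv_lim_carrier G S" if x: "x \<in> carrier G" for x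
    unfolding inv_lim_carrier_def
  proof (intro CollectI allI conjI)
    fix n
    show "qmap G S n x \<in> carrier (Gq G S n)" using x by (auto simp: cc qmap_def RCOSETS_def)
    have "S (Suc n) <#> (S (Suc (Suc n)) #> x) = (S (Suc n) <#> S (Suc (Suc n))) #> x"
      using x by (intro setmult_rcos_assoc subgroup.subset sS)
    then show "rho G S n (qmap G S (Suc n) x) = qmap G S n x" by (simp add: rho_def qmap_def absorb)
  qed
  have inj: "x = y" if x: "x \<in> carrier G" and y: "y \<in> carrier G" and eq: "?\<Phi> x = ?\<Phi> y" for x y
  proof -
    have mem: "x \<otimes> inv y \<in> S (Suc n)" for n
      using epi_eq_iff[OF e[of n] subgroup_self x y] fun_cong[OF eq, of n] by simp
    \<comment> \<open>\<open>qmap\<close> at \<open>n\<close> uses \<open>S (Suc n)\<close>; the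
      missing index 0 follows from the inclusion of \<open>S 1\<close> in
      \<open>S 0\<close>.\<close>
    then have "x \<otimes> inv y \<in> S n" for n using dec by (cases n) auto
    then have "x \<otimes> inv y = \<one>" using triv by blast
    then show ?thesis using x y by (metis inv_closed inv_equality inv_inv)
  qed
  have surj: "g \<in> ?\<Phi> ` carrier G" if g: "g \<in> inv_lim_carrier G S" for g
  proof -
    have gn: "g n \<in> rcosets (S (Suc n))" "rho G S n (g (Suc n)) = g n" for n
      using g by (auto simp: inv_lim_carrier_def cc)
    have closed: "closedin T (g n)" for n
    proof -
      obtain a where "a \<in> carrier G" "g n = S (Suc n) #> a" using gn(1)[of n] by (auto simp: RCOSETS_def)
      then show ?thesis using closedin_r_coset[OF open_subgroup_closed[OF sS S(2)]] by simp
    qed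
    have "g (Suc n) \<subseteq> g n" for n
    proof
      fix x assume x: "x \<in> g (Suc n)"
      then have "x \<in> carrier G" using closedin_subset[OF closed] by auto
      moreover have "\<one> \<otimes> x \<in> S (Suc n) <#> g (Suc n)"
        using x subgroup.one_closed[OF sS] unfolding set_mult_def by blast
      ultimately show "x \<in> g n" using gn(2)[of n] by (simp add: rho_def)
    qed
    moreover have "g n \<noteq> {}" for n
      using subgroup.rcosets_non_empty[OF sS gn(1)] .
    \<comment> \<open>Compactness with the empty set as the open set: an empty intersection would
      make some coset empty.\<close>
    ultimately have "(\<Inter>n. g n) \<noteq> {}" using compact_decseq[of g "{}"] closed by auto
    then obtain x where x: "\<And>n. x \<in> g n" by auto
    then have xc: "x \<in> carrier G" using closedin_subset[OF closed[of 0]] by auto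
    have "qmap G S n x = g n" for n
    proof -
      obtain a where a: "a \<in> carrier G" "g n = S (Suc n) #> a" using gn(1)[of n] by (auto simp: RCOSETS_def)
      then show ?thesis using repr_independence[OF _ a(1) sS] x[of n] by (simp add: qmap_def)
    qed
    then show ?thesis using xc by (intro image_eqI[of _ _ x]) (auto simp: fun_eq_iff)
  qed
  have image: "?\<Phi> ` carrier G = inv_lim_carrier G S" using im surj by blast
  show "?\<Phi> \<in> iso G (inv_lim_group G S)"
    unfolding iso_def
  proof (intro CollectI conjI homI)
    show "bij_betw ?\<Phi> (carrier G) (carrier (inv_lim_group G S))"
      using inj image by (auto simp: bij_betw_def inj_on_def inv_lim_group_def)
    show "?\<Phi> x \<in> carrier (inv_lim_group G S)" if "x \<in> carrier G" for x
      using im[OF that] by (simp add: inv_lim_group_def)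
    show "?\<Phi> (x \<otimes> y) = ?\<Phi> x \<otimes>\<^bsub>inv_lim_group G S\<^esub> ?\<Phi> y" if "x \<in> carrier G" "y \<in> carrier G" for x y
      using epi_mult[OF e that] by (simp add: inv_lim_group_def)
  qed
  have sub: "inv_lim_carrier G S \<subseteq> topspace (product_topology (\<lambda>n. Tq G T S n) UNIV)"
    by (auto simp: inv_lim_carrier_def top cc)
  then have ts: "topspace (inv_lim_top G T S) = inv_lim_carrier G S"
    unfolding inv_lim_top_def by (simp add: Int_absorb1)
  show "homeomorphic_map T (inv_lim_top G T S) ?\<Phi>"
  proof (rule continuous_imp_homeomorphic_map)
    show "compact_space T" by (rule compact)
    show "Hausdorff_space (inv_lim_top G T S)"
      unfolding inv_lim_top_def
      by (intro Hausdorff_space_subtopology) (simp add: Hausdorff_space_product_topology top)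
    show "?\<Phi> ` topspace T = topspace (inv_lim_top G T S)" using image ts by simp
    show "inj_on ?\<Phi> (topspace T)" using inj by (auto simp: inj_on_def)
    have "continuous_map T (Tq G T S n) (\<lambda>x. qmap G S n x)" for n
      unfolding continuous_map_def
    proof (intro conjI allI impI)
      show "qmap G S n \<in> topspace T \<rightarrow> topspace (Tq G T S n)" by (auto simp: top qmap_def RCOSETS_def)
      fix U assume "openin (Tq G T S n) U"
      then have U: "U \<subseteq> rcosets (S (Suc n))" by (simp add: top)
      then have "openin T (\<Union>U)"
        by (intro openin_Union) (auto simp: RCOSETS_def intro: openin_r_coset S)
      moreover have "\<Union>U = {x \<in> topspace T. qmap G S n x \<in> U}"
      proof (intro equalityI subsetI)
        fix x assume "x \<in> \<Union>U"
        then obtain C where C: "C \<in> U" "x \<in> C" by auto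
        then obtain a where a: "a \<in> carrier G" "C = S (Suc n) #> a" using U by (auto simp: RCOSETS_def)
        then have "S (Suc n) #> x = C" using repr_independence[OF _ a(1) sS] C by simp
        moreover have "x \<in> carrier G" using C U subgroup.rcosets_carrier[OF sS is_group] by blast
        ultimately show "x \<in> {x \<in> topspace T. qmap G S n x \<in> U}" using C by (simp add: qmap_def)
      next
        fix x assume "x \<in> {x \<in> topspace T. qmap G S n x \<in> U}"
        then show "x \<in> \<Union>U" using rcos_self[OF _ sS] by (auto simp: qmap_def)
      qed
      ultimately show "openin T {x \<in> topspace T. qmap G S n x \<in> U}" by simp
    qed
    then have "continuous_map T (product_topology (\<lambda>n. Tq G T S n) UNIV) ?\<Phi>"
      by (simp add: continuous_map_componentwise_UNIV)
    then show "continuous_map T (inv_lim_top G T S) ?\<Phi>"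
      unfolding inv_lim_top_def continuous_map_in_subtopology using im by auto
  qed
qed

section \<open>Building the sequence of critical pairs\<close>

context
  fixes \<C> :: "nat monoid set"
  assumes ji: "ji_under (carrier G)" and cl: "class_of_finite_simple \<C>" and st: "condition_starstar G T \<C>"
    and nv: "\<And>p. Factorial_Ring.prime p \<Longrightarrow> \<not> virtually_pro_p G T p"
begin

lemma class_sectionD:
  assumes "class_section \<C> R S"
  shows "R \<lhd> G" "S \<lhd> G" "S \<subset> R" "openin T R" "openin T S" "critical_pair G T R S"
proof -
  show 1: "R \<lhd> G" "S \<lhd> G" "S \<subset> R" "openin T S" "critical_pair G T R S"
    using assms by (auto simp: class_section_def critical_pair_def closed_normal_def)
  then show "openin T R"
    using open_overgroup[OF normal_imp_subgroup[OF 1(2)] 1(4) normal_imp_subgroup[OF 1(1)]] by blast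
qed

text \<open>\<open>W R S\<close> prescribes how deep the next pair must lie. The plain case takes
  \<open>S\<close>; the hereditary case intersects it with an obliquity bound for
  \<open>R\<close>.\<close>

lemma ex_section_sequence:
  assumes W: "\<And>R S. class_section \<C> R S \<Longrightarrow> W R S \<lhd> G \<and> openin T (W R S)"
  shows "\<exists>R S. \<forall>n::nat. class_section \<C> (R n) (S n) \<and> R (Suc n) \<subseteq> W (R n) (S n) \<and>
    cent_mod (R (Suc n)) (S (Suc n)) \<subseteq> W (R n) (S n)"
proof -
  note ex = ex_class_section[OF ji cl st nv]
  have "\<exists>f. \<forall>n::nat. class_section \<C> (fst (f n)) (snd (f n)) \<and>
    (fst (f (Suc n)) \<subseteq> W (fst (f n)) (snd (f n)) \<and>
     cent_mod (fst (f (Suc n))) (snd (f (Suc n))) \<subseteq> W (fst (f n)) (snd (f n)))"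
  proof (rule dependent_nat_choice)
    show "\<exists>x. class_section \<C> (fst x) (snd x)"
      using ex[of "carrier G"] ji by (auto simp: ji_under_def)
    fix x :: "'a set \<times> 'a set" and n :: nat
    assume "class_section \<C> (fst x) (snd x)"
    then have "W (fst x) (snd x) \<lhd> G \<and> openin T (W (fst x) (snd x))" by (rule W)
    then obtain R' S' where "class_section \<C> R' S'" "R' \<subseteq> W (fst x) (snd x)" "cent_mod R' S' \<subseteq> W (fst x) (snd x)"
      using ex by blast
    then show "\<exists>y. class_section \<C> (fst y) (snd y) \<and>
        (fst y \<subseteq> W (fst x) (snd x) \<and> cent_mod (fst y) (snd y) \<subseteq> W (fst x) (snd x))"
      by (intro exI[of _ "(R', S')"]) simp
  qed
  then obtain f where f: "\<forall>n::nat. class_section \<C> (fst (f n)) (snd (f n)) \<and>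
    (fst (f (Suc n)) \<subseteq> W (fst (f n)) (snd (f n)) \<and>
     cent_mod (fst (f (Suc n))) (snd (f (Suc n))) \<subseteq> W (fst (f n)) (snd (f n)))" by (rule exE)
  show ?thesis
    by (intro exI[of _ "\<lambda>n. fst (f n)"] exI[of _ "\<lambda>n. snd (f n)"]) (rule f)
qed

lemma good_pairs_if_sequence:
  assumes sec: "\<And>n. class_section \<C> (R n) (S n)"
    and R: "\<And>n. R (Suc n) \<subseteq> S n" and cent: "\<And>n. cent_mod (R (Suc n)) (S (Suc n)) \<subseteq> S n"
  shows "good_pairs G T \<C> R S"
proof -
  note D = class_sectionD[OF sec]
  have dec: "S (Suc n) \<subset> S n" for n using D(3)[of "Suc n"] R by blast
  let ?I = "\<Inter>n. S n"
  have iS: "invsub (carrier G) (S n)" for n using D(2,5) by (auto simp: normal_iff_normalises intro: invsub_openI)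
  have I: "invsub (carrier G) ?I" using iS by (intro invsub_Inter) auto
  have triv: "?I = {\<one>}"
  proof (rule ccontr)
    assume "?I \<noteq> {\<one>}"
    then have "openin T ?I" using ji_open[OF ji I] by simp
    then obtain n where "S n \<subseteq> ?I"
      using compact_decseq[of S ?I] invsubD(2)[OF iS] dec by (metis less_imp_le subset_refl)
    then show False using dec[of n] by auto
  qed
  have "critical_pair (Gq G S n) (Tq G T S n) (An G R S n) (Bn G S n) \<and>
    (\<exists>K\<in>\<C>. \<exists>k::nat. ((Gq G S n)\<lparr>carrier := An G R S n\<rparr> Mod Bn G S n) \<cong> product_group {..<k} (\<lambda>_. K)) \<and>
    Pn G R S n <#>\<^bsub>Gq G S n\<^esub> centralizer_of (Gq G S n) (Pn G R S n) \<subseteq> Bn G S n" for n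
  proof -
    \<comment> \<open>\<open>Gq\<close> at \<open>n\<close> is the quotient by
      \<open>S (Suc n)\<close>, hence the shifted index.\<close>
    note N = D(2,5)[of "Suc n"]
    have defs: "Gq G S n = G Mod S (Suc n)" "Tq G T S n = quot_top G T (S (Suc n))"
      "An G R S n = (\<lambda>x. S (Suc n) #> x) ` R n" "Bn G S n = (\<lambda>x. S (Suc n) #> x) ` S n"
      "Pn G R S n = (\<lambda>x. S (Suc n) #> x) ` R (Suc n)"
      by (auto simp: Gq_def Tq_def An_def Bn_def Pn_def qmap_def)
    have NS: "S (Suc n) \<subseteq> S n" using dec by blast
    obtain K and k :: nat and \<phi> where K: "K \<in> \<C>" "epi_ker G (R n) (S n) (product_group {..<k} (\<lambda>_. K)) \<phi>"
      using sec[of n] by (auto simp: class_section_def)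
    show ?thesis
      unfolding defs
    proof (intro conjI bexI[of _ K] exI[of _ k])
      show "critical_pair (G Mod S (Suc n)) (quot_top G T (S (Suc n)))
          ((\<lambda>x. S (Suc n) #> x) ` R n) ((\<lambda>x. S (Suc n) #> x) ` S n)"
        by (rule quo_critical_pair[OF N D(6) NS])
      show "(G Mod S (Suc n))\<lparr>carrier := (\<lambda>x. S (Suc n) #> x) ` R n\<rparr> Mod (\<lambda>x. S (Suc n) #> x) ` S n
          \<cong> product_group {..<k} (\<lambda>_. K)"
        by (rule quo_section_iso[OF N normal_imp_subgroup[OF D(1)] NS K(2)])
      show "(\<lambda>x. S (Suc n) #> x) ` R (Suc n) <#>\<^bsub>G Mod S (Suc n)\<^esub>
          centralizer_of (G Mod S (Suc n)) ((\<lambda>x. S (Suc n) #> x) ` R (Suc n)) \<subseteq> (\<lambda>x. S (Suc n) #> x) ` S n"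
        by (rule quo_product_subset[OF N subgroup.subset[OF normal_imp_subgroup[OF D(1)]] R cent subset_refl
              proj_subgroup[OF N normal_imp_subgroup[OF D(2)]]])
      show "K \<in> \<C>" by (rule K(1))
    qed
  qed
  then show ?thesis
    unfolding good_pairs_def
    using D(6) R triv inverse_limit[of S, OF D(2,5) less_imp_le[OF dec] triv] by blast
qed

lemma hji_pairs_if_sequence:
  assumes sec: "\<And>n. class_section \<C> (R n) (S n)"
    and R: "\<And>n. R (Suc n) \<subseteq> S n"
    and RW: "\<And>n. R (Suc n) \<subseteq> W n" and cent: "\<And>n. cent_mod (R (Suc n)) (S (Suc n)) \<subseteq> W n"
    and W: "\<And>n H. invsub (R n) H \<Longrightarrow> \<not> H \<subseteq> R n \<inter> \<Inter>(maxinv (R n) (R n)) \<Longrightarrow> W n \<subseteq> H"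
  shows "hji_pairs G T R S"
proof -
  note D = class_sectionD[OF sec]
  have defs: "Gq G S n = G Mod S (Suc n)" "Tq G T S n = quot_top G T (S (Suc n))"
    "An G R S n = (\<lambda>x. S (Suc n) #> x) ` R n" "Pn G R S n = (\<lambda>x. S (Suc n) #> x) ` R (Suc n)" for n
    by (auto simp: Gq_def Tq_def An_def Pn_def qmap_def)
  let ?C = "\<lambda>n. Pn G R S n <#>\<^bsub>Gq G S n\<^esub> centralizer_of (Gq G S n) (Pn G R S n)"
  \<comment> \<open>Maximal normal subgroups of \<open>An\<close>, rephrased through subgroups of
    \<open>Gq\<close>; closedness drops out because the quotient is discrete.\<close>
  let ?max = "\<lambda>n M. subgroup M (Gq G S n) \<and> M \<subset> An G R S n \<and> normalises (Gq G S n) (An G R S n) M \<and>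
      (\<forall>M'. subgroup M' (Gq G S n) \<longrightarrow> M \<subseteq> M' \<longrightarrow> M' \<subset> An G R S n \<longrightarrow> normalises (Gq G S n) (An G R S n) M' \<longrightarrow> M' = M)"
  have grp: "group (Gq G S n)" for n unfolding defs by (rule quo_group[OF D(2,5)])
  have sA: "subgroup (An G R S n) (Gq G S n)" for n
    unfolding defs by (rule proj_subgroup[OF D(2,5) normal_imp_subgroup[OF D(1)]])
  have NR: "S (Suc n) \<subseteq> R n" for n using D(3)[of "Suc n"] D(3)[of n] R[of n] by blast
  have dich: "?C n \<subseteq> H \<or> (\<forall>M. ?max n M \<longrightarrow> H \<subseteq> M)"
    if H: "subgroup H (Gq G S n)" "normalises (Gq G S n) (An G R S n) H" for n H
    using that unfolding defs
    by (intro quo_dichotomy[OF D(2,5) D(1) NR subgroup.subset[OF normal_imp_subgroup[OF D(1)]] RW cent W])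
  have nrm: "M \<lhd> (Gq G S n)\<lparr>carrier := An G R S n\<rparr> \<and> closedin (Tq G T S n) M \<longleftrightarrow>
      subgroup M (Gq G S n) \<and> M \<subseteq> An G R S n \<and> normalises (Gq G S n) (An G R S n) M" for n M
    unfolding group.normal_restrict_iff[OF grp sA] unfolding defs closedin_quo[OF D(2,5)]
    using subgroup.subset by blast
  have max_iff: "?max n M \<longleftrightarrow> M \<lhd> (Gq G S n)\<lparr>carrier := An G R S n\<rparr> \<and> closedin (Tq G T S n) M \<and>
             M \<noteq> An G R S n \<and>
             (\<forall>M'. M' \<lhd> (Gq G S n)\<lparr>carrier := An G R S n\<rparr> \<and> closedin (Tq G T S n) M' \<and>
                   M \<subseteq> M' \<and> M' \<noteq> An G R S n \<longrightarrow> M' = M)" for n M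
    using nrm by (metis psubset_eq)
  have nd: "\<not> centrally_decomposable ((Gq G S n)\<lparr>carrier := N\<rparr>)"
    if N: "closed_normal (Gq G S n) (Tq G T S n) N" "An G R S n \<subseteq> N" for n N
  proof -
    interpret F: group "Gq G S n" by (rule grp)
    have "finite (carrier (Gq G S n))" unfolding defs by (rule finite_quo[OF D(2,5)])
    then have fin: "finite (rcosets\<^bsub>Gq G S n\<^esub> {\<one>\<^bsub>Gq G S n\<^esub>})" by (simp add: RCOSETS_def)
    \<comment> \<open>A nontrivial \<open>An\<close> has a maximal normal subgroup \<open>M\<close>.
      One such \<open>M\<close> is what the argument against central products uses as the upper
      bound for small factors.\<close>
    have "An G R S n \<noteq> {\<one>\<^bsub>Gq G S n\<^esub>}"
    proof
      assume *: "An G R S n = {\<one>\<^bsub>Gq G S n\<^esub>}"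
      have "R n \<subseteq> S (Suc n)"
      proof
        fix x assume x: "x \<in> R n"
        then have "S (Suc n) #> x = \<one>\<^bsub>G Mod S (Suc n)\<^esub>" using * unfolding defs by blast
        then show "x \<in> S (Suc n)"
          using epi_one_iff[OF quo_epi[OF D(2,5)]] x subgroup.mem_carrier[OF normal_imp_subgroup[OF D(1)]] by blast
      qed
      then show False using D(3)[of "Suc n"] D(3)[of n] R[of n] by blast
    qed
    then have "{\<one>\<^bsub>Gq G S n\<^esub>} \<subset> An G R S n" using subgroup.one_closed[OF sA] by blast
    moreover have "normalises (Gq G S n) (An G R S n) {\<one>\<^bsub>Gq G S n\<^esub>}"
      using subgroup.mem_carrier[OF sA] by (auto simp: normalises_def)
    ultimately obtain M where "subgroup M (Gq G S n)" "M \<subset> An G R S n" "normalises (Gq G S n) (An G R S n) M"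
      "\<forall>M'. subgroup M' (Gq G S n) \<longrightarrow> M \<subseteq> M' \<longrightarrow> M' \<subseteq> An G R S n \<longrightarrow>
        normalises (Gq G S n) (An G R S n) M' \<longrightarrow> M' = M \<or> M' = An G R S n"
      using F.ex_maximal_normalised[OF F.triv_subgroup fin] by metis
    then have M: "?max n M" by blast
    have P: "subgroup (Pn G R S n) (Gq G S n)"
      unfolding defs by (rule proj_subgroup[OF D(2,5) normal_imp_subgroup[OF D(1)]])
    have "subgroup (centralizer_of (Gq G S n) (Pn G R S n)) (Gq G S n)"
    proof -
      have c: "closed_normal G T (cent_mod (R (Suc n)) (S (Suc n)))"
        by (rule cent_mod_closed_normal[OF D(1,2) open_subgroup_closed[OF normal_imp_subgroup[OF D(2)] D(5)]])
      have "subgroup (cent_mod (R (Suc n)) (S (Suc n))) G" using c by (simp add: closed_normal_def normal_imp_subgroup)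
      then show ?thesis
        unfolding defs quo_centralizer[OF D(2,5) subgroup.subset[OF normal_imp_subgroup[OF D(1)]]]
        by (rule proj_subgroup[OF D(2,5)])
    qed
    then have PC: "Pn G R S n \<subseteq> ?C n" "centralizer_of (Gq G S n) (Pn G R S n) \<subseteq> ?C n"
      using F.set_mult_upper1[OF P] F.set_mult_upper2[OF P] by auto
    have sN: "subgroup N (Gq G S n)" using N by (simp add: closed_normal_def normal_imp_subgroup)
    show ?thesis
    proof (rule not_centrally_decomposable[OF grp sN N(2) conjunct1[OF M] conjunct1[OF conjunct2[OF M]] PC])
      fix H assume "subgroup H (Gq G S n)" "normalises (Gq G S n) (An G R S n) H"
      from dich[OF this] show "?C n \<subseteq> H \<or> H \<subseteq> M"
      proof
        assume "\<forall>M. ?max n M \<longrightarrow> H \<subseteq> M"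
        then have "?max n M \<longrightarrow> H \<subseteq> M" by (rule spec)
        then have "H \<subseteq> M" using M by (rule mp)
        then show ?thesis by (rule disjI2)
      qed (rule disjI1)
    qed
  qed
  have "?C n \<subseteq> H \<or>
        (\<forall>M. M \<lhd> (Gq G S n)\<lparr>carrier := An G R S n\<rparr> \<and> closedin (Tq G T S n) M \<and>
             M \<noteq> An G R S n \<and>
             (\<forall>M'. M' \<lhd> (Gq G S n)\<lparr>carrier := An G R S n\<rparr> \<and> closedin (Tq G T S n) M' \<and>
                   M \<subseteq> M' \<and> M' \<noteq> An G R S n \<longrightarrow> M' = M)
             \<longrightarrow> H \<subseteq> M)"
    if "closed_subgroup (Gq G S n) (Tq G T S n) H"
      "\<forall>a\<in>An G R S n. \<forall>h\<in>H. a \<otimes>\<^bsub>Gq G S n\<^esub> h \<otimes>\<^bsub>Gq G S n\<^esub> inv\<^bsub>Gq G S n\<^esub> a \<in> H" for n H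
  proof -
    have "subgroup H (Gq G S n)" "normalises (Gq G S n) (An G R S n) H"
      using that by (simp_all only: closed_subgroup_def normalises_def)
    from dich[OF this] show ?thesis unfolding max_iff .
  qed
  then show ?thesis
    unfolding hji_pairs_def by (intro conjI allI impI nd; elim conjE) assumption+
qed

lemma ex_good_pairs: "\<exists>R S. good_pairs G T \<C> R S"
proof -
  obtain R S where "\<And>n::nat. class_section \<C> (R n) (S n) \<and> R (Suc n) \<subseteq> S n \<and> cent_mod (R (Suc n)) (S (Suc n)) \<subseteq> S n"
    using ex_section_sequence[of "\<lambda>R S. S"] class_sectionD(2,5) by blast
  then show ?thesis using good_pairs_if_sequence[of R S] by blast
qed

text \<open>The intersection of the maximal invariant subgroups of \<open>R n\<close> is nontrivial,
  hence open, and can serve as the open set in obliquity for \<open>A = R n\<close>. The resulting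
  bound depends on \<open>R n\<close> alone, so it can be imposed on the next pair.\<close>

lemma ex_hji_pairs:
  assumes hji: "hereditarily_just_infinite G T"
  shows "\<exists>R S. good_pairs G T \<C> R S \<and> hji_pairs G T R S"
proof -
  define P where "P R D \<longleftrightarrow> D \<lhd> G \<and> openin T D \<and>
    (\<forall>H. invsub R H \<and> \<not> H \<subseteq> R \<inter> \<Inter>(maxinv R R) \<longrightarrow> D \<subseteq> H)" for R D
  have ex: "\<exists>D. P R D" if c: "class_section \<C> R S" for R S
  proof -
    note D = class_sectionD[OF c]
    have jR: "ji_under R" by (rule hereditary_ji_under[OF ji cl st nv hji D(1,4)])
    have i: "invsub R R" by (rule ji_invsub_self[OF jR])
    have iU: "invsub R (R \<inter> \<Inter>(maxinv R R))" by (rule invsub_Inter_maxinv[OF jR i])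
    have "R \<inter> \<Inter>(maxinv R R) \<noteq> {\<one>}"
      by (rule Inter_maxinv_nontrivial[OF jR i ji_not_open_one[OF jR D(4)] subset_refl])
    then have oU: "openin T (R \<inter> \<Inter>(maxinv R R))" by (rule ji_open[OF jR iU])
    show ?thesis unfolding P_def by (rule obliquity[OF jR oU subgroup.one_closed[OF invsubD(1)[OF iU]]])
  qed
  define d where "d R = (SOME D. P R D)" for R
  have d: "P R (d R)" if "class_section \<C> R S" for R S
    unfolding d_def using ex[OF that] by (rule someI_ex)
  have "S \<inter> d R \<lhd> G \<and> openin T (S \<inter> d R)" if "class_section \<C> R S" for R S
    using class_sectionD(2,5)[OF that] d[OF that] by (auto simp: P_def normal_subgroup_intersect)
  then obtain R S where RS: "\<And>n::nat. class_section \<C> (R n) (S n) \<and> R (Suc n) \<subseteq> S n \<inter> d (R n) \<and>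
      cent_mod (R (Suc n)) (S (Suc n)) \<subseteq> S n \<inter> d (R n)"
    using ex_section_sequence[of "\<lambda>R S. S \<inter> d R"] by blast
  have sec: "class_section \<C> (R n) (S n)" for n using RS by blast
  have "good_pairs G T \<C> R S" by (rule good_pairs_if_sequence) (use RS in blast)+
  moreover have "hji_pairs G T R S"
  proof (rule hji_pairs_if_sequence[where W = "\<lambda>n. d (R n)"])
    show "d (R n) \<subseteq> H" if "invsub (R n) H" "\<not> H \<subseteq> R n \<inter> \<Inter>(maxinv (R n) (R n))" for n H
      using d[OF sec[of n]] that by (simp add: P_def)
  qed (use RS in blast)+
  ultimately show ?thesis by blast
qed

end

end

theorem theorem9:
  fixes G :: "'a monoid" and T :: "'a topology" and \<C> :: "nat monoid set"
  assumes "profinite_group G T"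
    and "just_infinite G T"
    and "\<And>p::nat. Factorial_Ring.prime p \<Longrightarrow> \<not> virtually_pro_p G T p"
    and "class_of_finite_simple \<C>"
    and "condition_starstar G T \<C>"
  shows "(\<exists>R S. good_pairs G T \<C> R S) \<and>
         (hereditarily_just_infinite G T \<longrightarrow> (\<exists>R S. good_pairs G T \<C> R S \<and> hji_pairs G T R S))"
proof -
  interpret group G using assms(1) by (simp add: profinite_group_def topological_group_def)
  interpret profinite G T by unfold_locales (rule assms(1))
  have ji: "ji_under (carrier G)" by (rule just_infinite_ji_under[OF assms(2)])
  show ?thesis
    using ex_good_pairs[OF ji assms(4,5,3)] ex_hji_pairs[OF ji assms(4,5,3)] by blast
qed

end
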